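(* Let $X$ and $Y$ be Tychonoff spaces and assume that $Y$ is $l$-dominated by $X$. (1) If $X$ is an Eberlein compact, then $Y$ is also an Eberlein compact. (2) If $X$ is a scattered Eberlein compact, then $Y$ is also a scattered Eberlein compact.
   Context: For a Tychonoff space $X$, $C_p(X)$ is the space of all real-valued continuous functions on $X$ endowed with the topology of pointwise convergence. A space $Y$ is $l$-dominated by a space $X$ if there exists a continuous linear surjection from $C_p(X)$ onto $C_p(Y)$. An Eberlein compact is a compact Hausdorff space homeomorphic to a weakly compact subset of a Banach space. A space is scattered if every nonempty subset $A$ of it has a point isolated in $A$. *)

theory Defs
  imports "HOL-Analysis.Analysis"
begin

definition Tychonoff_space :: "'a topology \<Rightarrow> bool" where
  "Tychonoff_space X \<longleftrightarrow> completely_regular_space X \<and> Hausdorff_space X"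

text \<open>Functions on \<open>topspace X\<close> are represented by their \<^const>\<open>extensional\<close> representatives,
  as in \<^const>\<open>product_topology\<close>; the vector space operations are therefore restricted to
  \<open>topspace X\<close> in the definition of \<open>l_dominated_by\<close>.\<close>

definition Cp :: "'a topology \<Rightarrow> ('a \<Rightarrow> real) topology" where
  "Cp X = subtopology (product_topology (\<lambda>_. euclideanreal) (topspace X))
            {f. continuous_map X euclideanreal f}"

definition l_dominated_by :: "'b topology \<Rightarrow> 'a topology \<Rightarrow> bool" where
  "l_dominated_by Y X \<longleftrightarrow>
     (\<exists>\<phi>. continuous_map (Cp X) (Cp Y) \<phi> \<and>
          \<phi> ` topspace (Cp X) = topspace (Cp Y) \<and>
          (\<forall>f\<in>topspace (Cp X). \<forall>g\<in>topspace (Cp X).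
             \<phi> (\<lambda>x\<in>topspace X. f x + g x) = (\<lambda>y\<in>topspace Y. \<phi> f y + \<phi> g y)) \<and>
          (\<forall>c. \<forall>f\<in>topspace (Cp X).
             \<phi> (\<lambda>x\<in>topspace X. c * f x) = (\<lambda>y\<in>topspace Y. c * \<phi> f y)))"

definition scattered_space :: "'a topology \<Rightarrow> bool" where
  "scattered_space X \<longleftrightarrow>
     (\<forall>A. A \<subseteq> topspace X \<and> A \<noteq> {} \<longrightarrow> (\<exists>x\<in>A. openin (subtopology X A) {x}))"

text \<open>Real Banach spaces with an explicit carrier and explicit operations. The class
  \<^class>\<open>banach\<close> does not suffice, because being an Eberlein compact asserts the existence of
  a Banach space and HOL cannot quantify existentially over types.\<close>

locale banach_space_on =
  fixes V :: "'v set"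
    and add :: "'v \<Rightarrow> 'v \<Rightarrow> 'v"
    and scale :: "real \<Rightarrow> 'v \<Rightarrow> 'v"
    and zero :: 'v
    and nrm :: "'v \<Rightarrow> real"
  assumes zero_closed: "zero \<in> V"
    and add_closed: "\<lbrakk>x \<in> V; y \<in> V\<rbrakk> \<Longrightarrow> add x y \<in> V"
    and scale_closed: "x \<in> V \<Longrightarrow> scale c x \<in> V"
    and add_assoc: "\<lbrakk>x \<in> V; y \<in> V; z \<in> V\<rbrakk> \<Longrightarrow> add (add x y) z = add x (add y z)"
    and add_commute: "\<lbrakk>x \<in> V; y \<in> V\<rbrakk> \<Longrightarrow> add x y = add y x"
    and add_zero: "x \<in> V \<Longrightarrow> add x zero = x"
    and add_inverse: "x \<in> V \<Longrightarrow> add x (scale (-1) x) = zero"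
    and scale_add_right: "\<lbrakk>x \<in> V; y \<in> V\<rbrakk> \<Longrightarrow> scale c (add x y) = add (scale c x) (scale c y)"
    and scale_add_left: "x \<in> V \<Longrightarrow> scale (c + d) x = add (scale c x) (scale d x)"
    and scale_scale: "x \<in> V \<Longrightarrow> scale c (scale d x) = scale (c * d) x"
    and scale_one: "x \<in> V \<Longrightarrow> scale 1 x = x"
    and nrm_eq_0: "x \<in> V \<Longrightarrow> nrm x = 0 \<longleftrightarrow> x = zero"
    and nrm_triangle: "\<lbrakk>x \<in> V; y \<in> V\<rbrakk> \<Longrightarrow> nrm (add x y) \<le> nrm x + nrm y"
    and nrm_scale: "x \<in> V \<Longrightarrow> nrm (scale c x) = \<bar>c\<bar> * nrm x"
    and complete:
      "\<lbrakk>\<And>n. s n \<in> V;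
        \<And>e. e > 0 \<Longrightarrow> \<exists>N. \<forall>m\<ge>N. \<forall>n\<ge>N. nrm (add (s m) (scale (-1) (s n))) < e\<rbrakk>
       \<Longrightarrow> \<exists>l\<in>V. (\<lambda>n::nat. nrm (add (s n) (scale (-1) l))) \<longlonglongrightarrow> 0"
begin

definition dual :: "('v \<Rightarrow> real) set" where
  "dual = {f. (\<forall>x\<in>V. \<forall>y\<in>V. f (add x y) = f x + f y) \<and>
              (\<forall>c. \<forall>x\<in>V. f (scale c x) = c * f x) \<and>
              (\<exists>C. \<forall>x\<in>V. \<bar>f x\<bar> \<le> C * nrm x)}"

definition weak_topology :: "'v topology" where
  "weak_topology = topology_generated_by {{x \<in> V. f x \<in> U} | f U. f \<in> dual \<and> open U}"

lemma topspace_weak_topology [simp]: "topspace weak_topology = V"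
proof -
  have "(\<lambda>_. 0) \<in> dual"
    by (auto simp: dual_def intro: exI[of _ 0])
  then have "V \<in> {{x \<in> V. f x \<in> U} | f U. f \<in> dual \<and> open U}"
    by (auto intro!: exI[of _ "\<lambda>_. 0"] exI[of _ UNIV])
  then show ?thesis
    unfolding weak_topology_def topology_generated_by_topspace by blast
qed

end

lemma banach_space_on_UNIV:
  "banach_space_on (UNIV :: 'v::banach set) (+) (*\<^sub>R) 0 norm"
proof
  fix s :: "nat \<Rightarrow> 'v"
  assume "\<And>e. e > 0 \<Longrightarrow> \<exists>N. \<forall>m\<ge>N. \<forall>n\<ge>N. norm (s m + (- 1) *\<^sub>R s n) < e"
  then have "Cauchy s"
    by (simp add: Cauchy_iff)
  then obtain l where "s \<longlonglongrightarrow> l"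
    using Cauchy_convergent convergent_def by blast
  then show "\<exists>l\<in>UNIV. (\<lambda>n. norm (s n + (- 1) *\<^sub>R l)) \<longlonglongrightarrow> 0"
    by (auto intro!: exI[of _ l] tendsto_norm_zero LIM_zero)
qed (auto simp: algebra_simps norm_triangle_ineq)

text \<open>The type argument is the type in which the carrier of the Banach space lives. The choice
  \<open>TYPE(('a \<Rightarrow> real) \<Rightarrow> real)\<close> loses no generality for \<open>X :: 'a topology\<close>: if \<open>h\<close> embeds \<open>X\<close> into a
  Banach space as a weakly compact set, then the space may be replaced by the closed linear span
  of the image of \<open>h\<close>, on which a functional \<open>f\<close> is determined by \<open>f \<circ> h\<close>, so that by
  Hahn-Banach evaluation at the functions \<open>f \<circ> h\<close> injects the span into
  \<open>('a \<Rightarrow> real) \<Rightarrow> real\<close>, along which the Banach space structure can be transported.\<close>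

definition Eberlein_compact_in :: "'v itself \<Rightarrow> 'a topology \<Rightarrow> bool" where
  "Eberlein_compact_in (_ :: 'v itself) X \<longleftrightarrow>
     compact_space X \<and> Hausdorff_space X \<and>
     (\<exists>(V :: 'v set) add scale zero nrm K.
        banach_space_on V add scale zero nrm \<and>
        compactin (banach_space_on.weak_topology V add scale nrm) K \<and>
        X homeomorphic_space subtopology (banach_space_on.weak_topology V add scale nrm) K)"

end

theory Submission
  imports Defs
begin

text \<open>
  Let \<open>\<phi>\<close> be a continuous linear surjection from the continuous functions on \<open>X\<close> onto those on \<open>Y\<close>, and
  write \<open>\<mu> y\<close> for the functional \<open>f \<mapsto> \<phi> f y\<close>. By continuity in the pointwise topology it is a finite
  combination of point evaluations, and by surjectivity every continuous function on \<open>Y\<close> has the form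
  \<open>y \<mapsto> \<mu> y f\<close>. The locale \<open>linear_domination\<close> records exactly this.

  \<^bold>\<open>A compact family on \<open>Y\<close>.\<close> If \<open>X\<close> is compact, then \<open>Y\<close> is feebly compact
  (\<open>feebly_compact_target\<close>): on points of a locally finite sequence of open sets a continuous function
  can be prescribed to grow faster than the norms of the functionals there, whereas a function
  \<open>y \<mapsto> \<mu> y f\<close> cannot. A gliding hump then bounds the norms of all \<open>\<mu> y\<close> uniformly
  (\<open>uniformly_bounded\<close>). An Eberlein compact \<open>X\<close> carries a pointwise compact, uniformly bounded set \<open>Z\<close>
  of continuous functions with uniformly dense linear span (\<open>Eberlein_compact_generating_set\<close>). Its
  image \<open>W\<close> is a uniformly bounded, pointwise compact set of continuous functions on \<open>Y\<close>, and since the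
  \<open>\<mu> y\<close> are uniformly bounded, \<open>W\<close> generates the topology of \<open>Y\<close>.

  \<^bold>\<open>Compactness of \<open>Y\<close>.\<close> Compactness of \<open>X\<close> alone would not give it: the ordinal space \<open>\<omega>\<^sub>1\<close> is
  \<open>l\<close>-dominated by \<open>\<omega>\<^sub>1 + 1\<close>. What has to be shown is that \<open>Y\<close>, embedded by evaluation into the functions
  on \<open>W\<close>, is closed for the pointwise topology (\<open>adherent_attained\<close>). This is a theorem of Preiss and
  Simon, and all of its ingredients come from one double limit argument
  (\<open>double_limit_feebly_compact\<close>): a point in the closure of \<open>Y\<close> is the limit of a sequence from \<open>Y\<close>
  (\<open>adherent_sequence\<close>), and every nonempty open set contains a nonempty open set on which the functions
  of \<open>W\<close> oscillate uniformly little (\<open>fragmented\<close>). Together they yield open sets of \<open>Y\<close> that shrink to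
  the given closure point, and feeble compactness puts that point in \<open>Y\<close>.

  \<^bold>\<open>Weak compactness.\<close> Evaluation maps \<open>Y\<close> into the Banach space of continuous functions on the compact
  set \<open>W\<close>, whose elements live in the type \<open>('b \<Rightarrow> real) \<Rightarrow> real\<close>. By a theorem of Grothendieck this map
  is continuous for the weak topology (\<open>functional_continuous_on_points\<close>): by \<open>adherent_sequence\<close> it is
  enough to look at sequences, and for these there is an elementary dominated convergence theorem for
  bounded functionals (\<open>dominated_convergence\<close>).

  \<^bold>\<open>Scatteredness.\<close> If a nonempty set \<open>A\<close> in \<open>Y\<close> had no isolated point, then by the Baire category
  theorem the supports of the \<open>\<mu> y\<close> would have bounded size on a nonempty open piece of \<open>A\<close>. Where the
  size is maximal the points of the support move continuously with \<open>y\<close>, and, \<open>X\<close> being scattered,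
  they are constant on a smaller piece, which is still infinite. But functionals \<open>\<mu> y\<close> at distinct
  points are linearly independent, and only finitely many can share one finite support
  (\<open>not_constant_support\<close>).
\<close>

section \<open>Pointwise topology and feeble compactness\<close>

abbreviation real_continuous :: "'a topology \<Rightarrow> ('a \<Rightarrow> real) \<Rightarrow> bool" where
  "real_continuous X \<equiv> continuous_map X euclideanreal"

lemma coordinate_separates_functions:
  fixes f g :: "'a \<Rightarrow> 'b::topological_space"
  assumes "open U" "f i \<in> U" "g i \<notin> U"
  shows "\<exists>V. open V \<and> f \<in> V \<and> g \<notin> V"
  using assms by (intro exI[of _ "(\<lambda>h. h i) -` U"]) (auto intro!: open_vimage)

text \<open>The class \<^class>\<open>t2_space\<close> for function types is what lets the Stone-Weierstrass theorem for type class
  topologies be applied inside a product of lines; the superclass instances have to precede it.\<close>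
instance "fun" :: (type, t0_space) t0_space
proof
  fix f g :: "'a \<Rightarrow> 'b"
  assume "f \<noteq> g"
  then obtain i where "f i \<noteq> g i" by auto
  then show "\<exists>U. open U \<and> \<not> (f \<in> U) = (g \<in> U)"
    using separation_t0[of "f i" "g i"] coordinate_separates_functions by metis
qed

instance "fun" :: (type, t1_space) t1_space
proof
  fix f g :: "'a \<Rightarrow> 'b"
  assume "f \<noteq> g"
  then obtain i where "f i \<noteq> g i" by auto
  then show "\<exists>U. open U \<and> f \<in> U \<and> g \<notin> U"
    using separation_t1[of "f i" "g i"] coordinate_separates_functions by metis
qed

instance "fun" :: (type, t2_space) t2_space
proof
  fix f g :: "'a \<Rightarrow> 'b"
  assume "f \<noteq> g"
  then obtain i where "f i \<noteq> g i" by auto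
  then obtain U V where "open U" "open V" "f i \<in> U" "g i \<in> V" "U \<inter> V = {}"
    using hausdorff by metis
  moreover have "open ((\<lambda>h::'a \<Rightarrow> 'b. h i) -` U)" "open ((\<lambda>h::'a \<Rightarrow> 'b. h i) -` V)"
    using \<open>open U\<close> \<open>open V\<close> by (auto intro!: open_vimage)
  ultimately show "\<exists>U V. open U \<and> open V \<and> f \<in> U \<and> g \<in> V \<and> U \<inter> V = {}"
    by (intro exI[of _ "(\<lambda>h. h i) -` U"] exI[of _ "(\<lambda>h. h i) -` V"]) auto
qed

lemma open_fun_coordinate_nbhd:
  fixes p :: "'i \<Rightarrow> real"
  assumes "finite F"
  shows "open {q. \<forall>i\<in>F. \<bar>q i - p i\<bar> < \<delta>}"
proof -
  have "{q. \<forall>i\<in>F. \<bar>q i - p i\<bar> < \<delta>} = {q. \<forall>i\<in>F. q (id i) \<in> ball (p i) \<delta>}"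
    by (auto simp: dist_real_def abs_minus_commute)
  then show ?thesis
    using product_topology_basis'[OF assms, of "\<lambda>i. ball (p i) \<delta>" id] by simp
qed

text \<open>A compact set of functions on an uncountable type need not be sequentially compact. A cluster point,
  tested on finitely many coordinates at a time, is all that the double limit argument asks for.\<close>
lemma compact_fun_sequence_cluster:
  fixes w :: "nat \<Rightarrow> 'i \<Rightarrow> real"
  assumes "compact W" "\<And>n. w n \<in> W"
  obtains v where "v \<in> W"
    "\<And>F \<delta> N. finite F \<Longrightarrow> \<delta> > 0 \<Longrightarrow> \<exists>n\<ge>N. \<forall>i\<in>F. \<bar>w n i - v i\<bar> < \<delta>"
proof -
  have "filtermap w sequentially \<noteq> bot" by (simp add: filtermap_bot_iff)
  moreover have "eventually (\<lambda>x. x \<in> W) (filtermap w sequentially)"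
    using assms(2) by (simp add: eventually_filtermap)
  ultimately obtain v where v: "v \<in> W" "inf (nhds v) (filtermap w sequentially) \<noteq> bot"
    using assms(1) unfolding compact_filter by blast
  have "\<exists>n\<ge>N. \<forall>i\<in>F. \<bar>w n i - v i\<bar> < \<delta>" if F: "finite F" "\<delta> > 0" for F \<delta> N
  proof (rule ccontr)
    assume neg: "\<not> ?thesis"
    let ?U = "{q. \<forall>i\<in>F. \<bar>q i - v i\<bar> < \<delta>}"
    have "eventually (\<lambda>x. x \<in> ?U) (nhds v)"
      using open_fun_coordinate_nbhd[OF F(1), of v \<delta>] F(2) by (intro eventually_nhds_in_open) auto
    moreover have "eventually (\<lambda>x. x \<notin> ?U) (filtermap w sequentially)"
      using neg unfolding eventually_filtermap eventually_sequentially by auto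
    ultimately have "eventually (\<lambda>x. False) (inf (nhds v) (filtermap w sequentially))"
      unfolding eventually_inf by blast
    then show False using v(2) by (simp add: trivial_limit_def)
  qed
  with v(1) that show thesis by blast
qed

lemma compact_box_fun:
  fixes B :: "'i \<Rightarrow> real set"
  assumes "\<And>i. compact (B i)"
  shows "compact (\<Pi>\<^sub>E i\<in>UNIV. B i)"
proof -
  have "compactin (product_topology (\<lambda>_::'i. euclideanreal) UNIV) (\<Pi>\<^sub>E i\<in>UNIV. B i)"
    using assms by (auto simp: compactin_PiE)
  then show ?thesis by (simp add: euclidean_product_topology)
qed

lemma inverse_Suc_eventually_less:
  assumes "\<epsilon> > 0"
  obtains N where "\<And>n. n \<ge> N \<Longrightarrow> 1 / real (Suc n) < \<epsilon>"
proof -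
  obtain N where N: "N \<noteq> 0" "inverse (real N) < \<epsilon>" using assms real_arch_inverse by blast
  have "1 / real (Suc n) \<le> inverse (real N)" if "n \<ge> N" for n using that N(1) by (simp add: field_simps)
  with N(2) that show thesis by (meson le_less_trans)
qed

lemma openin_real_preimage:
  assumes "real_continuous X f" "open S"
  shows "openin X {x \<in> topspace X. f x \<in> S}"
  using assms by (simp add: continuous_map_def)

lemma bounded_real_functions_convergent_subsequence:
  fixes w :: "nat \<Rightarrow> nat \<Rightarrow> real"
  assumes "\<And>k n. \<bar>w k n\<bar> \<le> B k"
  obtains r l where "strict_mono (r :: nat \<Rightarrow> nat)" "\<And>k. (\<lambda>j. w k (r j)) \<longlonglongrightarrow> l k"
proof -
  define K where "K = (\<Pi>\<^sub>E k\<in>UNIV. {-B k..B k})"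
  have "compact K" unfolding K_def by (intro compact_box_fun compact_Icc)
  then have "seq_compact K" by (rule compact_imp_seq_compact)
  moreover have "\<forall>n. (\<lambda>k. w k n) \<in> K" using assms by (auto simp: K_def abs_le_iff minus_le_iff)
  ultimately obtain l r where "strict_mono (r :: nat \<Rightarrow> nat)" "((\<lambda>n. (\<lambda>k. w k n)) \<circ> r) \<longlonglongrightarrow> l"
    unfolding seq_compact_def by (metis (no_types, lifting))
  then have "(\<lambda>j. w k (r j)) \<longlonglongrightarrow> l k" for k
    using continuous_on_tendsto_compose[OF continuous_on_product_coordinates[of k], of "(\<lambda>n. (\<lambda>k. w k n)) \<circ> r" l sequentially]
    by (simp add: o_def)
  with \<open>strict_mono r\<close> that show thesis by blast
qed

lemma completely_regular_bump:
  assumes "completely_regular_space X" "openin X G" "x \<in> G"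
  shows "\<exists>f. real_continuous X f \<and> f x = 1 \<and> (\<forall>z\<in>topspace X. 0 \<le> f z) \<and>
    (\<forall>z\<in>topspace X - G. f z = 0)"
proof -
  have "closedin X (topspace X - G)" "x \<in> topspace X - (topspace X - G)"
    using assms openin_subset by auto
  then obtain f where f: "continuous_map X (top_of_set {0..1::real}) f" "f x = 0" "f ` (topspace X - G) \<subseteq> {1}"
    using assms(1) unfolding completely_regular_space_def by metis
  then have "real_continuous X (\<lambda>z. 1 - f z)"
    by (auto simp: continuous_map_in_subtopology intro!: continuous_map_diff)
  then show ?thesis using f by (intro exI[of _ "\<lambda>z. 1 - f z"]) (auto simp: continuous_map_in_subtopology Pi_iff)
qed

text \<open>Near each point only finitely many summands of \<open>\<Sum>n. a n * h n\<close> with \<open>h n\<close> a bump at \<open>y n\<close> inside \<open>U n\<close> are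
  nonzero, so the sum is continuous however fast \<open>a\<close> grows.\<close>
lemma completely_regular_locally_finite_bumps:
  assumes creg: "completely_regular_space Y"
    and U: "\<And>n::nat. openin Y (U n)" and y: "\<And>n. y n \<in> U n"
    and lf: "\<And>q. q \<in> topspace Y \<Longrightarrow> \<exists>T N. openin Y T \<and> q \<in> T \<and> (\<forall>n\<ge>N. U n \<inter> T = {})"
    and a: "\<And>n. a n \<ge> (0::real)"
  obtains g where "real_continuous Y g" "\<And>n. g (y n) \<ge> a n"
proof -
  have "\<exists>h. real_continuous Y h \<and> h (y n) = 1 \<and> (\<forall>z\<in>topspace Y. 0 \<le> h z) \<and>
      (\<forall>z\<in>topspace Y - U n. h z = 0)" for n
    by (rule completely_regular_bump[OF creg U y])
  then obtain h where h: "\<And>n. real_continuous Y (h n)" "\<And>n. h n (y n) = 1"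
      and h0: "\<And>n z. z \<in> topspace Y \<Longrightarrow> 0 \<le> h n z" and hU: "\<And>n z. z \<in> topspace Y - U n \<Longrightarrow> h n z = 0"
    by metis
  from lf obtain Q M where Q: "\<And>q. q \<in> topspace Y \<Longrightarrow> openin Y (Q q) \<and> q \<in> Q q"
      "\<And>q n. q \<in> topspace Y \<Longrightarrow> n \<ge> M q \<Longrightarrow> U n \<inter> Q q = {}" by metis
  define G where "G N z = (\<Sum>n<N. a n * h n z)" for N :: nat and z
  \<comment> \<open>The infinite sum, cut off at an index \<open>M z\<close> past which all
    summands vanish near \<open>z\<close>.\<close>
  define g where "g z = G (M z) z" for z
  have Geq: "G N z = G (M q) z" if q: "q \<in> topspace Y" "z \<in> Q q" "N \<ge> M q" for N z q
  proof -
    have "h n z = 0" if "n \<ge> M q" for n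
      using Q[OF q(1)] that q(2) hU[of z n] openin_subset by blast
    then show ?thesis unfolding G_def using q(3) by (intro sum.mono_neutral_right) auto
  qed
  have g: "g z = G N z" if "z \<in> topspace Y" "N \<ge> M z" for z N
    using Geq[of z z N] Q that by (auto simp: g_def)
  have gQ: "g z = G (M q) z" if q: "q \<in> topspace Y" "z \<in> Q q" for z q
  proof -
    have "z \<in> topspace Y" using Q(1)[OF q(1)] q(2) openin_subset by blast
    then have "g z = G (max (M z) (M q)) z" by (intro g) auto
    then show ?thesis using Geq[of q z "max (M z) (M q)"] q by simp
  qed
  have cG: "real_continuous Y (G N)" for N
    unfolding G_def using h(1) by (intro continuous_intros) auto
  have "real_continuous Y g"
  proof (rule pasting_lemma[where I = "topspace Y" and T = Q and f = "\<lambda>q. G (M q)"])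
    show "continuous_map (subtopology Y (Q i)) euclideanreal (G (M i))" for i
      using cG continuous_map_from_subtopology by blast
    show "G (M i) x = G (M j) x"
      if "i \<in> topspace Y" "j \<in> topspace Y" "x \<in> topspace Y \<inter> Q i \<inter> Q j" for i j x
      using gQ that by (metis IntE)
  qed (use Q(1) gQ in auto)
  moreover have "g (y n) \<ge> a n" for n
  proof -
    have yn: "y n \<in> topspace Y" using U y openin_subset by blast
    have "a n * h n (y n) \<le> G (max (Suc n) (M (y n))) (y n)"
      unfolding G_def by (rule member_le_sum) (use h0[OF yn] a in auto)
    then show ?thesis using g[OF yn, of "max (Suc n) (M (y n))"] h(2) by simp
  qed
  ultimately show thesis using that by blast
qed

text \<open>For completely regular spaces this is pseudocompactness. The form with cluster points of open sets is
  the one that can be used at once on sets given by approximate equations.\<close>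
definition feebly_compact_space :: "'a topology \<Rightarrow> bool" where
  "feebly_compact_space Y \<longleftrightarrow> (\<forall>U. (\<forall>n::nat. openin Y (U n) \<and> U n \<noteq> {}) \<longrightarrow>
     (\<exists>q\<in>topspace Y. \<forall>T N. openin Y T \<and> q \<in> T \<longrightarrow> (\<exists>n\<ge>N. U n \<inter> T \<noteq> {})))"

text \<open>The open sets \<open>{y. \<bar>g y\<bar> > n}\<close> cannot cluster at a point where \<open>g\<close> is finite.\<close>
lemma feebly_compact_imp_bounded:
  assumes "feebly_compact_space Y" "real_continuous Y g"
  obtains B where "\<And>y. y \<in> topspace Y \<Longrightarrow> \<bar>g y\<bar> \<le> B"
proof (rule ccontr)
  assume neg: "\<not> thesis"
  define U where "U n = {y \<in> topspace Y. \<bar>g y\<bar> > real n}" for n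
  note opn = openin_real_preimage[OF assms(2)]
  have "openin Y (U n)" for n
    using opn[of "{t. \<bar>t\<bar> > real n}"] by (auto simp: U_def open_Collect_less continuous_intros)
  moreover have "U n \<noteq> {}" for n
    using neg that[of "real n"] by (force simp: U_def)
  ultimately obtain q where q: "q \<in> topspace Y"
      "\<And>T N. openin Y T \<Longrightarrow> q \<in> T \<Longrightarrow> \<exists>n\<ge>N. U n \<inter> T \<noteq> {}"
    using assms(1) unfolding feebly_compact_space_def by meson
  obtain N :: nat where N: "\<bar>g q\<bar> < real N" using reals_Archimedean2 by blast
  have "\<exists>n\<ge>N. U n \<inter> {y \<in> topspace Y. g y \<in> {t. \<bar>t\<bar> < real N}} \<noteq> {}"
    using q(1) N by (intro q(2) opn) (auto intro!: open_Collect_less continuous_intros)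
  then show False by (auto simp: U_def)
qed

text \<open>Feeble compactness behaves like sequential compactness as long as only countably many functions are
  observed: a diagonal subsequence makes all of them converge, and the open sets of points that realise
  the first \<open>n\<close> limits up to \<open>1 / (n + 1)\<close> can only cluster at a point that realises all limits exactly.\<close>
lemma feebly_compact_countable_cluster:
  assumes fc: "feebly_compact_space Y" and y: "\<And>n::nat. y n \<in> topspace Y"
    and w: "\<And>k::nat. real_continuous Y (w k)"
  obtains q r where "q \<in> topspace Y" "strict_mono (r :: nat \<Rightarrow> nat)"
    "\<And>k. (\<lambda>j. w k (y (r j))) \<longlonglongrightarrow> w k q"
proof -
  have "\<exists>B. \<forall>z\<in>topspace Y. \<bar>w k z\<bar> \<le> B" for k
    using feebly_compact_imp_bounded[OF fc w[of k]] by metis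
  then obtain B where "\<And>k z. z \<in> topspace Y \<Longrightarrow> \<bar>w k z\<bar> \<le> B k" by metis
  then obtain r l where r: "strict_mono (r :: nat \<Rightarrow> nat)" and l: "\<And>k. (\<lambda>j. w k (y (r j))) \<longlonglongrightarrow> l k"
    using bounded_real_functions_convergent_subsequence[of "\<lambda>k n. w k (y n)" B] y by blast
  note opn = openin_real_preimage[OF w]
  define U where "U n = topspace Y \<inter> (\<Inter>k\<in>{..n}. {z \<in> topspace Y. w k z \<in> ball (l k) (1 / real (Suc n))})" for n
  have "openin Y (U n)" for n
    unfolding U_def by (intro openin_Int openin_topspace openin_INT2 opn) auto
  moreover have "U n \<noteq> {}" for n
  proof -
    have "\<forall>\<^sub>F j in sequentially. \<forall>k\<in>{..n}. dist (w k (y (r j))) (l k) < 1 / real (Suc n)"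
      by (intro eventually_ball_finite ballI tendstoD l) auto
    then obtain j where "\<forall>k\<in>{..n}. dist (w k (y (r j))) (l k) < 1 / real (Suc n)"
      using eventually_sequentially by auto
    then have "y (r j) \<in> U n" using y by (auto simp: U_def dist_commute)
    then show ?thesis by auto
  qed
  ultimately obtain q where q: "q \<in> topspace Y"
      "\<And>T N. openin Y T \<Longrightarrow> q \<in> T \<Longrightarrow> \<exists>n\<ge>N. U n \<inter> T \<noteq> {}"
    using fc unfolding feebly_compact_space_def by meson
  have "w k q = l k" for k
  proof (rule ccontr)
    assume "w k q \<noteq> l k"
    define e where "e = dist (w k q) (l k) / 2"
    have e: "e > 0" using \<open>w k q \<noteq> l k\<close> by (simp add: e_def)
    obtain N where N: "\<And>n. n \<ge> N \<Longrightarrow> 1 / real (Suc n) < e"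
      using inverse_Suc_eventually_less[OF e] by blast
    have "\<exists>n\<ge>max k N. U n \<inter> {z \<in> topspace Y. w k z \<in> ball (w k q) e} \<noteq> {}"
      using q e by (intro q(2) opn) auto
    then obtain n z where nz: "n \<ge> k" "n \<ge> N" "z \<in> U n" "dist (w k q) (w k z) < e" by auto
    have "dist (l k) (w k z) < 1 / real (Suc n)" using nz by (auto simp: U_def)
    also have "\<dots> < e" using N nz(2) .
    finally show False using nz(4) dist_triangle[of "w k q" "l k" "w k z"]
      by (simp add: e_def dist_commute)
  qed
  with q(1) r l that show thesis by simp
qed

section \<open>Compact families of functions on feebly compact spaces\<close>

text \<open>The engine of the compactness proof. A cluster point \<open>v\<close> of the functions \<open>d n\<close> vanishes at all \<open>y i\<close>.
  A point \<open>q\<close> at which \<open>v\<close> and all \<open>d n\<close> take limits of their values along the \<open>y i\<close> then has \<open>v q = 0\<close> but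
  \<open>\<bar>d n q\<bar> \<ge> \<epsilon>\<close> for all \<open>n\<close>, and the latter passes to the cluster point \<open>v\<close>.\<close>
lemma double_limit_feebly_compact:
  fixes d :: "nat \<Rightarrow> 'b \<Rightarrow> real"
  assumes fc: "feebly_compact_space Y"
    and Z: "compact Z" "\<And>z. z \<in> Z \<Longrightarrow> real_continuous Y z"
    and d: "\<And>n. d n \<in> Z" and y: "\<And>n. y n \<in> topspace Y"
    and small: "\<And>n i. i \<le> n \<Longrightarrow> \<bar>d n (y i)\<bar> \<le> 1 / real (Suc n)"
    and large: "\<And>n m. n < m \<Longrightarrow> \<epsilon> \<le> \<bar>d n (y m)\<bar>"
  shows "\<epsilon> \<le> 0"
proof (rule ccontr)
  assume "\<not> \<epsilon> \<le> 0"
  then have e: "\<epsilon> > 0" by simp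
  obtain v where v: "v \<in> Z" and vcl: "\<And>F \<delta> N. finite F \<Longrightarrow> \<delta> > 0 \<Longrightarrow> \<exists>n\<ge>N. \<forall>i\<in>F. \<bar>d n i - v i\<bar> < \<delta>"
    using compact_fun_sequence_cluster[where w = d, OF Z(1) d] by blast
  have v0: "v (y i) = 0" for i
  proof (rule ccontr)
    assume "v (y i) \<noteq> 0"
    then have "\<bar>v (y i)\<bar> / 2 > 0" by simp
    then obtain N where N: "\<And>n. n \<ge> N \<Longrightarrow> 1 / real (Suc n) < \<bar>v (y i)\<bar> / 2"
      using inverse_Suc_eventually_less by blast
    obtain n where n: "n \<ge> max i N" "\<bar>d n (y i) - v (y i)\<bar> < \<bar>v (y i)\<bar> / 2"
      using vcl[of "{y i}" "\<bar>v (y i)\<bar> / 2" "max i N"] \<open>v (y i) \<noteq> 0\<close> by auto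
    have "\<bar>d n (y i)\<bar> \<le> 1 / real (Suc n)" using small n by simp
    also have "\<dots> < \<bar>v (y i)\<bar> / 2" using N n by simp
    finally show False using n(2) by linarith
  qed
  \<comment> \<open>The countably many functions to be
    observed: the cluster point together with the whole sequence.\<close>
  define w where "w k = (case k of 0 \<Rightarrow> v | Suc n \<Rightarrow> d n)" for k
  have wc: "real_continuous Y (w k)" for k
    using Z(2) v d by (cases k) (auto simp: w_def)
  obtain q r where q: "q \<in> topspace Y" and r: "strict_mono (r :: nat \<Rightarrow> nat)"
      and lim: "\<And>k. (\<lambda>j. w k (y (r j))) \<longlonglongrightarrow> w k q"
    by (rule feebly_compact_countable_cluster[where y = y and w = w, OF fc y wc]) (rule that)
  have "v q = 0"
    using lim[of 0] by (simp add: w_def v0 LIMSEQ_const_iff)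
  have dq: "\<epsilon> \<le> \<bar>d n q\<bar>" for n
  proof (rule tendsto_lowerbound)
    show "(\<lambda>j. \<bar>d n (y (r j))\<bar>) \<longlonglongrightarrow> \<bar>d n q\<bar>"
      using lim[of "Suc n"] by (intro tendsto_rabs) (simp add: w_def)
    have "n < r j" if "j \<ge> Suc n" for j
      using seq_suble[OF r, of j] that by linarith
    then show "\<forall>\<^sub>F j in sequentially. \<epsilon> \<le> \<bar>d n (y (r j))\<bar>"
      using large by (auto intro!: eventually_sequentiallyI)
  qed simp
  obtain n where "\<bar>d n q - v q\<bar> < \<epsilon>" using vcl[of "{q}" \<epsilon> 0] e by auto
  then show False using dq[of n] \<open>v q = 0\<close> by simp
qed

text \<open>Rounding the values to multiples of \<open>\<delta>\<close> leaves finitely many patterns, and one representative of each pattern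
  forms the net. The functions are merely bounded, since one of them will be a limit \<open>p\<close> whose continuity
  on \<open>W\<close> is unknown.\<close>
lemma finite_net_of_bounded_functions:
  fixes \<phi> :: "'i \<Rightarrow> 'w \<Rightarrow> real"
  assumes "finite E" "\<And>i w. i \<in> E \<Longrightarrow> w \<in> W \<Longrightarrow> \<bar>\<phi> i w\<bar> \<le> B" "\<delta> > 0"
  obtains F where "finite F" "F \<subseteq> W" "\<And>w. w \<in> W \<Longrightarrow> \<exists>w'\<in>F. \<forall>i\<in>E. \<bar>\<phi> i w - \<phi> i w'\<bar> < \<delta>"
proof -
  define k where "k w = (\<lambda>i\<in>E. \<lfloor>\<phi> i w / \<delta>\<rfloor>)" for w
  have "k ` W \<subseteq> (\<Pi>\<^sub>E i\<in>E. {\<lfloor>- B / \<delta>\<rfloor>..\<lfloor>B / \<delta>\<rfloor>})"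
  proof (clarsimp simp: k_def)
    fix w i assume "w \<in> W" "i \<in> E"
    then have "\<bar>\<phi> i w\<bar> \<le> B" by (rule assms(2)[rotated])
    then show "\<lfloor>- (B / \<delta>)\<rfloor> \<le> \<lfloor>\<phi> i w / \<delta>\<rfloor> \<and> \<lfloor>\<phi> i w / \<delta>\<rfloor> \<le> \<lfloor>B / \<delta>\<rfloor>"
      using \<open>\<delta> > 0\<close> by (intro conjI floor_mono) (auto simp: field_simps)
  qed
  moreover have "finite (\<Pi>\<^sub>E i\<in>E. {\<lfloor>- B / \<delta>\<rfloor>..\<lfloor>B / \<delta>\<rfloor>})"
    using assms(1) by (intro finite_PiE) auto
  ultimately have "finite (k ` W)" by (rule finite_subset)
  then obtain F where F: "F \<subseteq> W" "finite F" "k ` F = k ` W"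
    using finite_subset_image[of "k ` W" k W] by (metis subset_refl)
  have "\<exists>w'\<in>F. \<forall>i\<in>E. \<bar>\<phi> i w - \<phi> i w'\<bar> < \<delta>" if "w \<in> W" for w
  proof -
    have "k w \<in> k ` F" using that F(3) by simp
    then obtain w' where w': "w' \<in> F" "k w = k w'" by auto
    have "\<bar>\<phi> i w - \<phi> i w'\<bar> < \<delta>" if "i \<in> E" for i
    proof -
      have "\<lfloor>\<phi> i w / \<delta>\<rfloor> = \<lfloor>\<phi> i w' / \<delta>\<rfloor>"
        using fun_cong[OF w'(2), of i] that by (simp add: k_def)
      then have "\<bar>\<phi> i w / \<delta> - \<phi> i w' / \<delta>\<bar> < 1" by linarith
      then have "\<bar>(\<phi> i w - \<phi> i w') / \<delta>\<bar> < 1" by (simp add: diff_divide_distrib)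
      then show ?thesis using \<open>\<delta> > 0\<close> by (simp add: abs_divide)
    qed
    then show ?thesis using w'(1) by blast
  qed
  with F that show thesis by blast
qed

locale pointwise_compact_family =
  fixes Y :: "'b topology" and W :: "('b \<Rightarrow> real) set" and M :: real
  assumes feebly_compact: "feebly_compact_space Y"
    and compact_W: "compact W"
    and continuous_W: "w \<in> W \<Longrightarrow> real_continuous Y w"
    and bounded_W: "w \<in> W \<Longrightarrow> y \<in> topspace Y \<Longrightarrow> \<bar>w y\<bar> \<le> M"
begin

text \<open>The double limit argument is applied to differences of elements of \<open>W\<close>: closeness of two functions on
  the points chosen so far then becomes smallness of a single one.\<close>
definition differences :: "('b \<Rightarrow> real) set" where
  "differences = (\<lambda>(a, b) y. a y - b y) ` (W \<times> W)"

lemma compact_differences: "compact differences"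
  unfolding differences_def
proof (intro compact_continuous_image compact_Times compact_W continuous_on_coordinatewise_then_product)
  fix i
  have "continuous_on UNIV (\<lambda>x :: ('b \<Rightarrow> real) \<times> ('b \<Rightarrow> real). fst x i)"
    by (rule continuous_on_compose2[OF continuous_on_product_coordinates]) (auto intro: continuous_intros)
  moreover have "continuous_on UNIV (\<lambda>x :: ('b \<Rightarrow> real) \<times> ('b \<Rightarrow> real). snd x i)"
    by (rule continuous_on_compose2[OF continuous_on_product_coordinates]) (auto intro: continuous_intros)
  ultimately have "continuous_on UNIV (\<lambda>x :: ('b \<Rightarrow> real) \<times> ('b \<Rightarrow> real). fst x i - snd x i)"
    by (rule continuous_on_diff)
  then show "continuous_on (W \<times> W) (\<lambda>x. (case x of (a, b) \<Rightarrow> \<lambda>y. a y - b y) i)"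
    unfolding split_def by (rule continuous_on_subset) simp
qed

lemma differencesI: "a \<in> W \<Longrightarrow> b \<in> W \<Longrightarrow> (\<lambda>y. a y - b y) \<in> differences"
  by (auto simp: differences_def image_iff intro!: bexI[of _ "(a, b)"])

lemma continuous_differences: "d \<in> differences \<Longrightarrow> real_continuous Y d"
  by (auto simp: differences_def intro!: continuous_map_diff dest: continuous_W)

text \<open>Membership of \<open>p\<close> in the closure of \<open>S\<close>, when points are regarded as functions on \<open>W\<close> by evaluation.\<close>
definition adherent :: "'b set \<Rightarrow> (('b \<Rightarrow> real) \<Rightarrow> real) \<Rightarrow> bool" where
  "adherent S p \<longleftrightarrow> (\<forall>F \<delta>. finite F \<and> F \<subseteq> W \<and> \<delta> > 0 \<longrightarrow> (\<exists>y\<in>S. \<forall>w\<in>F. \<bar>w y - p w\<bar> < \<delta>))"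

lemma adherentD:
  assumes "adherent S p" "finite F" "F \<subseteq> W" "\<delta> > 0"
  obtains y where "y \<in> S" "\<And>w. w \<in> F \<Longrightarrow> \<bar>w y - p w\<bar> < \<delta>"
  using assms unfolding adherent_def by metis

lemma adherent_bounded:
  assumes "adherent S p" "S \<subseteq> topspace Y" "w \<in> W"
  shows "\<bar>p w\<bar> \<le> M + 1"
proof -
  obtain y where "y \<in> S" "\<bar>w y - p w\<bar> < 1"
    using adherentD[OF assms(1), of "{w}" 1] assms(3) by auto
  then show ?thesis using bounded_W[OF assms(3), of y] assms(2) by fastforce
qed

text \<open>Subsets of \<open>Y\<close>, as sets of functions on \<open>W\<close>, have sequentially attained closures. The point \<open>y n\<close> is chosen
  to agree with \<open>p\<close>, up to \<open>1 / (n + 1)\<close>, on finite nets of \<open>W\<close>; the net of stage \<open>k\<close> approximates every \<open>w\<close> both on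
  \<open>y 0, \<dots>, y k\<close> and under \<open>p\<close>. If \<open>w (y n)\<close> stayed away from \<open>p w\<close>, the differences of \<open>w\<close> and its
  approximants from the nets would violate the double limit lemma. The sets \<open>S n\<close> may shrink with \<open>n\<close>, as
  they do in \<open>adherent_attained\<close>.\<close>
proposition adherent_sequence:
  assumes S: "\<And>n::nat. S n \<subseteq> topspace Y" and p: "\<And>n. adherent (S n) p"
  obtains y where "\<And>n. y n \<in> S n" "\<And>w. w \<in> W \<Longrightarrow> (\<lambda>n. w (y n)) \<longlonglongrightarrow> p w"
proof -
  have "\<exists>F. finite F \<and> F \<subseteq> W \<and> (\<forall>w\<in>W. \<exists>w'\<in>F. (\<forall>e\<in>E. \<bar>w e - w' e\<bar> < \<delta>) \<and> \<bar>p w - p w'\<bar> < \<delta>)"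
    if E: "finite E" "E \<subseteq> topspace Y" "\<delta> > 0" for E \<delta>
  proof -
    \<comment> \<open>\<open>None\<close> stands for \<open>p\<close>, which is thereby treated as one more point
      at which functions from \<open>W\<close> are evaluated.\<close>
    define \<phi> where "\<phi> i w = (case i of None \<Rightarrow> p w | Some e \<Rightarrow> w e)" for i w
    have "finite (insert None (Some ` E))" using E(1) by simp
    moreover have "\<bar>\<phi> i w\<bar> \<le> M + 1" if "i \<in> insert None (Some ` E)" "w \<in> W" for i w
      using that E(2) bounded_W[OF that(2)] adherent_bounded[OF p S that(2)]
      by (force simp: \<phi>_def)
    ultimately obtain F where F: "finite F" "F \<subseteq> W"
        "\<And>w. w \<in> W \<Longrightarrow> \<exists>w'\<in>F. \<forall>i\<in>insert None (Some ` E). \<bar>\<phi> i w - \<phi> i w'\<bar> < \<delta>"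
      using finite_net_of_bounded_functions[of "insert None (Some ` E)" W \<phi> "M + 1" \<delta>] E(3) by metis
    then show ?thesis by (intro exI[of _ F]) (simp add: \<phi>_def conj_commute)
  qed
  then obtain net where net: "\<And>E \<delta>. finite E \<Longrightarrow> E \<subseteq> topspace Y \<Longrightarrow> \<delta> > 0 \<Longrightarrow>
      finite (net E \<delta>) \<and> net E \<delta> \<subseteq> W \<and> (\<forall>w\<in>W. \<exists>w'\<in>net E \<delta>. (\<forall>e\<in>E. \<bar>w e - w' e\<bar> < \<delta>) \<and> \<bar>p w - p w'\<bar> < \<delta>)"
    by metis
  define \<N> where "\<N> f k = net (f ` {..k}) (1 / real (Suc k))" for f :: "nat \<Rightarrow> 'b" and k
  define P where "P f n y \<longleftrightarrow> y \<in> S n \<and> (\<forall>k<n. \<forall>w\<in>\<N> f k. \<bar>w y - p w\<bar> < 1 / real (Suc n))" for f n y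
  have "\<exists>y. \<forall>n. P y n (y n)"
  proof (rule dependent_wellorder_choice)
    fix r :: 'b and f g :: "nat \<Rightarrow> 'b" and x :: nat
    assume "\<And>y. y < x \<Longrightarrow> f y = g y"
    then have "\<N> f k = \<N> g k" if "k < x" for k
      using that unfolding \<N>_def by (metis (no_types, lifting) atMost_iff image_cong le_less_trans)
    then show "P f x r = P g x r" by (simp add: P_def)
  next
    fix n and f :: "nat \<Rightarrow> 'b"
    assume "\<And>k. k < n \<Longrightarrow> P f k (f k)"
    then have fS: "f k \<in> topspace Y" if "k < n" for k
      using S[of k] that by (auto simp: P_def)
    have netk: "finite (\<N> f k) \<and> \<N> f k \<subseteq> W" if "k < n" for k
    proof -
      have "finite (f ` {..k})" "f ` {..k} \<subseteq> topspace Y" "1 / real (Suc k) > 0" using fS that by auto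
      from net[OF this] show ?thesis by (simp add: \<N>_def)
    qed
    have "finite (\<Union>k<n. \<N> f k)" "(\<Union>k<n. \<N> f k) \<subseteq> W" "1 / real (Suc n) > 0"
      using netk by auto
    then obtain y where "y \<in> S n" "\<And>w. w \<in> (\<Union>k<n. \<N> f k) \<Longrightarrow> \<bar>w y - p w\<bar> < 1 / real (Suc n)"
      using adherentD[OF p] by blast
    then show "\<exists>r. P f n r" unfolding P_def by (intro exI[of _ y]) auto
  qed
  then obtain y where y: "\<And>n. P y n (y n)" by blast
  have yS: "y n \<in> S n" for n using y by (simp add: P_def)
  have yT: "y n \<in> topspace Y" for n using yS S by blast
  have yN: "\<bar>v (y m) - p v\<bar> < 1 / real (Suc m)" if "n < m" "v \<in> \<N> y n" for n m v
    using y[of m] that by (simp add: P_def)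
  have "(\<lambda>n. w (y n)) \<longlonglongrightarrow> p w" if w: "w \<in> W" for w
  proof (rule ccontr)
    assume "\<not> (\<lambda>n. w (y n)) \<longlonglongrightarrow> p w"
    then obtain \<epsilon> where e: "\<epsilon> > 0" and inf: "\<And>N. \<exists>n\<ge>N. \<epsilon> \<le> \<bar>w (y n) - p w\<bar>"
      unfolding LIMSEQ_iff by (auto simp: not_less)
    then have "\<epsilon> / 4 > 0" by simp
    then obtain N where sm: "\<And>n. n \<ge> N \<Longrightarrow> 1 / real (Suc n) < \<epsilon> / 4"
      using inverse_Suc_eventually_less by blast
    define I where "I = {n. n \<ge> N \<and> \<epsilon> \<le> \<bar>w (y n) - p w\<bar>}"
    have "\<exists>n\<ge>k. n \<in> I" for k
      using inf[of "max k N"] by (auto simp: I_def)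
    then have "infinite I" unfolding infinite_nat_iff_unbounded_le by blast
    then obtain r where r: "strict_mono (r :: nat \<Rightarrow> nat)" "\<And>j. r j \<in> I"
      using infinite_enumerate by metis
    have "\<exists>v\<in>\<N> y n. (\<forall>i\<le>n. \<bar>w (y i) - v (y i)\<bar> < 1 / real (Suc n)) \<and> \<bar>p w - p v\<bar> < 1 / real (Suc n)" for n
      using net[of "y ` {..n}" "1 / real (Suc n)"] yT w unfolding \<N>_def by fastforce
    then obtain v where v: "\<And>n. v n \<in> \<N> y n" "\<And>n i. i \<le> n \<Longrightarrow> \<bar>w (y i) - v n (y i)\<bar> < 1 / real (Suc n)"
        "\<And>n. \<bar>p w - p (v n)\<bar> < 1 / real (Suc n)"
      by metis
    have vW: "v n \<in> W" for n
      using net[of "y ` {..n}" "1 / real (Suc n)"] yT v(1)[of n] unfolding \<N>_def by auto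
    define d where "d j = (\<lambda>z. w z - v (r j) z)" for j
    have "\<epsilon> / 2 \<le> 0"
    proof (rule double_limit_feebly_compact[OF feebly_compact compact_differences continuous_differences, of d "\<lambda>j. y (r j)"])
      show "d n \<in> differences" for n unfolding d_def using w vW by (rule differencesI)
      show "y (r n) \<in> topspace Y" for n by (rule yT)
      show "\<bar>d n (y (r i))\<bar> \<le> 1 / real (Suc n)" if "i \<le> n" for n i
      proof -
        have "r i \<le> r n" using r(1) that by (simp add: strict_mono_less_eq)
        then have "\<bar>d n (y (r i))\<bar> \<le> 1 / real (Suc (r n))" using v(2) unfolding d_def by (meson less_imp_le)
        also have "\<dots> \<le> 1 / real (Suc n)" using seq_suble[OF r(1), of n] by (simp add: field_simps)
        finally show ?thesis .
      qed
      show "\<epsilon> / 2 \<le> \<bar>d n (y (r m))\<bar>" if "n < m" for n m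
      proof -
        have "r n < r m" using r(1) that by (simp add: strict_mono_less)
        then have "\<bar>v (r n) (y (r m)) - p (v (r n))\<bar> < 1 / real (Suc (r m))" using yN v(1) by blast
        moreover have "\<bar>p w - p (v (r n))\<bar> < 1 / real (Suc (r n))" by (rule v)
        moreover have "r n \<ge> N" "r m \<ge> N" "\<epsilon> \<le> \<bar>w (y (r m)) - p w\<bar>" using r(2) by (auto simp: I_def)
        ultimately show ?thesis using sm[of "r n"] sm[of "r m"] unfolding d_def by linarith
      qed
    qed
    then show False using e by simp
  qed
  with yS that show thesis by blast
qed

lemma openin_finite_conditions:
  assumes "finite F" "F \<subseteq> W" "openin Y U"
  shows "openin Y {y \<in> U. \<forall>w\<in>F. \<bar>w y - p w\<bar> < \<delta>}"
proof -
  have "openin Y {y \<in> topspace Y. w y \<in> {t. \<bar>t - p w\<bar> < \<delta>}}" if "w \<in> F" for w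
  proof -
    have "open {t. \<bar>t - p w\<bar> < \<delta>}" by (auto intro!: open_Collect_less continuous_intros)
    moreover have "w \<in> W" using that assms(2) by blast
    ultimately show ?thesis by (intro openin_real_preimage continuous_W)
  qed
  then have "openin Y (U \<inter> (\<Inter>w\<in>F. {y \<in> topspace Y. w y \<in> {t. \<bar>t - p w\<bar> < \<delta>}}))" if "F \<noteq> {}"
    using assms that by (intro openin_Int openin_INT2) auto
  moreover have "{y \<in> U. \<forall>w\<in>F. \<bar>w y - p w\<bar> < \<delta>} = U \<inter> (\<Inter>w\<in>F. {y \<in> topspace Y. w y \<in> {t. \<bar>t - p w\<bar> < \<delta>}})"
    if "F \<noteq> {}" using openin_subset[OF assms(3)] that by auto
  ultimately show ?thesis using assms(3) by (cases "F = {}") auto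
qed

text \<open>If no open subset of \<open>U\<close> has small oscillation, then closeness on a finite set \<open>E\<close> of points does not control
  closeness on \<open>U\<close>. Otherwise take a finite net \<open>F\<close> of \<open>W\<close> with respect to the values on \<open>E\<close>: on the open set where
  the functions of \<open>F\<close> vary by less than \<open>\<eta> / 4\<close>, every function of \<open>W\<close> would vary by at most \<open>\<eta>\<close>.\<close>
lemma oscillating_pair:
  assumes U: "openin Y U" "U \<noteq> {}" and "\<eta> > 0"
    and large: "\<And>V. openin Y V \<Longrightarrow> V \<noteq> {} \<Longrightarrow> V \<subseteq> U \<Longrightarrow> \<exists>u\<in>V. \<exists>u'\<in>V. \<exists>w\<in>W. \<bar>w u - w u'\<bar> > \<eta>"
    and E: "finite E" "E \<subseteq> topspace Y" and "\<delta> > 0"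
  obtains d u where "d \<in> differences" "\<And>e. e \<in> E \<Longrightarrow> \<bar>d e\<bar> < \<delta>" "u \<in> U" "\<bar>d u\<bar> > \<eta> / 4"
proof (rule ccontr)
  assume neg: "\<not> thesis"
  note found = that
  obtain F where F: "finite F" "F \<subseteq> W" "\<And>w. w \<in> W \<Longrightarrow> \<exists>w'\<in>F. \<forall>e\<in>E. \<bar>w e - w' e\<bar> < \<delta>"
    using finite_net_of_bounded_functions[of E W "\<lambda>e w. w e" M \<delta>] E \<open>\<delta> > 0\<close> bounded_W by (metis subsetD)
  obtain u0 where u0: "u0 \<in> U" using U by blast
  define V where "V = {u \<in> U. \<forall>w\<in>F. \<bar>w u - w u0\<bar> < \<eta> / 4}"
  have "openin Y V" unfolding V_def by (rule openin_finite_conditions[OF F(1,2) U(1)])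
  moreover have "u0 \<in> V" using u0 \<open>\<eta> > 0\<close> by (simp add: V_def)
  moreover have "V \<subseteq> U" by (auto simp: V_def)
  ultimately obtain u u' w where uu: "u \<in> V" "u' \<in> V" "w \<in> W" "\<bar>w u - w u'\<bar> > \<eta>"
    using large by blast
  obtain w' where w': "w' \<in> F" "\<forall>e\<in>E. \<bar>w e - w' e\<bar> < \<delta>" using F(3) uu(3) by blast
  have "(\<lambda>y. w y - w' y) \<in> differences" using uu w' F by (intro differencesI) auto
  then have "\<bar>w z - w' z\<bar> \<le> \<eta> / 4" if "z \<in> U" for z
    using neg found[of "\<lambda>y. w y - w' y" z] w'(2) that by (meson not_le)
  then have "\<bar>w u - w' u\<bar> \<le> \<eta> / 4" "\<bar>w u' - w' u'\<bar> \<le> \<eta> / 4" using uu by (auto simp: V_def)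
  moreover have "\<bar>w' u - w' u0\<bar> < \<eta> / 4" "\<bar>w' u' - w' u0\<bar> < \<eta> / 4" using uu w' by (auto simp: V_def)
  ultimately show False using uu(4) by linarith
qed

text \<open>A variant of Namioka's theorem. If it failed, \<open>oscillating_pair\<close> could be iterated: each new difference
  \<open>d n\<close> is small on all points chosen so far, and each new point is chosen in the open set where all earlier
  differences exceed \<open>\<eta> / 4\<close>. This is what the double limit lemma excludes.\<close>
proposition fragmented:
  assumes U: "openin Y U" "U \<noteq> {}" and "\<eta> > 0"
  obtains V where "openin Y V" "V \<noteq> {}" "V \<subseteq> U" "\<And>u u' w. u \<in> V \<Longrightarrow> u' \<in> V \<Longrightarrow> w \<in> W \<Longrightarrow> \<bar>w u - w u'\<bar> \<le> \<eta>"
proof (rule ccontr)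
  assume neg: "\<not> thesis"
  note found = that
  have large: "\<exists>u\<in>V. \<exists>u'\<in>V. \<exists>w\<in>W. \<bar>w u - w u'\<bar> > \<eta>" if "openin Y V" "V \<noteq> {}" "V \<subseteq> U" for V
    using neg found[of V] that by (meson not_le)
  have UY: "U \<subseteq> topspace Y" using U openin_subset by blast
  \<comment> \<open>The region left after \<open>n\<close> steps. The last conjunct of \<open>P\<close> says that
    the next region is nonempty, which keeps the recursion going.\<close>
  define R where "R f n = {u \<in> U. \<forall>k<n. \<bar>snd (f k) u\<bar> > \<eta> / 4}" for f :: "nat \<Rightarrow> 'b \<times> ('b \<Rightarrow> real)" and n :: nat
  define P where "P f n yd \<longleftrightarrow> fst yd \<in> R f n \<and> snd yd \<in> differences \<and>
      (\<forall>i<n. \<bar>snd yd (fst (f i))\<bar> < 1 / real (Suc n)) \<and> \<bar>snd yd (fst yd)\<bar> < 1 / real (Suc n) \<and>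
      (\<exists>u\<in>R f n. \<bar>snd yd u\<bar> > \<eta> / 4)" for f n yd
  have "\<exists>f. \<forall>n. P f n (f n)"
  proof (rule dependent_wellorder_choice)
    fix r and f g :: "nat \<Rightarrow> 'b \<times> ('b \<Rightarrow> real)" and x :: nat
    assume "\<And>y. y < x \<Longrightarrow> f y = g y"
    then show "P f x r = P g x r" by (simp add: P_def R_def)
  next
    fix n and f :: "nat \<Rightarrow> 'b \<times> ('b \<Rightarrow> real)"
    assume IH: "\<And>k. k < n \<Longrightarrow> P f k (f k)"
    have "R f n \<noteq> {}"
    proof (cases n)
      case (Suc m)
      then obtain u where "u \<in> R f m" "\<bar>snd (f m) u\<bar> > \<eta> / 4" using IH[of m] unfolding P_def by auto
      then have "u \<in> R f n" using Suc by (auto simp: R_def less_Suc_eq)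
      then show ?thesis by blast
    qed (use U in \<open>auto simp: R_def\<close>)
    have opn: "openin Y {u \<in> topspace Y. d u \<in> {t. \<bar>t\<bar> > \<eta> / 4}}" if "d \<in> differences" for d
    proof -
      have "open {t. \<bar>t\<bar> > \<eta> / 4}" by (auto intro!: open_Collect_less continuous_intros)
      then show ?thesis by (intro openin_real_preimage continuous_differences[OF that])
    qed
    have "openin Y (R f n)"
    proof (cases "n = 0")
      case False
      have "R f n = U \<inter> (\<Inter>k\<in>{..<n}. {u \<in> topspace Y. snd (f k) u \<in> {t. \<bar>t\<bar> > \<eta> / 4}})"
        using UY False by (auto simp: R_def)
      also have "openin Y \<dots>"
        using IH False U(1) by (intro openin_Int openin_INT2 opn) (auto simp: P_def)
      finally show ?thesis .
    qed (use U in \<open>auto simp: R_def\<close>)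
    obtain y where y: "y \<in> R f n" using \<open>R f n \<noteq> {}\<close> by blast
    have RU: "R f n \<subseteq> U" by (auto simp: R_def)
    have fY: "fst (f i) \<in> topspace Y" if "i < n" for i
      using IH[OF that] UY by (auto simp: P_def R_def)
    obtain d u where d: "d \<in> differences" "\<And>e. e \<in> insert y ((\<lambda>i. fst (f i)) ` {..<n}) \<Longrightarrow> \<bar>d e\<bar> < 1 / real (Suc n)"
        "u \<in> R f n" "\<bar>d u\<bar> > \<eta> / 4"
    proof (rule oscillating_pair[OF \<open>openin Y (R f n)\<close> \<open>R f n \<noteq> {}\<close> \<open>\<eta> > 0\<close>,
            of "insert y ((\<lambda>i. fst (f i)) ` {..<n})" "1 / real (Suc n)"])
      show "\<exists>u\<in>V. \<exists>u'\<in>V. \<exists>w\<in>W. \<eta> < \<bar>w u - w u'\<bar>" if "openin Y V" "V \<noteq> {}" "V \<subseteq> R f n" for V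
        using large that RU by blast
      show "insert y ((\<lambda>i. fst (f i)) ` {..<n}) \<subseteq> topspace Y" using y RU UY fY by blast
    qed auto
    have "P f n (y, d)" unfolding P_def using y d by auto
    then show "\<exists>r. P f n r" by blast
  qed
  then obtain f where f: "\<And>n. P f n (f n)" by blast
  have "\<eta> / 4 \<le> 0"
  proof (rule double_limit_feebly_compact[OF feebly_compact compact_differences continuous_differences,
        of "\<lambda>n. snd (f n)" "\<lambda>n. fst (f n)"])
    show "snd (f n) \<in> differences" for n using f[of n] by (simp add: P_def)
    show "fst (f n) \<in> topspace Y" for n using f[of n] UY by (auto simp: P_def R_def)
    show "\<bar>snd (f n) (fst (f i))\<bar> \<le> 1 / real (Suc n)" if "i \<le> n" for n i
      using f[of n] that unfolding P_def by (metis le_neq_implies_less less_imp_le)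
    show "\<eta> / 4 \<le> \<bar>snd (f n) (fst (f m))\<bar>" if "n < m" for n m
      using f[of m] that by (auto simp: P_def R_def less_imp_le)
  qed
  then show False using \<open>\<eta> > 0\<close> by simp
qed

text \<open>The theorem of Preiss and Simon. The sets \<open>S n\<close> of points with a neighbourhood of oscillation at most
  \<open>1 / (n + 1)\<close> are open and, by \<open>fragmented\<close>, dense, so \<open>p\<close> is adherent to all of them and is the limit of
  points \<open>y n\<close> from \<open>S n\<close>. The neighbourhoods \<open>V n\<close> converge to \<open>p\<close> along with the \<open>y n\<close>, and therefore they can
  only cluster at a point of \<open>Y\<close> that represents \<open>p\<close>.\<close>
theorem adherent_attained:
  assumes p: "adherent (topspace Y) p"
  obtains y where "y \<in> topspace Y" "\<And>w. w \<in> W \<Longrightarrow> w y = p w"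
proof -
  define small where "small n V \<longleftrightarrow> openin Y V \<and> (\<forall>u\<in>V. \<forall>u'\<in>V. \<forall>w\<in>W. \<bar>w u - w u'\<bar> \<le> 1 / real (Suc n))"
    for n :: nat and V
  define S where "S n = \<Union>{V. small n V}" for n
  have S: "S n \<subseteq> topspace Y" for n
    unfolding S_def small_def using openin_subset by blast
  have "adherent (S n) p" for n
    unfolding adherent_def
  proof (intro allI impI, elim conjE)
    fix F and \<delta> :: real
    assume F: "finite F" "F \<subseteq> W" "\<delta> > 0"
    let ?U = "{y \<in> topspace Y. \<forall>w\<in>F. \<bar>w y - p w\<bar> < \<delta>}"
    have "openin Y ?U" using F by (intro openin_finite_conditions) auto
    moreover have "?U \<noteq> {}"
    proof -
      obtain z where "z \<in> topspace Y" "\<And>w. w \<in> F \<Longrightarrow> \<bar>w z - p w\<bar> < \<delta>"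
        by (rule adherentD[OF p F]) (rule that)
      then show ?thesis by blast
    qed
    moreover have "1 / real (Suc n) > 0" by simp
    ultimately obtain V where V: "openin Y V" "V \<noteq> {}" "V \<subseteq> ?U"
        "\<And>u u' w. u \<in> V \<Longrightarrow> u' \<in> V \<Longrightarrow> w \<in> W \<Longrightarrow> \<bar>w u - w u'\<bar> \<le> 1 / real (Suc n)"
      by (rule fragmented) (rule that)
    then have "V \<subseteq> S n" by (auto simp: S_def small_def)
    then show "\<exists>y\<in>S n. \<forall>w\<in>F. \<bar>w y - p w\<bar> < \<delta>" using V by blast
  qed
  then obtain y where y: "\<And>n. y n \<in> S n" "\<And>w. w \<in> W \<Longrightarrow> (\<lambda>n. w (y n)) \<longlonglongrightarrow> p w"
    by (rule adherent_sequence[OF S]) (rule that)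
  have "\<exists>V. y n \<in> V \<and> small n V" for n
    using y(1)[of n] unfolding S_def by blast
  then obtain V where V: "\<And>n. y n \<in> V n" "\<And>n. small n (V n)"
    by metis
  have "\<forall>n. openin Y (V n) \<and> V n \<noteq> {}"
    using V unfolding small_def by blast
  then obtain q where q: "q \<in> topspace Y" "\<And>T N. openin Y T \<Longrightarrow> q \<in> T \<Longrightarrow> \<exists>n\<ge>N. V n \<inter> T \<noteq> {}"
    using feebly_compact unfolding feebly_compact_space_def by meson
  have "w q = p w" if w: "w \<in> W" for w
  proof (rule ccontr)
    assume neq: "w q \<noteq> p w"
    define \<delta> where "\<delta> = \<bar>w q - p w\<bar> / 3"
    have "\<delta> > 0" using neq by (simp add: \<delta>_def)
    then obtain N where N: "\<And>n. n \<ge> N \<Longrightarrow> 1 / real (Suc n) < \<delta>"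
      using inverse_Suc_eventually_less by blast
    obtain N' where N': "\<And>n. n \<ge> N' \<Longrightarrow> \<bar>w (y n) - p w\<bar> < \<delta>"
      using y(2)[OF w] \<open>\<delta> > 0\<close> unfolding LIMSEQ_iff by auto
    have "openin Y {z \<in> topspace Y. \<forall>w\<in>{w}. \<bar>w z - w q\<bar> < \<delta>}"
      using w by (intro openin_finite_conditions) auto
    then obtain n z where n: "n \<ge> max N N'" "z \<in> V n" "\<bar>w z - w q\<bar> < \<delta>"
      using q(2)[of "{z \<in> topspace Y. \<forall>w\<in>{w}. \<bar>w z - w q\<bar> < \<delta>}" "max N N'"] q(1) \<open>\<delta> > 0\<close> by auto
    have "\<bar>w z - w (y n)\<bar> \<le> 1 / real (Suc n)" using V n w unfolding small_def by blast
    also have "\<dots> < \<delta>" using N n by simp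
    finally have "\<bar>w z - w (y n)\<bar> < \<delta>" .
    moreover have "\<bar>w (y n) - p w\<bar> < \<delta>" using N' n by simp
    moreover have "\<bar>w q - p w\<bar> \<le> \<bar>w z - w q\<bar> + \<bar>w z - w (y n)\<bar> + \<bar>w (y n) - p w\<bar>" by linarith
    moreover have "\<bar>w q - p w\<bar> = 3 * \<delta>" by (simp add: \<delta>_def)
    ultimately show False using n(3) by linarith
  qed
  with q(1) that show thesis by blast
qed

end

section \<open>Weak compactness in spaces of continuous functions\<close>

lemma Dini_pointwise_zero:
  fixes H :: "nat \<Rightarrow> 'c::topological_space \<Rightarrow> real"
  assumes W: "compact W" and H: "\<And>n. continuous_on W (H n)"
    and dec: "\<And>n w. w \<in> W \<Longrightarrow> H (Suc n) w \<le> H n w"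
    and small: "\<And>w. w \<in> W \<Longrightarrow> \<exists>n. H n w < \<delta>"
  obtains n where "\<And>w. w \<in> W \<Longrightarrow> H n w < \<delta>"
proof -
  have "\<exists>T. open T \<and> T \<inter> W = H n -` {..<\<delta>} \<inter> W" for n
    using H[of n] open_lessThan unfolding continuous_on_open_invariant by blast
  then obtain T where T: "\<And>n. open (T n)" "\<And>n. T n \<inter> W = H n -` {..<\<delta>} \<inter> W" by metis
  have "W \<subseteq> (\<Union>n\<in>UNIV. T n)" using small T(2) by blast
  then obtain C where C: "finite C" "W \<subseteq> (\<Union>n\<in>C. T n)"
    using compactE_image[OF W, of UNIV T] T(1) by (metis (no_types, lifting))
  have mono: "H n w \<le> H m w" if "w \<in> W" "m \<le> n" for m n w
    using that(2) by (rule lift_Suc_antimono_le[of "\<lambda>n. H n w", rotated]) (use dec that in auto)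
  have "H (Max (insert 0 C)) w < \<delta>" if w: "w \<in> W" for w
  proof -
    obtain n where n: "n \<in> C" "w \<in> T n" using C(2) w by blast
    then have "H n w < \<delta>" using T(2)[of n] w by auto
    moreover have "H (Max (insert 0 C)) w \<le> H n w"
      using n C(1) by (intro mono w) auto
    ultimately show ?thesis by simp
  qed
  then show thesis by (rule that)
qed

text \<open>Functions are total, but compared on \<open>W\<close> only: the bound makes \<open>\<Lambda>\<close> insensitive to values outside \<open>W\<close>.\<close>
locale bounded_functional =
  fixes W :: "'c::topological_space set" and \<Lambda> :: "('c \<Rightarrow> real) \<Rightarrow> real" and C :: real
  assumes compact_W: "compact W"
    and add: "continuous_on W f \<Longrightarrow> continuous_on W g \<Longrightarrow> \<Lambda> (\<lambda>w. f w + g w) = \<Lambda> f + \<Lambda> g"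
    and bound: "continuous_on W f \<Longrightarrow> (\<And>w. w \<in> W \<Longrightarrow> \<bar>f w\<bar> \<le> B) \<Longrightarrow> B \<ge> 0 \<Longrightarrow> \<bar>\<Lambda> f\<bar> \<le> C * B"
begin

lemma cong:
  assumes "continuous_on W f" "\<And>w. w \<in> W \<Longrightarrow> f w = g w"
  shows "\<Lambda> f = \<Lambda> g"
proof -
  have g: "continuous_on W g" using assms continuous_on_cong by metis
  have z: "\<Lambda> (\<lambda>w. f w - g w) = 0"
    using bound[of "\<lambda>w. f w - g w" 0] assms g by (auto intro!: continuous_intros)
  have "\<Lambda> (\<lambda>w. (f w - g w) + g w) = \<Lambda> (\<lambda>w. f w - g w) + \<Lambda> g"
    using assms g by (intro add continuous_intros)
  then show ?thesis using z by simp
qed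

lemma zero: "\<Lambda> (\<lambda>_. 0) = 0"
  using bound[of "\<lambda>_. 0" 0] by (auto intro: continuous_intros)

lemma minus: "continuous_on W f \<Longrightarrow> \<Lambda> (\<lambda>w. - f w) = - \<Lambda> f"
  using add[of f "\<lambda>w. - f w"] zero continuous_on_minus[of W f] by simp

text \<open>On nonnegative functions this is the positive functional \<open>\<bar>\<Lambda>\<bar>\<close>, the total variation of \<open>\<Lambda>\<close>.\<close>
definition variation :: "('c \<Rightarrow> real) \<Rightarrow> real" where
  "variation f = Sup {\<Lambda> g | g. continuous_on W g \<and> (\<forall>w\<in>W. \<bar>g w\<bar> \<le> f w)}"

definition nonneg :: "('c \<Rightarrow> real) \<Rightarrow> bool" where
  "nonneg f \<longleftrightarrow> continuous_on W f \<and> (\<forall>w\<in>W. 0 \<le> f w)"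

lemma nonneg_bounded: "nonneg f \<Longrightarrow> \<exists>B\<ge>0. \<forall>w\<in>W. f w \<le> B"
proof -
  assume f: "nonneg f"
  then have "bounded (f ` W)"
    using compact_W by (auto simp: nonneg_def intro!: compact_imp_bounded compact_continuous_image)
  then obtain B where "\<forall>x\<in>f ` W. norm x \<le> B" unfolding bounded_iff by blast
  then show ?thesis by (intro exI[of _ "max 0 B"]) auto
qed

lemma variation_bdd:
  assumes "nonneg f"
  shows "bdd_above {\<Lambda> g | g. continuous_on W g \<and> (\<forall>w\<in>W. \<bar>g w\<bar> \<le> f w)}"
proof -
  obtain B where B: "B \<ge> 0" "\<forall>w\<in>W. f w \<le> B" using nonneg_bounded[OF assms] by blast
  have "\<Lambda> g \<le> C * B" if "continuous_on W g" "\<forall>w\<in>W. \<bar>g w\<bar> \<le> f w" for g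
  proof -
    have "\<bar>\<Lambda> g\<bar> \<le> C * B" using that B by (intro bound) force+
    then show ?thesis by simp
  qed
  then show ?thesis by (intro bdd_aboveI[of _ "C * B"]) blast
qed

lemma variation_upper:
  assumes "nonneg f" "continuous_on W g" "\<And>w. w \<in> W \<Longrightarrow> \<bar>g w\<bar> \<le> f w"
  shows "\<Lambda> g \<le> variation f"
  unfolding variation_def by (rule cSup_upper[OF _ variation_bdd]) (use assms in auto)

lemma variation_least:
  assumes "nonneg f" "\<And>g. continuous_on W g \<Longrightarrow> (\<And>w. w \<in> W \<Longrightarrow> \<bar>g w\<bar> \<le> f w) \<Longrightarrow> \<Lambda> g \<le> x"
  shows "variation f \<le> x"
  unfolding variation_def
proof (rule cSup_least)
  have "\<Lambda> (\<lambda>_. 0) \<in> {\<Lambda> g | g. continuous_on W g \<and> (\<forall>w\<in>W. \<bar>g w\<bar> \<le> f w)}"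
    using assms(1) by (auto simp: nonneg_def intro!: exI[of _ "\<lambda>_. 0"])
  then show "{\<Lambda> g | g. continuous_on W g \<and> (\<forall>w\<in>W. \<bar>g w\<bar> \<le> f w)} \<noteq> {}" by blast
qed (use assms(2) in auto)

lemma abs_le_variation:
  assumes f: "continuous_on W f"
  shows "\<bar>\<Lambda> f\<bar> \<le> variation (\<lambda>w. \<bar>f w\<bar>)"
proof -
  have n: "nonneg (\<lambda>w. \<bar>f w\<bar>)" using f by (auto simp: nonneg_def intro: continuous_intros)
  have "\<Lambda> f \<le> variation (\<lambda>w. \<bar>f w\<bar>)" "\<Lambda> (\<lambda>w. - f w) \<le> variation (\<lambda>w. \<bar>f w\<bar>)"
    by (intro variation_upper n f continuous_intros; simp)+
  then show ?thesis using minus[OF f] by simp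
qed

lemma variation_le_bound:
  assumes "nonneg f" "\<And>w. w \<in> W \<Longrightarrow> f w \<le> B" "B \<ge> 0"
  shows "variation f \<le> C * B"
proof (rule variation_least[OF assms(1)])
  fix g assume "continuous_on W g" "\<And>w. w \<in> W \<Longrightarrow> \<bar>g w\<bar> \<le> f w"
  then have "\<bar>\<Lambda> g\<bar> \<le> C * B" using assms by (intro bound) force+
  then show "\<Lambda> g \<le> C * B" by simp
qed

lemma variation_mono:
  assumes "nonneg f" "nonneg g" "\<And>w. w \<in> W \<Longrightarrow> f w \<le> g w"
  shows "variation f \<le> variation g"
  by (rule variation_least[OF assms(1)]) (use assms in \<open>force intro!: variation_upper\<close>)

lemma nonneg_add: "nonneg f \<Longrightarrow> nonneg g \<Longrightarrow> nonneg (\<lambda>w. f w + g w)"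
  by (auto simp: nonneg_def intro: continuous_intros)

text \<open>One inequality is the Riesz decomposition: a function bounded by \<open>f + g\<close> is its truncation at \<open>f\<close> plus a
  remainder bounded by \<open>g\<close>. The other one adds nearly optimal functions for \<open>f\<close> and for \<open>g\<close>.\<close>
lemma variation_add:
  assumes f: "nonneg f" and g: "nonneg g"
  shows "variation (\<lambda>w. f w + g w) = variation f + variation g"
proof (rule antisym)
  show "variation (\<lambda>w. f w + g w) \<le> variation f + variation g"
  proof (rule variation_least[OF nonneg_add[OF f g]])
    fix u assume u: "continuous_on W u" "\<And>w. w \<in> W \<Longrightarrow> \<bar>u w\<bar> \<le> f w + g w"
    define u1 where "u1 w = max (- f w) (min (u w) (f w))" for w
    have c1: "continuous_on W u1" using u f unfolding u1_def nonneg_def by (intro continuous_intros) auto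
    have "\<Lambda> u = \<Lambda> (\<lambda>w. u1 w + (u w - u1 w))" by simp
    also have "\<dots> = \<Lambda> u1 + \<Lambda> (\<lambda>w. u w - u1 w)" using c1 u by (intro add continuous_intros)
    also have "\<Lambda> u1 \<le> variation f"
      using f c1 by (intro variation_upper) (auto simp: u1_def nonneg_def)
    also have "\<Lambda> (\<lambda>w. u w - u1 w) \<le> variation g"
    proof (intro variation_upper g continuous_intros u c1)
      fix w assume w: "w \<in> W"
      have "0 \<le> f w" "0 \<le> g w" using f g w by (auto simp: nonneg_def)
      then show "\<bar>u w - u1 w\<bar> \<le> g w" using u(2)[OF w] unfolding u1_def by linarith
    qed
    finally show "\<Lambda> u \<le> variation f + variation g" by simp
  qed
  have "variation f \<le> variation (\<lambda>w. f w + g w) - variation g"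
  proof (rule variation_least[OF f])
    fix u assume u: "continuous_on W u" "\<And>w. w \<in> W \<Longrightarrow> \<bar>u w\<bar> \<le> f w"
    have "variation g \<le> variation (\<lambda>w. f w + g w) - \<Lambda> u"
    proof (rule variation_least[OF g])
      fix v assume v: "continuous_on W v" "\<And>w. w \<in> W \<Longrightarrow> \<bar>v w\<bar> \<le> g w"
      have "\<Lambda> u + \<Lambda> v = \<Lambda> (\<lambda>w. u w + v w)" using u v by (simp add: add)
      also have "\<dots> \<le> variation (\<lambda>w. f w + g w)"
        using u v by (intro variation_upper nonneg_add f g continuous_intros) force+
      finally show "\<Lambda> v \<le> variation (\<lambda>w. f w + g w) - \<Lambda> u" by simp
    qed
    then show "\<Lambda> u \<le> variation (\<lambda>w. f w + g w) - variation g" by simp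
  qed
  then show "variation f + variation g \<le> variation (\<lambda>w. f w + g w)" by simp
qed

lemma variation_zero: "variation (\<lambda>_. 0) = 0"
  using variation_add[of "\<lambda>_. 0" "\<lambda>_. 0"] by (simp add: nonneg_def)

lemma nonneg_sum: "(\<And>i. i \<in> I \<Longrightarrow> nonneg (f i)) \<Longrightarrow> nonneg (\<lambda>w. \<Sum>i\<in>I. f i w)"
  by (auto simp: nonneg_def intro!: continuous_intros sum_nonneg)

lemma variation_sum:
  assumes "finite I" "\<And>i. i \<in> I \<Longrightarrow> nonneg (f i)"
  shows "variation (\<lambda>w. \<Sum>i\<in>I. f i w) = (\<Sum>i\<in>I. variation (f i))"
  using assms
proof (induction I)
  case (insert i I)
  then show ?case
    using variation_add[of "f i" "\<lambda>w. \<Sum>i\<in>I. f i w"] nonneg_sum[of I f] by auto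
qed (simp add: variation_zero)

text \<open>The suprema of the tails \<open>h n, h (n + 1), \<dots>\<close> decrease to \<open>0\<close>
  pointwise, but need not be continuous. They are replaced by finite maxima \<open>G n\<close> that already exhaust the
  variation of the tail up to \<open>\<epsilon> / 2 ^ (n + 2)\<close>. The minima \<open>H n\<close> of \<open>G 0, \<dots>, G n\<close> are continuous and decrease to
  \<open>0\<close>, hence uniformly by Dini's theorem, although additivity of the variation forces the variation of
  \<open>H n\<close> to stay above \<open>\<epsilon> / 2\<close>.\<close>
lemma not_uniformly_large:
  assumes h: "\<And>n. nonneg (h n)" and M: "\<And>n w. w \<in> W \<Longrightarrow> h n w \<le> M" "M \<ge> 0"
    and lim: "\<And>w. w \<in> W \<Longrightarrow> (\<lambda>n. h n w) \<longlonglongrightarrow> 0"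
    and large: "\<And>n. \<epsilon> \<le> variation (h n)"
  shows "\<epsilon> \<le> 0"
proof (rule ccontr)
  assume "\<not> \<epsilon> \<le> 0"
  then have e: "\<epsilon> > 0" by simp
  have C0: "C \<ge> 0" using bound[of "\<lambda>_. 0" 1] by (auto intro: continuous_intros)
  \<comment> \<open>\<open>mx n j\<close> is the maximum of \<open>h n, \<dots>, h (n + j)\<close>.\<close>
  define mx where "mx n j = rec_nat (h n) (\<lambda>j F w. max (F w) (h (n + Suc j) w)) j" for n j
  have mx0: "mx n 0 = h n" and mxS: "mx n (Suc j) = (\<lambda>w. max (mx n j w) (h (n + Suc j) w))" for n j
    by (simp_all add: mx_def)
  have mx_nonneg: "nonneg (mx n j)" for n j
  proof (induction j)
    case (Suc j)
    then show ?case using h[of "n + Suc j"] unfolding mxS nonneg_def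
      by (auto intro!: continuous_intros)
  qed (simp add: mx0 h)
  have mx_upper: "h (n + i) w \<le> mx n j w" if "i \<le> j" for n i j w
    using that by (induction j) (auto simp: mx0 mxS le_Suc_eq intro: max.coboundedI1 max.coboundedI2)
  have mx_least: "mx n j w \<le> B" if "\<And>i. i \<le> j \<Longrightarrow> h (n + i) w \<le> B" for n j w B
    using that
  proof (induction j)
    case (Suc j)
    then show ?case using Suc.prems[of "Suc j"] by (simp add: mxS)
  qed (use mx0 in force)
  have mx_mono: "mx n j w \<le> mx n' j' w" if "n' \<le> n" "n + j \<le> n' + j'" for n n' j j' w
  proof (rule mx_least)
    fix i assume "i \<le> j"
    then have "h (n' + (n - n' + i)) w \<le> mx n' j' w" using that by (intro mx_upper) auto
    then show "h (n + i) w \<le> mx n' j' w" using that by simp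
  qed
  have "\<exists>J. \<forall>j. variation (mx n j) \<le> variation (mx n J) + \<epsilon> / 2 ^ (n + 2)" for n
  proof -
    have bdd: "bdd_above (range (\<lambda>j. variation (mx n j)))"
      by (rule bdd_aboveI[of _ "C * M"]) (auto intro!: variation_le_bound mx_nonneg mx_least M)
    have "(SUP j. variation (mx n j)) - \<epsilon> / 2 ^ (n + 2) < (SUP j. variation (mx n j))" using e by simp
    then obtain J where "(SUP j. variation (mx n j)) - \<epsilon> / 2 ^ (n + 2) < variation (mx n J)"
      using less_cSup_iff[of "range (\<lambda>j. variation (mx n j))"] bdd by auto
    moreover have "variation (mx n j) \<le> (SUP j. variation (mx n j))" for j
      by (rule cSUP_upper[OF _ bdd]) simp
    ultimately show ?thesis by (intro exI[of _ J]) (smt (verit))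
  qed
  then obtain J where J: "\<And>n j. variation (mx n j) \<le> variation (mx n (J n)) + \<epsilon> / 2 ^ (n + 2)"
    by metis
  define G where "G n = mx n (J n)" for n
  define H where "H n = rec_nat (G 0) (\<lambda>n F w. min (F w) (G (Suc n) w)) n" for n
  have H0: "H 0 = G 0" and HS: "H (Suc n) = (\<lambda>w. min (H n w) (G (Suc n) w))" for n
    by (simp_all add: H_def)
  have G_nonneg: "nonneg (G n)" for n unfolding G_def by (rule mx_nonneg)
  have H_nonneg: "nonneg (H n)" for n
  proof (induction n)
    case (Suc n)
    then show ?case using G_nonneg[of "Suc n"] unfolding HS nonneg_def
      by (auto intro!: continuous_intros)
  qed (simp add: H0 G_nonneg)
  have H_le: "H n w \<le> G i w" if "i \<le> n" for n i w
    using that by (induction n) (auto simp: H0 HS le_Suc_eq intro: min.coboundedI1)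
  have H_attained: "\<exists>i\<le>n. H n w = G i w" for n w
  proof (induction n)
    case (Suc n)
    then obtain i where "i \<le> n" "H n w = G i w" by blast
    then show ?case by (cases "H n w \<le> G (Suc n) w") (auto simp: HS min_def intro: le_SucI)
  qed (simp add: H0)
  have main: "variation (h n) \<le> variation (H n) + \<epsilon> / 2" for n
  proof -
    \<comment> \<open>An index beyond the range of each of the maxima \<open>G 0, \<dots>, G n\<close>.\<close>
    define N where "N = n + (\<Sum>i\<le>n. J i)"
    have JN: "i + J i \<le> N" if "i \<le> n" for i
      using member_le_sum[of i "{..n}" J] that by (simp add: N_def)
    define G' where "G' i = mx i (N - i)" for i
    have GG': "G i w \<le> G' i w" if "i \<le> n" for i w
      unfolding G_def G'_def using JN[OF that] by (intro mx_mono) auto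
    define D where "D i w = G' i w - G i w" for i w
    have D: "nonneg (D i)" if "i \<le> n" for i
      using GG'[OF that] mx_nonneg[of i "N - i"] G_nonneg[of i]
      unfolding D_def nonneg_def G'_def by (auto intro!: continuous_intros)
    have varD: "variation (D i) \<le> \<epsilon> / 2 ^ (i + 2)" if "i \<le> n" for i
    proof -
      have "variation (G' i) = variation (\<lambda>w. G i w + D i w)" by (simp add: D_def)
      also have "\<dots> = variation (G i) + variation (D i)" by (rule variation_add[OF G_nonneg D[OF that]])
      finally show ?thesis using J[of i "N - i"] by (simp add: G'_def G_def)
    qed
    have S: "nonneg (\<lambda>w. \<Sum>i\<le>n. D i w)" using D by (intro nonneg_sum) auto
    have "variation (h n) \<le> variation (\<lambda>w. H n w + (\<Sum>i\<le>n. D i w))"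
    proof (intro variation_mono h nonneg_add H_nonneg S)
      fix w assume w: "w \<in> W"
      obtain i where i: "i \<le> n" "H n w = G i w" using H_attained by blast
      have "h n w \<le> G' n w" using mx_upper[of 0 "N - n" n w] by (simp add: G'_def)
      also have "\<dots> \<le> G' i w" unfolding G'_def using i JN by (intro mx_mono) (auto simp: N_def)
      also have "\<dots> = H n w + D i w" using i by (simp add: D_def)
      also have "D i w \<le> (\<Sum>i\<le>n. D i w)"
        using D w i(1) by (intro member_le_sum) (auto simp: nonneg_def)
      finally show "h n w \<le> H n w + (\<Sum>i\<le>n. D i w)" by simp
    qed
    also have "\<dots> = variation (H n) + (\<Sum>i\<le>n. variation (D i))"
      using D by (subst variation_add[OF H_nonneg S], subst variation_sum) auto
    also have "(\<Sum>i\<le>n. variation (D i)) \<le> (\<Sum>i\<le>n. \<epsilon> / 2 ^ (i + 2))"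
      using varD by (intro sum_mono) auto
    also have "(\<Sum>i\<le>n. \<epsilon> / 2 ^ (i + 2)) = \<epsilon> / 2 - \<epsilon> / 2 ^ (n + 2)"
      by (induction n) (auto simp: field_simps)
    also have "\<dots> \<le> \<epsilon> / 2" using e by simp
    finally show ?thesis by simp
  qed
  define \<delta> where "\<delta> = \<epsilon> / (4 * (C + 1))"
  have d: "\<delta> > 0" using e C0 by (simp add: \<delta>_def)
  obtain n where n: "\<And>w. w \<in> W \<Longrightarrow> H n w < \<delta>"
  proof (rule Dini_pointwise_zero[OF compact_W, of H \<delta>])
    show "continuous_on W (H n)" for n using H_nonneg by (simp add: nonneg_def)
    show "H (Suc n) w \<le> H n w" for n w by (simp add: HS)
    show "\<exists>n. H n w < \<delta>" if w: "w \<in> W" for w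
    proof -
      obtain n where n: "\<And>k. k \<ge> n \<Longrightarrow> \<bar>h k w\<bar> < \<delta> / 2"
        using lim[OF w] d unfolding LIMSEQ_iff by (metis diff_zero half_gt_zero real_norm_def)
      have "H n w \<le> G n w" by (rule H_le) simp
      also have "\<dots> \<le> \<delta> / 2" unfolding G_def
      proof (rule mx_least)
        show "h (n + i) w \<le> \<delta> / 2" for i using n[of "n + i"] by auto
      qed
      finally show ?thesis using d by (intro exI[of _ n]) linarith
    qed
  qed (rule that)
  have "\<epsilon> \<le> variation (H n) + \<epsilon> / 2" using large[of n] main[of n] by simp
  also have "variation (H n) \<le> C * \<delta>" using n d by (intro variation_le_bound H_nonneg) (auto intro: less_imp_le)
  also have "C * \<delta> \<le> \<epsilon> / 4"
    using e C0 by (simp add: \<delta>_def field_simps)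
  finally show False using e by simp
qed

theorem dominated_convergence:
  assumes f: "\<And>n. continuous_on W (f n)" and M: "\<And>n w. w \<in> W \<Longrightarrow> \<bar>f n w\<bar> \<le> M"
    and lim: "\<And>w. w \<in> W \<Longrightarrow> (\<lambda>n. f n w) \<longlonglongrightarrow> 0"
    and large: "\<And>n. \<epsilon> \<le> \<bar>\<Lambda> (f n)\<bar>"
  shows "\<epsilon> \<le> 0"
proof (rule not_uniformly_large)
  show "nonneg (\<lambda>w. \<bar>f n w\<bar>)" for n using f by (auto simp: nonneg_def intro!: continuous_intros)
  show "\<bar>f n w\<bar> \<le> max 0 M" if "w \<in> W" for n w using M[OF that, of n] by simp
  show "(\<lambda>n. \<bar>f n w\<bar>) \<longlonglongrightarrow> 0" if "w \<in> W" for w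
    using tendsto_rabs_zero[OF lim[OF that]] .
  show "\<epsilon> \<le> variation (\<lambda>w. \<bar>f n w\<bar>)" for n
    using large[of n] abs_le_variation[OF f[of n]] by simp
qed simp

end

lemma continuous_map_real_epsI:
  assumes "\<And>y \<epsilon>. y \<in> topspace Y \<Longrightarrow> \<epsilon> > 0 \<Longrightarrow> \<exists>U. openin Y U \<and> y \<in> U \<and> (\<forall>z\<in>U. \<bar>f z - f y\<bar> < \<epsilon>)"
  shows "real_continuous Y f"
  unfolding continuous_map_def
proof (intro conjI allI impI)
  fix S :: "real set" assume "openin euclidean S"
  then have S: "open S" by simp
  show "openin Y {y \<in> topspace Y. f y \<in> S}"
  proof (subst openin_subopen, clarify)
    fix y assume y: "y \<in> topspace Y" "f y \<in> S"
    then obtain \<epsilon> where e: "\<epsilon> > 0" "ball (f y) \<epsilon> \<subseteq> S" using S open_contains_ball by blast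
    then obtain U where U: "openin Y U" "y \<in> U" "\<forall>z\<in>U. \<bar>f z - f y\<bar> < \<epsilon>"
      using assms[OF y(1) e(1)] by auto
    have "U \<subseteq> {y \<in> topspace Y. f y \<in> S}"
      using U e(2) openin_subset[OF U(1)] by (force simp: dist_real_def abs_minus_commute)
    then show "\<exists>T. openin Y T \<and> y \<in> T \<and> T \<subseteq> {y \<in> topspace Y. f y \<in> S}" using U by blast
  qed
qed simp

context pointwise_compact_family
begin

text \<open>Outside \<open>W\<close> the value is \<open>0\<close>, so that evaluations belong to \<open>continuous_functions_on W\<close> below.\<close>
definition ev :: "'b \<Rightarrow> ('b \<Rightarrow> real) \<Rightarrow> real" where
  "ev y = (\<lambda>w. if w \<in> W then w y else 0)"

lemma continuous_on_ev: "continuous_on W (ev y)"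
proof -
  have "continuous_on W (\<lambda>w. w y)"
    using continuous_on_product_coordinates by (rule continuous_on_subset) simp
  then show ?thesis by (rule continuous_on_eq) (simp add: ev_def)
qed

lemma inj_on_ev:
  assumes "\<And>y z. y \<in> S \<Longrightarrow> z \<in> S \<Longrightarrow> y \<noteq> z \<Longrightarrow> \<exists>w\<in>W. w y \<noteq> w z"
  shows "inj_on ev S"
proof (rule inj_onI, rule ccontr)
  fix y z assume "y \<in> S" "z \<in> S" "ev y = ev z" "y \<noteq> z"
  then obtain w where "w \<in> W" "w y \<noteq> w z" using assms by blast
  then show False using fun_cong[OF \<open>ev y = ev z\<close>, of w] by (simp add: ev_def)
qed

text \<open>Grothendieck's theorem. If continuity failed at \<open>y\<close>, then \<open>y\<close> would be adherent to a set on which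
  \<open>\<Lambda> \<circ> ev\<close> stays away from its value at \<open>y\<close>, so by \<open>adherent_sequence\<close> a sequence in that set would converge to
  \<open>y\<close> pointwise on \<open>W\<close>, against \<open>dominated_convergence\<close>.\<close>
theorem functional_continuous_on_points:
  assumes "bounded_functional W \<Lambda> C"
  shows "real_continuous Y (\<lambda>y. \<Lambda> (ev y))"
proof (rule continuous_map_real_epsI, rule ccontr)
  interpret bounded_functional W \<Lambda> C by (rule assms)
  fix y \<epsilon> assume y: "y \<in> topspace Y" and e: "\<epsilon> > (0::real)"
    and neg: "\<not> (\<exists>U. openin Y U \<and> y \<in> U \<and> (\<forall>z\<in>U. \<bar>\<Lambda> (ev z) - \<Lambda> (ev y)\<bar> < \<epsilon>))"
  define S where "S = {z \<in> topspace Y. \<epsilon> \<le> \<bar>\<Lambda> (ev z) - \<Lambda> (ev y)\<bar>}"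
  have SY: "S \<subseteq> topspace Y" by (auto simp: S_def)
  have adh: "adherent S (ev y)"
    unfolding adherent_def
  proof (intro allI impI, elim conjE)
    fix F and \<delta> :: real assume F: "finite F" "F \<subseteq> W" "\<delta> > 0"
    let ?U = "{z \<in> topspace Y. \<forall>w\<in>F. \<bar>w z - w y\<bar> < \<delta>}"
    have "openin Y ?U" using openin_finite_conditions[of F "topspace Y" "\<lambda>w. w y" \<delta>] F by simp
    moreover have "y \<in> ?U" using y F by simp
    ultimately obtain z where "z \<in> ?U" "\<not> \<bar>\<Lambda> (ev z) - \<Lambda> (ev y)\<bar> < \<epsilon>" using neg by blast
    then show "\<exists>z\<in>S. \<forall>w\<in>F. \<bar>w z - ev y w\<bar> < \<delta>" using F by (auto simp: S_def ev_def)
  qed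
  obtain z where z: "\<And>n. z n \<in> S" "\<And>w. w \<in> W \<Longrightarrow> (\<lambda>n::nat. w (z n)) \<longlonglongrightarrow> ev y w"
    by (rule adherent_sequence[of "\<lambda>_. S", OF SY adh]) (rule that)
  define f where "f n w = ev (z n) w - ev y w" for n w
  have cont: "continuous_on W (f n)" for n
    unfolding f_def by (intro continuous_intros continuous_on_ev)
  have "\<epsilon> \<le> 0"
  proof (rule dominated_convergence[of f "2 * M"])
    show "continuous_on W (f n)" for n by (rule cont)
    show "\<bar>f n w\<bar> \<le> 2 * M" if "w \<in> W" for n w
      using bounded_W[OF that y] bounded_W[OF that, of "z n"] z(1)[of n] that
      by (auto simp: f_def ev_def S_def)
    show "(\<lambda>n. f n w) \<longlonglongrightarrow> 0" if "w \<in> W" for w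
      using tendsto_diff[OF z(2)[OF that] tendsto_const[of "ev y w"]] that by (simp add: f_def ev_def)
    show "\<epsilon> \<le> \<bar>\<Lambda> (f n)\<bar>" for n
    proof -
      have "\<Lambda> (ev (z n)) = \<Lambda> (\<lambda>w. f n w + ev y w)" by (simp add: f_def)
      also have "\<dots> = \<Lambda> (f n) + \<Lambda> (ev y)" by (rule add[OF cont continuous_on_ev])
      finally show ?thesis using z(1)[of n] by (simp add: S_def)
    qed
  qed
  then show False using e by simp
qed

end

text \<open>Fixing the value \<open>0\<close> outside \<open>W\<close> makes equality on \<open>W\<close> the same as equality, as a norm requires, and it is
  preserved by the unrestricted pointwise operations.\<close>
definition continuous_functions_on :: "'c::topological_space set \<Rightarrow> ('c \<Rightarrow> real) set" where
  "continuous_functions_on W = {F. continuous_on W F \<and> (\<forall>w. w \<notin> W \<longrightarrow> F w = 0)}"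

lemma continuous_on_compact_bdd:
  fixes F :: "'c::topological_space \<Rightarrow> real"
  assumes "compact W" "continuous_on W F"
  shows "bdd_above ((\<lambda>w. \<bar>F w\<bar>) ` W)"
proof -
  have "bounded ((\<lambda>w. \<bar>F w\<bar>) ` W)"
    using assms by (intro compact_imp_bounded compact_continuous_image continuous_intros)
  then show ?thesis by (rule bounded_imp_bdd_above)
qed

lemma banach_space_on_continuous_functions:
  fixes W :: "'c::topological_space set"
  assumes W: "compact W" "W \<noteq> {}"
  shows "banach_space_on (continuous_functions_on W) (\<lambda>F G w. F w + G w) (\<lambda>c F w. c * F w) (\<lambda>_. 0)
           (\<lambda>F. SUP w\<in>W. \<bar>F w\<bar>)"
proof -
  define nr where "nr F = (SUP w\<in>W. \<bar>F w\<bar>)" for F :: "'c \<Rightarrow> real"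
  have upper: "\<bar>F w\<bar> \<le> nr F" if "continuous_on W F" "w \<in> W" for F w
    unfolding nr_def by (rule cSUP_upper[OF that(2) continuous_on_compact_bdd[OF W(1) that(1)]])
  have least: "nr F \<le> B" if "\<And>w. w \<in> W \<Longrightarrow> \<bar>F w\<bar> \<le> B" for F B
    unfolding nr_def by (rule cSUP_least[OF W(2) that])
  have nneg: "nr F \<ge> 0" if "continuous_on W F" for F
    using upper[OF that] W(2) by (meson abs_ge_zero order_trans ex_in_conv)
  have "banach_space_on (continuous_functions_on W) (\<lambda>F G w. F w + G w) (\<lambda>c F w. c * F w) (\<lambda>_. 0) nr"
  proof
    fix F assume F: "F \<in> continuous_functions_on W"
    show "nr F = 0 \<longleftrightarrow> F = (\<lambda>_. 0)"
    proof
      assume "nr F = 0"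
      then have "F w = 0" for w
        using upper[of F w] F by (cases "w \<in> W") (auto simp: continuous_functions_on_def)
      then show "F = (\<lambda>_. 0)" by auto
    next
      assume "F = (\<lambda>_. 0)"
      then show "nr F = 0" using least[of F 0] nneg[of F] F by (auto simp: continuous_functions_on_def)
    qed
    fix c
    show "nr (\<lambda>w. c * F w) = \<bar>c\<bar> * nr F"
    proof (rule antisym)
      show "nr (\<lambda>w. c * F w) \<le> \<bar>c\<bar> * nr F"
        using upper[of F] F by (intro least) (auto simp: abs_mult continuous_functions_on_def intro!: mult_left_mono)
      show "\<bar>c\<bar> * nr F \<le> nr (\<lambda>w. c * F w)"
      proof (cases "c = 0")
        case True
        then show ?thesis using nneg[of "\<lambda>w. c * F w"] by (simp add: continuous_intros)
      next
        case False
        have "nr F \<le> nr (\<lambda>w. c * F w) / \<bar>c\<bar>"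
        proof (rule least)
          fix w assume "w \<in> W"
          then have "\<bar>c * F w\<bar> \<le> nr (\<lambda>w. c * F w)"
            using F by (intro upper) (auto simp: continuous_functions_on_def intro!: continuous_intros)
          then show "\<bar>F w\<bar> \<le> nr (\<lambda>w. c * F w) / \<bar>c\<bar>" using False by (simp add: field_simps abs_mult)
        qed
        then show ?thesis using False by (simp add: field_simps)
      qed
    qed
  next
    fix F G assume FG: "F \<in> continuous_functions_on W" "G \<in> continuous_functions_on W"
    show "nr (\<lambda>w. F w + G w) \<le> nr F + nr G"
    proof (rule least)
      fix w assume "w \<in> W"
      then show "\<bar>F w + G w\<bar> \<le> nr F + nr G"
        using upper[of F w] upper[of G w] FG by (auto simp: continuous_functions_on_def)
    qed
  next
    fix s :: "nat \<Rightarrow> 'c \<Rightarrow> real"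
    assume s: "\<And>n. s n \<in> continuous_functions_on W"
      and cau: "\<And>e. e > 0 \<Longrightarrow> \<exists>N. \<forall>m\<ge>N. \<forall>n\<ge>N. nr (\<lambda>w. s m w + - 1 * s n w) < e"
    have sc: "continuous_on W (s n)" and s0: "w \<notin> W \<Longrightarrow> s n w = 0" for n w
      using s by (auto simp: continuous_functions_on_def)
    have "uniformly_Cauchy_on W s"
    proof (rule uniformly_Cauchy_onI)
      fix e :: real assume "e > 0"
      then obtain N where N: "\<forall>m\<ge>N. \<forall>n\<ge>N. nr (\<lambda>w. s m w + - 1 * s n w) < e" using cau by blast
      have "dist (s m w) (s n w) < e" if "w \<in> W" "m \<ge> N" "n \<ge> N" for w m n
      proof -
        have "\<bar>s m w + - 1 * s n w\<bar> \<le> nr (\<lambda>w. s m w + - 1 * s n w)"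
          using that by (intro upper[of "\<lambda>w. s m w + - 1 * s n w"] continuous_intros sc)
        then show ?thesis using N that by (force simp: dist_real_def)
      qed
      then show "\<exists>N. \<forall>w\<in>W. \<forall>m\<ge>N. \<forall>n\<ge>N. dist (s m w) (s n w) < e" by blast
    qed
    then obtain l where l: "uniform_limit W s l sequentially"
      using uniformly_convergent_eq_Cauchy uniformly_convergent_on_def by blast
    define L where "L w = (if w \<in> W then l w else 0)" for w
    have uL: "uniform_limit W s L sequentially"
      using l by (rule uniform_limit_cong'[THEN iffD1, rotated 2]) (auto simp: L_def)
    have Lc: "continuous_on W L"
      by (rule uniform_limit_theorem[OF _ uL]) (auto simp: sc)
    have "(\<lambda>n. nr (\<lambda>w. s n w + - 1 * L w)) \<longlonglongrightarrow> 0"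
    proof (rule LIMSEQ_I)
      fix r :: real assume "r > 0"
      then obtain N where N: "\<And>n w. n \<ge> N \<Longrightarrow> w \<in> W \<Longrightarrow> dist (s n w) (L w) < r / 2"
        using uL half_gt_zero unfolding uniform_limit_sequentially_iff by metis
      have "norm (nr (\<lambda>w. s n w + - 1 * L w) - 0) < r" if "n \<ge> N" for n
      proof -
        have "nr (\<lambda>w. s n w + - 1 * L w) \<le> r / 2"
          using N[OF that] by (intro least) (auto simp: dist_real_def intro: less_imp_le)
        moreover have "nr (\<lambda>w. s n w + - 1 * L w) \<ge> 0" by (intro nneg continuous_intros sc Lc)
        ultimately show ?thesis using \<open>r > 0\<close> by simp
      qed
      then show "\<exists>no. \<forall>n\<ge>no. norm (nr (\<lambda>w. s n w + - 1 * L w) - 0) < r" by blast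
    qed
    moreover have "L \<in> continuous_functions_on W" using Lc by (simp add: continuous_functions_on_def L_def)
    ultimately show "\<exists>l\<in>continuous_functions_on W. (\<lambda>n. nr (\<lambda>w. s n w + - 1 * l w)) \<longlonglongrightarrow> 0" by blast
  qed (auto simp: continuous_functions_on_def algebra_simps intro!: continuous_intros)
  then show ?thesis by (simp add: nr_def[abs_def])
qed

context pointwise_compact_family
begin

text \<open>Evaluation is weakly continuous by \<open>functional_continuous_on_points\<close> and injective since \<open>W\<close> separates
  points; from a compact space into a Hausdorff one it is therefore an embedding. Point evaluations at
  elements of \<open>W\<close> are bounded functionals, which gives the Hausdorff property.\<close>
theorem Eberlein_compact_if_separating:
  assumes Y: "compact_space Y" "Hausdorff_space Y" and "W \<noteq> {}"
    and sep: "\<And>y z. y \<in> topspace Y \<Longrightarrow> z \<in> topspace Y \<Longrightarrow> y \<noteq> z \<Longrightarrow> \<exists>w\<in>W. w y \<noteq> w z"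
  shows "Eberlein_compact_in TYPE(('b \<Rightarrow> real) \<Rightarrow> real) Y"
proof -
  let ?V = "continuous_functions_on W"
  let ?add = "\<lambda>(F :: ('b \<Rightarrow> real) \<Rightarrow> real) G w. F w + G w"
  let ?scale = "\<lambda>c (F :: ('b \<Rightarrow> real) \<Rightarrow> real) w. c * F w"
  let ?nrm = "\<lambda>F :: ('b \<Rightarrow> real) \<Rightarrow> real. SUP w\<in>W. \<bar>F w\<bar>"
  have banach: "banach_space_on ?V ?add ?scale (\<lambda>_. 0) ?nrm"
    by (rule banach_space_on_continuous_functions[OF compact_W \<open>W \<noteq> {}\<close>])
  interpret B: banach_space_on ?V ?add ?scale "\<lambda>_. 0" ?nrm by (rule banach)
  have evV: "ev y \<in> ?V" for y
    using continuous_on_ev by (simp add: continuous_functions_on_def ev_def)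
  have nrm_bound: "?nrm F \<le> b" if "\<And>w. w \<in> W \<Longrightarrow> \<bar>F w\<bar> \<le> b" for F b
    by (rule cSUP_least[OF \<open>W \<noteq> {}\<close> that])
  have functional: "\<exists>C. bounded_functional W (\<lambda>F. f (\<lambda>w. if w \<in> W then F w else 0)) C"
    if f: "f \<in> B.dual" for f
  proof -
    let ?r = "\<lambda>(F :: ('b \<Rightarrow> real) \<Rightarrow> real) w. if w \<in> W then F w else 0"
    have rV: "?r F \<in> ?V" if "continuous_on W F" for F :: "('b \<Rightarrow> real) \<Rightarrow> real"
      using that by (auto simp: continuous_functions_on_def intro: continuous_on_eq)
    from f obtain C where C: "\<And>F. F \<in> ?V \<Longrightarrow> \<bar>f F\<bar> \<le> C * ?nrm F"
      unfolding B.dual_def by blast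
    have fadd: "f (\<lambda>w. F w + G w) = f F + f G" if "F \<in> ?V" "G \<in> ?V" for F G
      using f that unfolding B.dual_def by blast
    have "bounded_functional W (\<lambda>F. f (?r F)) \<bar>C\<bar>"
    proof
      show "compact W" by (rule compact_W)
      fix F G :: "('b \<Rightarrow> real) \<Rightarrow> real"
      assume FG: "continuous_on W F" "continuous_on W G"
      have "(\<lambda>w. ?r F w + ?r G w) = ?r (\<lambda>w. F w + G w)" by auto
      then show "f (?r (\<lambda>w. F w + G w)) = f (?r F) + f (?r G)"
        using fadd[OF rV[OF FG(1)] rV[OF FG(2)]] by simp
    next
      fix F :: "('b \<Rightarrow> real) \<Rightarrow> real" and B
      assume F: "continuous_on W F" "\<And>w. w \<in> W \<Longrightarrow> \<bar>F w\<bar> \<le> B" "(0::real) \<le> B"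
      have n: "?nrm (?r F) \<le> B" using F by (intro nrm_bound) auto
      have n0: "?nrm (?r F) \<ge> 0"
      proof -
        obtain w where "w \<in> W" using \<open>W \<noteq> {}\<close> by blast
        have "\<bar>?r F w\<bar> \<le> ?nrm (?r F)"
          using rV[OF F(1)] by (intro cSUP_upper \<open>w \<in> W\<close> continuous_on_compact_bdd[OF compact_W])
             (simp add: continuous_functions_on_def)
        then show ?thesis by (meson abs_ge_zero order_trans)
      qed
      have "\<bar>f (?r F)\<bar> \<le> C * ?nrm (?r F)" by (rule C[OF rV[OF F(1)]])
      also have "\<dots> \<le> \<bar>C\<bar> * ?nrm (?r F)" using n0 by (intro mult_right_mono) auto
      also have "\<dots> \<le> \<bar>C\<bar> * B" using n by (intro mult_left_mono) auto
      finally show "\<bar>f (?r F)\<bar> \<le> \<bar>C\<bar> * B" .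
    qed
    then show ?thesis by blast
  qed
  have cont: "continuous_map Y B.weak_topology ev"
    unfolding B.weak_topology_def
  proof (rule continuous_on_generated_topo)
    fix U assume "U \<in> {{x \<in> ?V. f x \<in> U} | f U. f \<in> B.dual \<and> open U}"
    then obtain f S where U: "U = {x \<in> ?V. f x \<in> S}" and f: "f \<in> B.dual" and S: "open S" by blast
    obtain C where "bounded_functional W (\<lambda>F. f (\<lambda>w. if w \<in> W then F w else 0)) C"
      using functional[OF f] by blast
    then have "real_continuous Y (\<lambda>y. f (\<lambda>w. if w \<in> W then ev y w else 0))"
      by (rule functional_continuous_on_points)
    moreover have "(\<lambda>w. if w \<in> W then ev y w else 0) = ev y" for y by (auto simp: ev_def)
    ultimately have "real_continuous Y (\<lambda>y. f (ev y))" by simp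
    then have "openin Y {y \<in> topspace Y. f (ev y) \<in> S}"
      using S by (rule openin_real_preimage)
    moreover have "ev -` U \<inter> topspace Y = {y \<in> topspace Y. f (ev y) \<in> S}"
      using evV by (auto simp: U)
    ultimately show "openin Y (ev -` U \<inter> topspace Y)" by simp
  next
    have "\<Union> {{x \<in> ?V. f x \<in> U} | f U. f \<in> B.dual \<and> open U} = ?V"
      using B.topspace_weak_topology unfolding B.weak_topology_def topology_generated_by_topspace .
    then show "ev ` topspace Y \<subseteq> \<Union> {{x \<in> ?V. f x \<in> U} | f U. f \<in> B.dual \<and> open U}"
      using evV by (simp only:) (rule image_subsetI)
  qed
  define K where "K = ev ` topspace Y"
  have "compactin Y (topspace Y)" using Y(1) by (simp add: compact_space_def)
  then have K: "compactin B.weak_topology K"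
    unfolding K_def using cont by (rule image_compactin)
  have KV: "K \<subseteq> ?V" unfolding K_def using evV by blast
  have "Hausdorff_space (subtopology B.weak_topology K)"
    unfolding Hausdorff_space_def
  proof (intro allI impI)
    fix F G assume "F \<in> topspace (subtopology B.weak_topology K) \<and> G \<in> topspace (subtopology B.weak_topology K) \<and> F \<noteq> G"
    then have FG: "F \<in> ?V" "G \<in> ?V" "F \<in> K" "G \<in> K" "F \<noteq> G" by auto
    then obtain w where w: "F w \<noteq> G w" by blast
    then have wW: "w \<in> W" using FG by (auto simp: continuous_functions_on_def)
    obtain S T where ST: "open S" "open T" "F w \<in> S" "G w \<in> T" "S \<inter> T = {}"
      using hausdorff[OF w] by blast
    have dual: "(\<lambda>F. F w) \<in> B.dual"
      unfolding B.dual_def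
    proof (intro CollectI conjI exI[of _ 1] ballI)
      fix F assume "F \<in> ?V"
      then show "\<bar>F w\<bar> \<le> 1 * ?nrm F"
        using cSUP_upper[OF wW continuous_on_compact_bdd[OF compact_W]] by (simp add: continuous_functions_on_def)
    qed auto
    have opn: "openin B.weak_topology {x \<in> ?V. x w \<in> S}" if "open S" for S
      unfolding B.weak_topology_def 
      by (intro topology_generated_by_Basis CollectI exI[of _ "\<lambda>F. F w"] exI[of _ S] conjI refl dual that)
    have "openin (subtopology B.weak_topology K) (K \<inter> {x \<in> ?V. x w \<in> S})"
         "openin (subtopology B.weak_topology K) (K \<inter> {x \<in> ?V. x w \<in> T})"
      by (intro openin_subtopology_Int2 opn ST)+
    then show "\<exists>U V. openin (subtopology B.weak_topology K) U \<and> openin (subtopology B.weak_topology K) V \<and> F \<in> U \<and> G \<in> V \<and> disjnt U V"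
      using FG ST by (intro exI[of _ "K \<inter> {x \<in> ?V. x w \<in> S}"] exI[of _ "K \<inter> {x \<in> ?V. x w \<in> T}"])
         (auto simp: disjnt_def)
  qed
  moreover have "inj_on ev (topspace Y)" by (rule inj_on_ev[OF sep])
  moreover have "continuous_map Y (subtopology B.weak_topology K) ev"
    using cont by (auto simp: continuous_map_in_subtopology K_def)
  moreover have "topspace (subtopology B.weak_topology K) = ev ` topspace Y"
    using KV by (auto simp: K_def)
  ultimately have "homeomorphic_map Y (subtopology B.weak_topology K) ev"
    using Y(1) by (intro continuous_imp_homeomorphic_map) auto
  then have "Y homeomorphic_space subtopology B.weak_topology K"
    by (rule homeomorphic_map_imp_homeomorphic_space)
  with banach K Y show ?thesis
    unfolding Eberlein_compact_in_def by blast
qed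

end

section \<open>Compact spaces that dominate linearly\<close>

lemma compact_space_imp_bounded_real:
  assumes "compact_space X" "real_continuous X f"
  obtains B where "B \<ge> 0" "\<And>x. x \<in> topspace X \<Longrightarrow> \<bar>f x\<bar> \<le> B"
proof -
  have "compactin euclideanreal (f ` topspace X)"
    using assms by (intro image_compactin[of X]) (auto simp: compact_space_def)
  then have "bounded (f ` topspace X)" by (simp add: compact_imp_bounded)
  then obtain B where "\<forall>z\<in>f ` topspace X. norm z \<le> B" unfolding bounded_iff by blast
  then show thesis using that[of "max 0 B"] by (simp add: le_max_iff_disj)
qed

text \<open>The functionals \<open>\<mu> y f = \<phi> f y\<close> of a continuous linear surjection \<open>\<phi>\<close>, for functions \<open>f\<close> that are not
  required to be extensional. Continuity of \<open>\<phi>\<close> enters as \<open>finite_bound\<close>, which is continuity of \<open>\<mu> y\<close> for the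
  topology of pointwise convergence.\<close>
locale linear_domination =
  fixes X :: "'a topology" and Y :: "'b topology" and \<mu> :: "'b \<Rightarrow> ('a \<Rightarrow> real) \<Rightarrow> real"
  assumes Tychonoff_X: "Tychonoff_space X" and Tychonoff_Y: "Tychonoff_space Y"
    and add: "\<lbrakk>y \<in> topspace Y; real_continuous X f; real_continuous X g\<rbrakk>
      \<Longrightarrow> \<mu> y (\<lambda>x. f x + g x) = \<mu> y f + \<mu> y g"
    and scale: "\<lbrakk>y \<in> topspace Y; real_continuous X f\<rbrakk> \<Longrightarrow> \<mu> y (\<lambda>x. c * f x) = c * \<mu> y f"
    and finite_bound: "y \<in> topspace Y \<Longrightarrow> \<exists>F C. finite F \<and> F \<subseteq> topspace X \<and> 0 \<le> C \<and>
      (\<forall>f. real_continuous X f \<longrightarrow> \<bar>\<mu> y f\<bar> \<le> C * (\<Sum>x\<in>F. \<bar>f x\<bar>))"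
    and continuous_image: "real_continuous X f \<Longrightarrow> real_continuous Y (\<lambda>y. \<mu> y f)"
    and surjective: "real_continuous Y h \<Longrightarrow>
      \<exists>f. real_continuous X f \<and> (\<forall>y\<in>topspace Y. \<mu> y f = h y)"
begin

lemma diff:
  assumes "y \<in> topspace Y" "real_continuous X f" "real_continuous X g"
  shows "\<mu> y (\<lambda>x. f x - g x) = \<mu> y f - \<mu> y g"
  using add[OF assms(1), of f "\<lambda>x. (-1) * g x"] scale[OF assms(1,3), of "-1"] assms
  by (simp add: continuous_map_minus)

lemma sup_bound:
  assumes "y \<in> topspace Y"
  shows "\<exists>K\<ge>0. \<forall>f B. real_continuous X f \<longrightarrow> (\<forall>x\<in>topspace X. \<bar>f x\<bar> \<le> B) \<longrightarrow> \<bar>\<mu> y f\<bar> \<le> K * B"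
proof -
  obtain F C where F: "finite F" "F \<subseteq> topspace X" "0 \<le> C"
      "\<And>f. real_continuous X f \<Longrightarrow> \<bar>\<mu> y f\<bar> \<le> C * (\<Sum>x\<in>F. \<bar>f x\<bar>)"
    using finite_bound[OF assms] by blast
  have "\<bar>\<mu> y f\<bar> \<le> (C * card F) * B"
    if f: "real_continuous X f" "\<forall>x\<in>topspace X. \<bar>f x\<bar> \<le> B" for f B
  proof -
    have "(\<Sum>x\<in>F. \<bar>f x\<bar>) \<le> card F * B" using f(2) F(2) by (intro sum_bounded_above) auto
    then have "C * (\<Sum>x\<in>F. \<bar>f x\<bar>) \<le> C * (card F * B)" using F(3) by (rule mult_left_mono)
    then show ?thesis using F(4)[OF f(1)] by (simp add: mult.assoc)
  qed
  then show ?thesis using F(3) by (intro exI[of _ "C * card F"]) auto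
qed

text \<open>For a locally finite sequence there would be a continuous function on \<open>Y\<close> with values at least
  \<open>n * (K n + 1)\<close> at \<open>y n\<close>, where \<open>K n\<close> bounds the norm of \<open>\<mu> (y n)\<close>. A function \<open>y \<mapsto> \<mu> y f\<close> has values at most
  \<open>K n * B\<close> there, where \<open>B\<close> bounds \<open>f\<close>.\<close>
theorem feebly_compact_target:
  assumes X: "compact_space X"
  shows "feebly_compact_space Y"
  unfolding feebly_compact_space_def
proof (intro allI impI, rule ccontr)
  fix U assume U: "\<forall>n::nat. openin Y (U n) \<and> U n \<noteq> {}"
    and neg: "\<not> (\<exists>q\<in>topspace Y. \<forall>T N. openin Y T \<and> q \<in> T \<longrightarrow> (\<exists>n\<ge>N. U n \<inter> T \<noteq> {}))"
  then have "\<forall>n. \<exists>y. y \<in> U n" by blast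
  then obtain y where y: "\<And>n. y n \<in> U n" by metis
  have yY: "y n \<in> topspace Y" for n using y U openin_subset by blast
  have "\<forall>n. \<exists>K\<ge>0. \<forall>f B. real_continuous X f \<longrightarrow> (\<forall>x\<in>topspace X. \<bar>f x\<bar> \<le> B) \<longrightarrow> \<bar>\<mu> (y n) f\<bar> \<le> K * B"
    using sup_bound[OF yY] by blast
  from choice[OF this] obtain K where K0: "\<forall>n. K n \<ge> 0 \<and> (\<forall>f B. real_continuous X f \<longrightarrow>
      (\<forall>x\<in>topspace X. \<bar>f x\<bar> \<le> B) \<longrightarrow> \<bar>\<mu> (y n) f\<bar> \<le> K n * B)" ..
  note K = K0[THEN spec, THEN conjunct1] K0[THEN spec, THEN conjunct2, THEN spec, THEN spec, THEN mp, THEN mp]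
  obtain g where g: "real_continuous Y g" "\<And>n. real n * (K n + 1) \<le> g (y n)"
  proof (rule completely_regular_locally_finite_bumps[of Y U y "\<lambda>n. real n * (K n + 1)"])
    show "completely_regular_space Y" using Tychonoff_Y by (simp add: Tychonoff_space_def)
    show "\<exists>T N. openin Y T \<and> q \<in> T \<and> (\<forall>n\<ge>N. U n \<inter> T = {})" if "q \<in> topspace Y" for q
    proof -
      from neg have "\<not> (\<forall>T N. openin Y T \<and> q \<in> T \<longrightarrow> (\<exists>n\<ge>N. U n \<inter> T \<noteq> {}))"
        by (rule contrapos_nn) (rule bexI[OF _ that])
      then show ?thesis by simp
    qed
    show "0 \<le> real n * (K n + 1)" for n using K(1)[of n] by simp
  qed (use U y that in auto)
  obtain f where f: "real_continuous X f" "\<forall>y\<in>topspace Y. \<mu> y f = g y"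
    using surjective[OF g(1)] by blast
  obtain B where B: "B \<ge> 0" "\<And>x. x \<in> topspace X \<Longrightarrow> \<bar>f x\<bar> \<le> B"
    by (rule compact_space_imp_bounded_real[OF X f(1)]) (rule that)
  obtain n where n: "real n > B" using reals_Archimedean2 by blast
  have "real n * (K n + 1) \<le> \<bar>\<mu> (y n) f\<bar>" using g(2)[of n] f(2) yY by fastforce
  also have "\<dots> \<le> K n * B" using K(2)[OF f(1)] B(2) by blast
  also have "\<dots> \<le> K n * real n" using n K(1) by (intro mult_left_mono) auto
  finally show False using n B(1) by (simp add: algebra_simps)
qed

text \<open>The uniform boundedness principle, by Sokal's gliding hump: if the norms \<open>nu (y n)\<close> exceed \<open>4 ^ n\<close>, steps of
  size \<open>3 ^ (-n)\<close> in nearly norming directions \<open>g n\<close>, with signs chosen so that \<open>\<mu> (y n)\<close> does not get cancelled,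
  converge uniformly to an \<open>L\<close> for which \<open>\<mu> (y n) L\<close> is unbounded. The later steps together are at most
  \<open>3 ^ (-n) / 2\<close>, which the factor \<open>2 / 3\<close> of the near norming outweighs. Boundedness of \<open>y \<mapsto> \<mu> y f\<close> for each \<open>f\<close>
  comes from feeble compactness of \<open>Y\<close>.\<close>
theorem uniformly_bounded:
  assumes X: "compact_space X"
  shows "\<exists>M. \<forall>y\<in>topspace Y. \<forall>f B. real_continuous X f \<longrightarrow>
    (\<forall>x\<in>topspace X. \<bar>f x\<bar> \<le> B) \<longrightarrow> B > 0 \<longrightarrow> \<bar>\<mu> y f\<bar> \<le> M * B"
proof -
  define unit_ball where "unit_ball = {f. real_continuous X f \<and> (\<forall>x\<in>topspace X. \<bar>f x\<bar> \<le> 1)}"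
  define nu where "nu y = (SUP f\<in>unit_ball. \<bar>\<mu> y f\<bar>)" for y
  have zero_ball: "(\<lambda>_. 0) \<in> unit_ball" by (simp add: unit_ball_def)
  have bdd: "bdd_above ((\<lambda>f. \<bar>\<mu> y f\<bar>) ` unit_ball)" if y: "y \<in> topspace Y" for y
  proof -
    obtain K where K: "\<And>f B. real_continuous X f \<Longrightarrow> \<forall>x\<in>topspace X. \<bar>f x\<bar> \<le> B \<Longrightarrow> \<bar>\<mu> y f\<bar> \<le> K * B"
      using sup_bound[OF y] by auto
    have "\<bar>\<mu> y f\<bar> \<le> K * 1" if "f \<in> unit_ball" for f
      using that by (intro K) (auto simp: unit_ball_def)
    then show ?thesis by (intro bdd_aboveI2[of _ _ K]) simp
  qed
  have nu: "\<bar>\<mu> y f\<bar> \<le> nu y * B"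
    if y: "y \<in> topspace Y" and f: "real_continuous X f" "\<And>x. x \<in> topspace X \<Longrightarrow> \<bar>f x\<bar> \<le> B"
      and B: "B > 0" for y f B
  proof -
    have "real_continuous X (\<lambda>x. (1 / B) * f x)" by (rule continuous_map_real_mult_left[OF f(1)])
    then have "(\<lambda>x. (1 / B) * f x) \<in> unit_ball"
      using f(2) B by (simp add: unit_ball_def abs_mult field_simps)
    then have "\<bar>\<mu> y (\<lambda>x. (1 / B) * f x)\<bar> \<le> nu y"
      unfolding nu_def by (rule cSUP_upper[OF _ bdd[OF y]])
    then have "\<bar>(1 / B) * \<mu> y f\<bar> \<le> nu y" by (simp only: scale[OF y f(1)])
    then show ?thesis using B by (simp add: abs_mult field_simps)
  qed
  have "\<exists>M. \<forall>y\<in>topspace Y. nu y \<le> M"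
  proof (rule ccontr)
    assume neg: "\<not> ?thesis"
    have "\<exists>y\<in>topspace Y. nu y > 4 ^ n" for n :: nat
      using neg by (meson not_le)
    then obtain y where y: "\<And>n. y n \<in> topspace Y" "\<And>n. nu (y n) > 4 ^ n" by metis
    have nu_pos: "nu (y n) > 0" for n
      using y(2)[of n] by (meson less_trans zero_less_numeral zero_less_power)
    have "\<exists>g\<in>unit_ball. \<bar>\<mu> (y n) g\<bar> > 2 / 3 * nu (y n)" for n
    proof -
      have "2 / 3 * nu (y n) < (SUP f\<in>unit_ball. \<bar>\<mu> (y n) f\<bar>)" using nu_pos[of n] by (simp add: nu_def)
      then show ?thesis using less_cSUP_iff[OF _ bdd[OF y(1)]] zero_ball by (metis empty_iff)
    qed
    then obtain g where g: "\<And>n. g n \<in> unit_ball" "\<And>n. \<bar>\<mu> (y n) (g n)\<bar> > 2 / 3 * nu (y n)" by metis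
    have gc: "real_continuous X (g n)" and g1: "x \<in> topspace X \<Longrightarrow> \<bar>g n x\<bar> \<le> 1" for n x
      using g(1) by (auto simp: unit_ball_def)
    define a where "a n = (1 / 3 :: real) ^ n" for n
    define s where "s n F = (if \<bar>\<mu> (y n) (\<lambda>x. F x + a n * g n x)\<bar> \<ge> \<bar>\<mu> (y n) (\<lambda>x. a n * g n x)\<bar> then a n else - a n)" for n F
    define F where "F n = rec_nat (\<lambda>_. 0) (\<lambda>n F x. F x + s n F * g n x) n" for n
    have F0: "F 0 = (\<lambda>_. 0)" and FS: "F (Suc n) = (\<lambda>x. F n x + s n (F n) * g n x)" for n
      by (simp_all add: F_def)
    have abs_s: "\<bar>s n f\<bar> = a n" for n f by (simp add: s_def a_def)
    have Fc: "real_continuous X (F n)" for n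
      by (induction n) (auto simp: F0 FS gc intro!: continuous_map_add continuous_map_real_mult_left)
    have FS_large: "\<bar>\<mu> (y n) (F (Suc n))\<bar> \<ge> a n * \<bar>\<mu> (y n) (g n)\<bar>" for n
    proof -
      have c: "\<mu> (y n) (\<lambda>x. F n x + t * g n x) = \<mu> (y n) (F n) + t * \<mu> (y n) (g n)" for t
        using add[OF y(1)[of n] Fc, of "\<lambda>x. t * g n x"] scale[OF y(1)[of n] gc]
        by (simp add: gc continuous_map_real_mult_left)
      have "\<mu> (y n) (\<lambda>x. a n * g n x) = a n * \<mu> (y n) (g n)" by (rule scale[OF y(1) gc])
      moreover have "a n > 0" by (simp add: a_def)
      ultimately show ?thesis unfolding FS s_def c by (auto simp: abs_mult)
    qed
    have increment: "\<bar>F (Suc n) x - F n x\<bar> \<le> a n" if "x \<in> topspace X" for n x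
      using g1[OF that, of n] mult_left_le[of "\<bar>g n x\<bar>" "a n"] by (simp add: FS abs_mult abs_s a_def)
    have tail: "\<bar>F m x - F n x\<bar> \<le> 3 / 2 * (a n - a m)" if "n \<le> m" "x \<in> topspace X" for m n x
      using that(1)
    proof (induction m rule: dec_induct)
      case (step m)
      have "a (Suc m) = a m / 3" by (simp add: a_def)
      moreover have "\<bar>F (Suc m) x - F n x\<bar> \<le> \<bar>F (Suc m) x - F m x\<bar> + \<bar>F m x - F n x\<bar>" by simp
      moreover have "3 / 2 * (a n - a (Suc m)) = 3 / 2 * (a n - a m) + a m"
        using \<open>a (Suc m) = a m / 3\<close> by (simp add: field_simps)
      ultimately show ?case using step.IH increment[OF that(2), of m] by linarith
    qed simp
    obtain L where L: "real_continuous X L"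
        "\<And>\<epsilon>. 0 < \<epsilon> \<Longrightarrow> \<forall>\<^sub>F n in sequentially. \<forall>x\<in>topspace X. dist (F n x) (L x) < \<epsilon>"
    proof (rule Met_TC.continuous_map_uniformly_Cauchy_limit[where X = X and f = F, unfolded mtopology_is_euclidean])
      show "Met_TC.mcomplete TYPE(real)" by (simp add: complete_UNIV mcomplete_iff_complete)
      show "\<exists>N. \<forall>m n x. N \<le> m \<longrightarrow> N \<le> n \<longrightarrow> x \<in> topspace X \<longrightarrow> dist (F m x) (F n x) < \<epsilon>"
        if e: "\<epsilon> > 0" for \<epsilon>
      proof -
        obtain N where N: "(1 / 3 :: real) ^ N < \<epsilon> / 3" using real_arch_pow_inv[of "\<epsilon> / 3" "1 / 3"] e by auto
        have "dist (F m x) (F n x) < \<epsilon>" if "N \<le> m" "N \<le> n" "x \<in> topspace X" for m n x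
        proof -
          have "a m \<ge> 0" "a n \<ge> 0" by (simp_all add: a_def)
          moreover have "dist (F m x) (F n x) \<le> \<bar>F m x - F N x\<bar> + \<bar>F n x - F N x\<bar>"
            by (simp add: dist_real_def)
          moreover have "a N < \<epsilon> / 3" using N by (simp add: a_def)
          ultimately show ?thesis using tail[OF that(1,3)] tail[OF that(2,3)]
            by (simp add: right_diff_distrib)
        qed
        then show ?thesis by blast
      qed
    qed (use Fc that in auto)
    have close: "\<bar>L x - F (Suc n) x\<bar> \<le> a n / 2" if x: "x \<in> topspace X" for n x
    proof (rule field_le_epsilon)
      fix e :: real assume "e > 0"
      then obtain N where "\<And>m. m \<ge> N \<Longrightarrow> \<forall>x\<in>topspace X. dist (F m x) (L x) < e"
        using L(2) unfolding eventually_sequentially by blast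
      then have "\<bar>F (max N (Suc n)) x - L x\<bar> < e" using x by (auto simp: dist_real_def)
      moreover have "\<bar>F (max N (Suc n)) x - F (Suc n) x\<bar> \<le> 3 / 2 * (a (Suc n) - a (max N (Suc n)))"
        by (rule tail) (use x in auto)
      moreover have "a (Suc n) = a n / 3" "a (max N (Suc n)) \<ge> 0" by (simp_all add: a_def)
      moreover have "\<bar>L x - F (Suc n) x\<bar> \<le> \<bar>F (max N (Suc n)) x - L x\<bar> + \<bar>F (max N (Suc n)) x - F (Suc n) x\<bar>"
        by simp
      ultimately show "\<bar>L x - F (Suc n) x\<bar> \<le> a n / 2 + e" by (simp add: right_diff_distrib)
    qed
    have grow: "\<bar>\<mu> (y n) L\<bar> \<ge> (4 / 3) ^ n / 6" for n
    proof -
      have an: "a n > 0" by (simp add: a_def)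
      have "\<mu> (y n) L = \<mu> (y n) (F (Suc n)) + \<mu> (y n) (\<lambda>x. L x - F (Suc n) x)"
        using diff[OF y(1) L(1) Fc] by simp
      moreover have "\<bar>\<mu> (y n) (\<lambda>x. L x - F (Suc n) x)\<bar> \<le> nu (y n) * (a n / 2)"
        using an by (intro nu y(1) continuous_map_diff L(1) Fc close) auto
      moreover have "a n * \<bar>\<mu> (y n) (g n)\<bar> \<ge> a n * (2 / 3 * nu (y n))"
        using an g(2)[of n] by (intro mult_left_mono) auto
      moreover have "a n * (2 / 3 * nu (y n)) - nu (y n) * (a n / 2) = a n * nu (y n) / 6"
        by (simp add: field_simps)
      moreover have "\<bar>p + q\<bar> \<ge> \<bar>p\<bar> - \<bar>q\<bar>" for p q :: real by simp
      ultimately have "\<bar>\<mu> (y n) L\<bar> \<ge> a n * nu (y n) / 6" using FS_large[of n] by (smt (verit))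
      moreover have "a n * nu (y n) \<ge> a n * 4 ^ n" using an y(2)[of n] by (intro mult_left_mono) auto
      moreover have "a n * 4 ^ n = (4 / 3) ^ n" by (simp add: a_def power_divide)
      ultimately show ?thesis by simp
    qed
    obtain B where B: "\<And>y. y \<in> topspace Y \<Longrightarrow> \<bar>\<mu> y L\<bar> \<le> B"
      by (rule feebly_compact_imp_bounded[OF feebly_compact_target[OF X] continuous_image[OF L(1)]]) (rule that)
    obtain n where "6 * B < (4 / 3) ^ n" using real_arch_pow[of "4 / 3" "6 * B"] by auto
    then show False using grow[of n] B[OF y(1)[of n]] by linarith
  qed
  then obtain M where M: "\<And>y. y \<in> topspace Y \<Longrightarrow> nu y \<le> M" by blast
  show ?thesis
  proof (intro exI[of _ M] ballI allI impI)
    fix y f and B :: real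
    assume y: "y \<in> topspace Y" and f: "real_continuous X f" "\<forall>x\<in>topspace X. \<bar>f x\<bar> \<le> B" and B: "B > 0"
    have "nu y * B \<le> M * B" using M[OF y] B by (intro mult_right_mono) auto
    then show "\<bar>\<mu> y f\<bar> \<le> M * B" using nu[OF y f(1) _ B] f(2) by fastforce
  qed
qed

end

text \<open>Evaluation at the elements of \<open>R\<close> embeds \<open>X\<close> as a compact set into a product of lines, where the theorem
  for topologies given by type classes applies.\<close>
theorem Stone_Weierstrass_compact_space:
  fixes R :: "('a \<Rightarrow> real) set"
  assumes X: "compact_space X"
    and R: "\<And>r. r \<in> R \<Longrightarrow> real_continuous X r"
    and add: "\<And>r s. r \<in> R \<Longrightarrow> s \<in> R \<Longrightarrow> (\<lambda>x. r x + s x) \<in> R"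
    and mult: "\<And>r s. r \<in> R \<Longrightarrow> s \<in> R \<Longrightarrow> (\<lambda>x. r x * s x) \<in> R"
    and const: "\<And>c. (\<lambda>_. c) \<in> R"
    and sep: "\<And>x y. x \<in> topspace X \<Longrightarrow> y \<in> topspace X \<Longrightarrow> x \<noteq> y \<Longrightarrow> \<exists>r\<in>R. r x \<noteq> r y"
    and f: "real_continuous X f" and e: "\<epsilon> > 0"
  obtains r where "r \<in> R" "\<And>x. x \<in> topspace X \<Longrightarrow> \<bar>f x - r x\<bar> < \<epsilon>"
proof -
  define T where "T x = (\<lambda>r. if r \<in> R then r x else 0)" for x
  define S where "S = T ` topspace X"
  have Tc: "continuous_map X euclidean T"
    unfolding euclidean_product_topology[symmetric] continuous_map_componentwise_UNIV T_def
    using R by auto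
  have "compactin euclidean S"
    unfolding S_def using X Tc by (intro image_compactin[of X]) (auto simp: compact_space_def)
  then have S: "compact S" by simp
  have inj: "inj_on T (topspace X)"
  proof (rule inj_onI, rule ccontr)
    fix x y assume "x \<in> topspace X" "y \<in> topspace X" "T x = T y" "x \<noteq> y"
    then obtain r where "r \<in> R" "r x \<noteq> r y" using sep by blast
    then show False using fun_cong[OF \<open>T x = T y\<close>, of r] by (simp add: T_def)
  qed
  have "Hausdorff_space (euclidean :: (('a \<Rightarrow> real) \<Rightarrow> real) topology)"
    unfolding Hausdorff_space_def disjnt_def by (simp, meson hausdorff)
  then have "homeomorphic_map X (top_of_set S) T"
    using X Tc inj by (intro continuous_imp_homeomorphic_map)
      (auto simp: S_def continuous_map_in_subtopology Hausdorff_space_subtopology)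
  then obtain U where U: "homeomorphic_maps X (top_of_set S) T U"
    by (auto simp: homeomorphic_map_maps)
  have UT: "U (T x) = x" if "x \<in> topspace X" for x
    using U that by (simp add: homeomorphic_maps_def)
  have push: "continuous_on S (\<lambda>p. g (U p))" if "real_continuous X g" for g :: "'a \<Rightarrow> real"
  proof -
    have "continuous_map (top_of_set S) X U" using U by (simp add: homeomorphic_maps_def)
    then have "continuous_map (top_of_set S) euclideanreal (g \<circ> U)" using that by (rule continuous_map_compose)
    then show ?thesis by (simp add: o_def)
  qed
  define R' where "R' = {F. continuous_on S F \<and> (\<exists>r\<in>R. \<forall>x\<in>topspace X. F (T x) = r x)}"
  interpret R': function_ring_on R' S
  proof
    show "compact S" by (rule S)
    show "(\<lambda>p. F p + G p) \<in> R'" if FG: "F \<in> R'" "G \<in> R'" for F G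
    proof -
      obtain r s where "r \<in> R" "s \<in> R" "\<forall>x\<in>topspace X. F (T x) = r x" "\<forall>x\<in>topspace X. G (T x) = s x"
        using FG by (auto simp: R'_def)
      then show ?thesis using FG add[of r s] unfolding R'_def
        by (auto intro!: continuous_on_add bexI[of _ "\<lambda>x. r x + s x"])
    qed
    show "(\<lambda>p. F p * G p) \<in> R'" if FG: "F \<in> R'" "G \<in> R'" for F G
    proof -
      obtain r s where "r \<in> R" "s \<in> R" "\<forall>x\<in>topspace X. F (T x) = r x" "\<forall>x\<in>topspace X. G (T x) = s x"
        using FG by (auto simp: R'_def)
      then show ?thesis using FG mult[of r s] unfolding R'_def
        by (auto intro!: continuous_on_mult bexI[of _ "\<lambda>x. r x * s x"])
    qed
    show "(\<lambda>_. c) \<in> R'" for c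
      using const[of c] by (auto simp: R'_def)
    show "\<exists>F\<in>R'. F p \<noteq> F q" if pq: "p \<in> S" "q \<in> S" "p \<noteq> q" for p q
    proof -
      obtain x y where xy: "x \<in> topspace X" "y \<in> topspace X" "p = T x" "q = T y" using pq by (auto simp: S_def)
      then obtain r where r: "r \<in> R" "r x \<noteq> r y" using sep pq by blast
      have "(\<lambda>p. r (U p)) \<in> R'" using r R push UT by (auto simp: R'_def intro!: bexI[of _ r])
      then show ?thesis using r xy UT by (intro bexI[of _ "\<lambda>p. r (U p)"]) auto
    qed
  qed (simp add: R'_def)
  obtain F where F: "F \<in> R'" "\<And>p. p \<in> S \<Longrightarrow> \<bar>f (U p) - F p\<bar> < \<epsilon>"
    using R'.Stone_Weierstrass_basic[OF push[OF f] e] by blast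
  then obtain r where r: "r \<in> R" "\<And>x. x \<in> topspace X \<Longrightarrow> F (T x) = r x" by (auto simp: R'_def)
  show thesis
  proof (rule that[OF r(1)])
    fix x assume x: "x \<in> topspace X"
    then have "T x \<in> S" by (simp add: S_def)
    from F(2)[OF this] show "\<bar>f x - r x\<bar> < \<epsilon>" using UT[OF x] r(2)[OF x] by simp
  qed
qed

section \<open>Eberlein compact spaces\<close>

inductive_set linear_combinations :: "('a \<Rightarrow> real) set \<Rightarrow> ('a \<Rightarrow> real) set"
  for Z where
    zero: "(\<lambda>_. 0) \<in> linear_combinations Z"
  | step: "r \<in> linear_combinations Z \<Longrightarrow> z \<in> Z \<Longrightarrow> (\<lambda>x. r x + c * z x) \<in> linear_combinations Z"

lemma linear_combinations_add:
  assumes "r \<in> linear_combinations Z" "s \<in> linear_combinations Z"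
  shows "(\<lambda>x. r x + s x) \<in> linear_combinations Z"
  using assms(2)
proof induction
  case (step s z c)
  then show ?case
    using linear_combinations.step[OF step.IH step.hyps(2), of c] by (simp add: add.assoc)
qed (use assms in simp)

lemma linear_combinations_scale:
  assumes "r \<in> linear_combinations Z"
  shows "(\<lambda>x. c * r x) \<in> linear_combinations Z"
  using assms
proof induction
  case (step r z d)
  then show ?case
    using linear_combinations.step[OF step.IH step.hyps(2), of "c * d"] by (simp add: algebra_simps)
qed (simp add: linear_combinations.zero)

lemma linear_combinations_generator:
  assumes "z \<in> Z" shows "(\<lambda>x. c * z x) \<in> linear_combinations Z"
  using linear_combinations.step[OF linear_combinations.zero assms, of c] by simp

lemma linear_combinations_continuous:
  assumes "\<And>z. z \<in> Z \<Longrightarrow> real_continuous X z" "r \<in> linear_combinations Z"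
  shows "real_continuous X r"
  using assms(2)
  by induction (simp_all add: continuous_map_add continuous_map_real_mult_left assms(1))

lemma linear_combinations_product:
  assumes Z: "\<And>z z'. z \<in> Z \<Longrightarrow> z' \<in> Z \<Longrightarrow> \<exists>r\<in>linear_combinations Z. \<forall>x\<in>S. z x * z' x = r x"
    and rs: "r \<in> linear_combinations Z" "s \<in> linear_combinations Z"
  shows "\<exists>u\<in>linear_combinations Z. \<forall>x\<in>S. r x * s x = u x"
  using rs(1)
proof induction
  case zero
  then show ?case using linear_combinations.zero by force
next
  case (step r z c)
  have "\<exists>u\<in>linear_combinations Z. \<forall>x\<in>S. z x * s x = u x"
    using rs(2)
  proof induction
    case zero
    then show ?case using linear_combinations.zero by force
  next
    case (step s z' d)
    obtain u v where "u \<in> linear_combinations Z" "\<forall>x\<in>S. z x * s x = u x"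
        "v \<in> linear_combinations Z" "\<forall>x\<in>S. z x * z' x = v x"
      using step Z \<open>z \<in> Z\<close> by metis
    then show ?case
      using linear_combinations_add[of u Z "\<lambda>x. d * v x"] linear_combinations_scale[of v Z d]
      by (intro bexI[of _ "\<lambda>x. u x + d * v x"]) (auto simp: algebra_simps)
  qed
  then obtain u v where "u \<in> linear_combinations Z" "\<forall>x\<in>S. r x * s x = u x"
      "v \<in> linear_combinations Z" "\<forall>x\<in>S. z x * s x = v x"
    using step.IH by metis
  then show ?case
    using linear_combinations_add[of u Z "\<lambda>x. c * v x"] linear_combinations_scale[of v Z c]
    by (intro bexI[of _ "\<lambda>x. u x + c * v x"]) (auto simp: algebra_simps)
qed

text \<open>At \<open>t = 0\<close> the convention \<open>s / 0 = 0\<close> gives the value \<open>0\<close>, which is also the limit, because the modulus is at most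
  \<open>\<bar>t\<bar>\<close>.\<close>
lemma continuous_on_scaled_sin:
  "continuous_on UNIV (\<lambda>(t, s). t * sin (s / t) :: real)"
  unfolding continuous_on_def
proof (intro ballI)
  fix p :: "real \<times> real"
  obtain t s where p: "p = (t, s)" by (cases p)
  show "((\<lambda>(t, s). t * sin (s / t)) \<longlongrightarrow> (case p of (t, s) \<Rightarrow> t * sin (s / t))) (at p within UNIV)"
  proof (cases "t = 0")
    case True
    have "((\<lambda>q. fst q * sin (snd q / fst q)) \<longlongrightarrow> 0) (at p within UNIV)"
    proof (rule Lim_null_comparison)
      show "\<forall>\<^sub>F q in at p. norm (fst q * sin (snd q / fst q)) \<le> \<bar>fst q\<bar>"
        by (intro always_eventually allI) (simp add: abs_mult mult_left_le)
      have "((\<lambda>q. \<bar>fst q\<bar>) \<longlongrightarrow> \<bar>fst p\<bar>) (at p)" by (intro tendsto_intros)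
      then show "((\<lambda>q. \<bar>fst q\<bar>) \<longlongrightarrow> 0) (at p)" using True p by simp
    qed
    then show ?thesis using True p by (simp add: split_def)
  next
    case False
    have "((\<lambda>q. fst q * sin (snd q / fst q)) \<longlongrightarrow> fst p * sin (snd p / fst p)) (at p)"
      using False p by (intro tendsto_intros) auto
    then show ?thesis by (simp add: split_def)
  qed
qed

context banach_space_on
begin

lemma nrm_nonneg: "x \<in> V \<Longrightarrow> nrm x \<ge> 0"
proof -
  assume x: "x \<in> V"
  have "nrm zero = 0" using nrm_eq_0 zero_closed by blast
  moreover have "nrm (add x (scale (-1) x)) \<le> nrm x + nrm (scale (-1) x)"
    using x scale_closed by (intro nrm_triangle) auto
  ultimately show "nrm x \<ge> 0" using add_inverse[OF x] nrm_scale[OF x, of "-1"] by simp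
qed

lemma dual_add: "f \<in> dual \<Longrightarrow> g \<in> dual \<Longrightarrow> (\<lambda>v. f v + g v) \<in> dual"
proof -
  assume f: "f \<in> dual" and g: "g \<in> dual"
  obtain A B where "\<forall>x\<in>V. \<bar>f x\<bar> \<le> A * nrm x" "\<forall>x\<in>V. \<bar>g x\<bar> \<le> B * nrm x"
    using f g unfolding dual_def by blast
  then have "\<forall>x\<in>V. \<bar>f x + g x\<bar> \<le> (A + B) * nrm x"
    by (fastforce simp: distrib_right)
  then have "\<exists>C. \<forall>x\<in>V. \<bar>f x + g x\<bar> \<le> C * nrm x" ..
  then show "(\<lambda>v. f v + g v) \<in> dual"
    using f g unfolding dual_def by (simp add: distrib_left)
qed

lemma dual_scale: "f \<in> dual \<Longrightarrow> (\<lambda>v. c * f v) \<in> dual"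
proof -
  assume f: "f \<in> dual"
  obtain A where "\<forall>x\<in>V. \<bar>f x\<bar> \<le> A * nrm x"
    using f unfolding dual_def by blast
  then have "\<forall>x\<in>V. \<bar>c * f x\<bar> \<le> (\<bar>c\<bar> * A) * nrm x"
    by (auto simp: abs_mult mult.assoc intro: mult_left_mono)
  then have "\<exists>C. \<forall>x\<in>V. \<bar>c * f x\<bar> \<le> C * nrm x" ..
  then show "(\<lambda>v. c * f v) \<in> dual"
    using f unfolding dual_def by (simp add: distrib_left)
qed

lemma continuous_map_dual:
  assumes "f \<in> dual" shows "continuous_map weak_topology euclideanreal f"
  unfolding continuous_map_def
proof (intro conjI allI impI)
  fix U :: "real set" assume "openin euclidean U"
  then have "{x \<in> V. f x \<in> U} \<in> {{x \<in> V. f x \<in> U} | f U. f \<in> dual \<and> open U}"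
    using assms by auto
  then show "openin weak_topology {x \<in> topspace weak_topology. f x \<in> U}"
    unfolding topspace_weak_topology unfolding weak_topology_def by (rule topology_generated_by_Basis)
qed simp

text \<open>If no functional distinguishes two points, then no weakly open set does.\<close>
lemma dual_separates_Hausdorff:
  assumes H: "Hausdorff_space (subtopology weak_topology K)"
    and xy: "x \<in> K" "y \<in> K" "x \<in> V" "y \<in> V" "x \<noteq> y"
  shows "\<exists>f\<in>dual. f x \<noteq> f y"
proof (rule ccontr)
  assume neg: "\<not> ?thesis"
  have inv: "x \<in> U \<longleftrightarrow> y \<in> U" if "openin weak_topology U" for U
  proof -
    have "generate_topology_on {{x \<in> V. f x \<in> U} | f U. f \<in> dual \<and> open U} U"
      using that unfolding weak_topology_def by (rule openin_topology_generated_by)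
    then show ?thesis
    proof induction
      case (Basis S)
      then obtain f U where "S = {x \<in> V. f x \<in> U}" "f \<in> dual" unfolding mem_Collect_eq by (elim exE conjE)
      then show ?case using neg xy by auto
    qed auto
  qed
  obtain U where U: "openin (subtopology weak_topology K) U" "x \<in> U" "y \<notin> U"
    using H[unfolded Hausdorff_space_def, THEN spec[of _ x], THEN spec[of _ y]] xy by (auto simp: disjnt_iff)
  then show False using inv xy by (auto simp: openin_subtopology)
qed

text \<open>The value \<open>0\<close> outside \<open>V\<close> makes this a subset of a product of compact intervals.\<close>
definition dual_ball :: "('v \<Rightarrow> real) set" where
  "dual_ball = {f. (\<forall>v\<in>V. \<bar>f v\<bar> \<le> nrm v) \<and> (\<forall>v. v \<notin> V \<longrightarrow> f v = 0) \<and>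
     (\<forall>x\<in>V. \<forall>y\<in>V. f (add x y) = f x + f y) \<and> (\<forall>c. \<forall>x\<in>V. f (scale c x) = c * f x)}"

lemma dual_ball_subset_dual: "f \<in> dual_ball \<Longrightarrow> f \<in> dual"
  unfolding dual_ball_def dual_def by (auto intro!: exI[of _ 1])

text \<open>The Banach-Alaoglu theorem: linearity is a closed condition in a compact product of intervals.\<close>
theorem compact_dual_ball: "compact dual_ball"
proof -
  define box where "box = (\<Pi>\<^sub>E v\<in>UNIV. if v \<in> V then {- nrm v..nrm v} else {0})"
  have box: "compact box" unfolding box_def by (rule compact_box_fun) simp
  have coord: "continuous_on UNIV (\<lambda>f :: 'v \<Rightarrow> real. f v)" for v by simp
  have 1: "closed (\<Inter>x\<in>V. \<Inter>y\<in>V. {f :: 'v \<Rightarrow> real. f (add x y) = f x + f y})"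
    by (intro closed_INT ballI closed_Collect_eq continuous_on_add coord)
  have 2: "closed (\<Inter>c\<in>UNIV. \<Inter>x\<in>V. {f :: 'v \<Rightarrow> real. f (scale c x) = c * f x})"
    by (intro closed_INT ballI closed_Collect_eq continuous_on_mult coord continuous_on_const)
  have "f \<in> box \<longleftrightarrow> (\<forall>v\<in>V. \<bar>f v\<bar> \<le> nrm v) \<and> (\<forall>v. v \<notin> V \<longrightarrow> f v = 0)" for f
    unfolding box_def by (auto simp: PiE_iff abs_le_iff minus_le_iff split: if_splits)
  then have "dual_ball = box \<inter> ((\<Inter>x\<in>V. \<Inter>y\<in>V. {f. f (add x y) = f x + f y}) \<inter>
      (\<Inter>c\<in>UNIV. \<Inter>x\<in>V. {f. f (scale c x) = c * f x}))"
    unfolding dual_ball_def by auto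
  then show ?thesis using box 1 2 by (simp add: compact_Int_closed closed_Int)
qed

end

text \<open>With \<open>h\<close> the embedding into the Banach space, the functions \<open>sin \<circ> (g + \<sigma>) \<circ> h\<close>, where \<open>g\<close> is a bounded functional
  and \<open>\<sigma>\<close> is a real number, are bounded by \<open>1\<close> and separate points, and by the product formula for the sine
  their linear combinations form an algebra. So the Stone-Weierstrass theorem applies to them. Unbounded
  parameters \<open>(g, \<sigma>) = (f, \<tau>) / t\<close> become compact by damping with the factor \<open>t\<close>: the functions
  \<open>t * sin ((f + \<tau>) / t)\<close> with \<open>f\<close> in the dual ball, \<open>\<tau>\<close> in \<open>{-1..1}\<close> and \<open>t\<close> in \<open>{0..1}\<close> form the continuous image of a
  compact set, and they have the same linear span.\<close>
theorem Eberlein_compact_generating_set: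
  fixes X :: "'a topology"
  assumes "Eberlein_compact_in TYPE('v) X"
  obtains Z :: "('a \<Rightarrow> real) set" where "compact Z" "Z \<noteq> {}"
    "\<And>z. z \<in> Z \<Longrightarrow> real_continuous X z" "\<And>z x. z \<in> Z \<Longrightarrow> \<bar>z x\<bar> \<le> 1"
    "\<And>f \<epsilon>. real_continuous X f \<Longrightarrow> \<epsilon> > 0 \<Longrightarrow>
       \<exists>r\<in>linear_combinations Z. \<forall>x\<in>topspace X. \<bar>f x - r x\<bar> < \<epsilon>"
proof -
  obtain V :: "'v set" and add scale zero nrm K
    where X: "compact_space X" "Hausdorff_space X" and ban: "banach_space_on V add scale zero nrm"
      and hom: "X homeomorphic_space subtopology (banach_space_on.weak_topology V add scale nrm) K"
    using assms unfolding Eberlein_compact_in_def by blast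
  interpret banach_space_on V add scale zero nrm by (rule ban)
  obtain h where h: "homeomorphic_map X (subtopology weak_topology K) h"
    using hom unfolding homeomorphic_space by blast
  have hX: "h x \<in> K" "h x \<in> V" if "x \<in> topspace X" for x
    using homeomorphic_imp_surjective_map[OF h] that by auto
  have cont: "real_continuous X (\<lambda>x. f (h x))" if "f \<in> dual" for f
  proof -
    have "continuous_map X weak_topology h"
      using homeomorphic_imp_continuous_map[OF h] by (simp add: continuous_map_in_subtopology)
    from continuous_map_compose[OF this continuous_map_dual[OF that]] show ?thesis by (simp add: o_def)
  qed
  have HK: "Hausdorff_space (subtopology weak_topology K)"
    using hom X(2) homeomorphic_Hausdorff_space by blast
  have sepd: "\<exists>f\<in>dual. f (h x) \<noteq> f (h y)" if xy: "x \<in> topspace X" "y \<in> topspace X" "x \<noteq> y" for x y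
  proof (rule dual_separates_Hausdorff[OF HK])
    show "h x \<noteq> h y" using homeomorphic_imp_injective_map[OF h] xy by (auto dest: inj_onD)
  qed (use hX xy in auto)
  define zeta where "zeta = (\<lambda>(t :: real, f :: 'v \<Rightarrow> real, \<tau> :: real) (x :: 'a). t * sin ((f (h x) + \<tau>) / t))"
  define P where "P = {0..1::real} \<times> dual_ball \<times> {-1..1::real}"
  define Z where "Z = zeta ` P"
  have "compact P" unfolding P_def by (intro compact_Times compact_dual_ball compact_Icc)
  moreover have "continuous_on P zeta"
  proof (rule continuous_on_coordinatewise_then_product)
    fix x :: 'a
    have ev: "continuous_on UNIV (\<lambda>p :: real \<times> ('v \<Rightarrow> real) \<times> real. fst (snd p) (h x))"
      by (rule continuous_on_compose2[OF continuous_on_product_coordinates])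
        (intro continuous_on_fst continuous_on_snd continuous_on_id subset_UNIV)+
    have "continuous_on UNIV (\<lambda>p :: real \<times> ('v \<Rightarrow> real) \<times> real. (fst p, fst (snd p) (h x) + snd (snd p)))"
      by (intro continuous_on_Pair continuous_on_add ev continuous_intros)
    from continuous_on_compose2[OF continuous_on_scaled_sin this]
    have "continuous_on UNIV (\<lambda>p :: real \<times> ('v \<Rightarrow> real) \<times> real. zeta p x)"
      by (simp add: zeta_def split_def)
    then show "continuous_on P (\<lambda>p. zeta p x)" by (rule continuous_on_subset) simp
  qed
  ultimately have Zcomp: "compact Z" unfolding Z_def by (intro compact_continuous_image)
  have "(\<lambda>_. 0) \<in> dual_ball" using nrm_nonneg by (auto simp: dual_ball_def)
  then have "(0, (\<lambda>_. 0), 0) \<in> P" by (simp add: P_def)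
  then have Zne: "Z \<noteq> {}" by (auto simp: Z_def)
  have zetac: "real_continuous X (\<lambda>x. t * sin ((f (h x) + \<tau>) / t))" if "f \<in> dual" for t f \<tau>
  proof -
    have "real_continuous X (\<lambda>x. (1 / t) * (f (h x) + \<tau>))"
      using cont[OF that] by (intro continuous_map_real_mult_left continuous_map_add) auto
    moreover have "continuous_map euclideanreal euclideanreal (\<lambda>s. t * sin s)"
      by (auto intro!: continuous_intros)
    ultimately have "real_continuous X ((\<lambda>s. t * sin s) \<circ> (\<lambda>x. (1 / t) * (f (h x) + \<tau>)))"
      by (rule continuous_map_compose)
    then show ?thesis by (simp add: o_def)
  qed
  have Zcont: "real_continuous X z" if "z \<in> Z" for z
    using that zetac dual_ball_subset_dual by (auto simp: Z_def P_def zeta_def)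
  have Zbd: "\<bar>z x\<bar> \<le> 1" if "z \<in> Z" for z x
    using that by (auto simp: Z_def P_def zeta_def abs_mult intro!: mult_le_one)
  have trig: "\<exists>r\<in>linear_combinations Z. \<forall>x\<in>topspace X. sin (g (h x) + \<sigma>) = r x" if g: "g \<in> dual" for g \<sigma>
  proof -
    obtain A where A: "\<And>v. v \<in> V \<Longrightarrow> \<bar>g v\<bar> \<le> A * nrm v" using g unfolding dual_def by blast
    \<comment> \<open>Division by \<open>m\<close> brings \<open>g\<close> into the dual ball and \<open>\<sigma>\<close> into
      \<open>{-1..1}\<close>; the damping factor is \<open>t = 1 / m\<close>.\<close>
    define m where "m = max 1 (max \<bar>A\<bar> \<bar>\<sigma>\<bar>)"
    have m: "m \<ge> 1" "A \<le> m" "\<bar>\<sigma>\<bar> \<le> m" by (auto simp: m_def)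
    define f where "f v = (if v \<in> V then g v / m else 0)" for v
    have fle: "\<bar>f v\<bar> \<le> nrm v" if "v \<in> V" for v
    proof -
      have "\<bar>g v\<bar> \<le> m * nrm v" using A[OF that] mult_right_mono[OF m(2) nrm_nonneg[OF that]] by linarith
      then show ?thesis using m(1) that by (simp add: f_def abs_divide field_simps)
    qed
    have "f \<in> dual_ball"
      using g fle add_closed scale_closed unfolding dual_ball_def dual_def
      by (auto simp: f_def add_divide_distrib)
    moreover have "- 1 \<le> \<sigma> / m" "\<sigma> / m \<le> 1" using m by (auto simp: field_simps)
    ultimately have "(1 / m, f, \<sigma> / m) \<in> P" using m(1) by (simp add: P_def)
    then have z: "zeta (1 / m, f, \<sigma> / m) \<in> Z" by (simp add: Z_def)
    have "sin (g (h x) + \<sigma>) = m * zeta (1 / m, f, \<sigma> / m) x" if "x \<in> topspace X" for x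
      using m(1) hX[OF that] by (simp add: zeta_def f_def field_simps)
    then show ?thesis using linear_combinations_generator[OF z, of m] by (intro bexI[of _ "\<lambda>x. m * zeta (1 / m, f, \<sigma> / m) x"]) auto
  qed
  have Zprod: "\<exists>r\<in>linear_combinations Z. \<forall>x\<in>topspace X. z x * z' x = r x"
    if zz: "z \<in> Z" "z' \<in> Z" for z z'
  proof -
    obtain t f \<tau> t' f' \<tau>' where z: "z = zeta (t, f, \<tau>)" "z' = zeta (t', f', \<tau>')" "f \<in> dual_ball" "f' \<in> dual_ball"
    proof -
      obtain p p' where "p \<in> P" "z = zeta p" "p' \<in> P" "z' = zeta p'"
        using zz unfolding Z_def by blast
      then show thesis
        using that[of "fst p" "fst (snd p)" "snd (snd p)" "fst p'" "fst (snd p')" "snd (snd p')"]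
        by (auto simp: P_def)
    qed
    have ff: "f \<in> dual" "f' \<in> dual" using z dual_ball_subset_dual by auto
    define g1 where "g1 v = (1 / t) * f v + (-1 / t') * f' v" for v
    define g2 where "g2 v = (1 / t) * f v + (1 / t') * f' v" for v
    have "g1 \<in> dual" "g2 \<in> dual" unfolding g1_def g2_def by (intro dual_add dual_scale ff)+
    then obtain r1 r2 where r: "r1 \<in> linear_combinations Z" "r2 \<in> linear_combinations Z"
        "\<forall>x\<in>topspace X. sin (g1 (h x) + (\<tau> / t - \<tau>' / t' + pi / 2)) = r1 x"
        "\<forall>x\<in>topspace X. sin (g2 (h x) + (\<tau> / t + \<tau>' / t' + pi / 2)) = r2 x"
      using trig by metis
    have eq: "z x * z' x = (t * t' / 2) * r1 x + (- (t * t' / 2)) * r2 x" if x: "x \<in> topspace X" for x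
    proof -
      define a where "a = (f (h x) + \<tau>) / t"
      define b where "b = (f' (h x) + \<tau>') / t'"
      have "g1 (h x) + (\<tau> / t - \<tau>' / t' + pi / 2) = (a - b) + pi / 2"
        by (simp add: a_def b_def g1_def add_divide_distrib)
      then have "r1 x = sin ((a - b) + pi / 2)" using r(3)[rule_format, OF x] by (simp only:)
      then have r1: "r1 x = cos (a - b)" by (simp add: sin_add)
      have "g2 (h x) + (\<tau> / t + \<tau>' / t' + pi / 2) = (a + b) + pi / 2"
        by (simp add: a_def b_def g2_def add_divide_distrib)
      then have "r2 x = sin ((a + b) + pi / 2)" using r(4)[rule_format, OF x] by (simp only:)
      then have r2: "r2 x = cos (a + b)" by (simp add: sin_add)
      have "z x * z' x = t * t' * (sin a * sin b)"
        by (simp add: z zeta_def a_def b_def)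
      also have "\<dots> = t * t' * ((r1 x - r2 x) / 2)"
        by (simp only: sin_times_sin r1 r2)
      finally show ?thesis by (simp add: field_simps)
    qed
    define u where "u = (\<lambda>x. (t * t' / 2) * r1 x + (- (t * t' / 2)) * r2 x)"
    have "u \<in> linear_combinations Z"
      unfolding u_def by (intro linear_combinations_add linear_combinations_scale r)
    moreover have "\<forall>x\<in>topspace X. z x * z' x = u x"
      using eq by (simp add: u_def)
    ultimately show ?thesis by (intro bexI[of _ u])
  qed
  define R where "R = {r. real_continuous X r \<and> (\<exists>s\<in>linear_combinations Z. \<forall>x\<in>topspace X. r x = s x)}"
  have dense: "\<exists>r\<in>linear_combinations Z. \<forall>x\<in>topspace X. \<bar>f x - r x\<bar> < \<epsilon>"
    if f: "real_continuous X f" and e: "\<epsilon> > 0" for f \<epsilon>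
  proof -
    obtain r where "r \<in> R" "\<And>x. x \<in> topspace X \<Longrightarrow> \<bar>f x - r x\<bar> < \<epsilon>"
    proof (rule Stone_Weierstrass_compact_space[OF X(1), of R f \<epsilon>])
      show "real_continuous X r" if "r \<in> R" for r using that by (simp add: R_def)
      show "(\<lambda>x. r x + s x) \<in> R" if rs: "r \<in> R" "s \<in> R" for r s
      proof -
        obtain u v where "u \<in> linear_combinations Z" "v \<in> linear_combinations Z"
            "\<forall>x\<in>topspace X. r x = u x" "\<forall>x\<in>topspace X. s x = v x" using rs by (auto simp: R_def)
        then show ?thesis using rs linear_combinations_add[of u Z v]
          by (auto simp: R_def intro!: continuous_map_add bexI[of _ "\<lambda>x. u x + v x"])
      qed
      show "(\<lambda>x. r x * s x) \<in> R" if rs: "r \<in> R" "s \<in> R" for r s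
      proof -
        obtain u v where uv: "u \<in> linear_combinations Z" "v \<in> linear_combinations Z"
            "\<forall>x\<in>topspace X. r x = u x" "\<forall>x\<in>topspace X. s x = v x" using rs by (auto simp: R_def)
        obtain p where "p \<in> linear_combinations Z" "\<forall>x\<in>topspace X. u x * v x = p x"
          using linear_combinations_product[OF Zprod uv(1,2)] by blast
        then show ?thesis using rs uv
          by (auto simp: R_def intro!: continuous_map_real_mult bexI[of _ p])
      qed
      show "(\<lambda>_. c) \<in> R" for c
      proof -
        have "(\<lambda>_. 0) \<in> dual" by (auto simp: dual_def intro: exI[of _ 0])
        from trig[OF this, of "pi / 2"] obtain r where r: "r \<in> linear_combinations Z" "\<forall>x\<in>topspace X. 1 = r x" by auto
        show ?thesis using linear_combinations_scale[OF r(1), of c] r(2)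
          by (auto simp: R_def intro!: bexI[of _ "\<lambda>x. c * r x"])
      qed
      show "\<exists>r\<in>R. r x \<noteq> r y" if xy: "x \<in> topspace X" "y \<in> topspace X" "x \<noteq> y" for x y
      proof -
        obtain g where g: "g \<in> dual" "g (h x) \<noteq> g (h y)" using sepd[OF xy] by blast
        \<comment> \<open>Normalise to \<open>k x = pi / 2\<close> and \<open>k y = 0\<close>, where the
          sine takes different values.\<close>
        define c where "c = (pi / 2) / (g (h x) - g (h y))"
        define k where "k u = c * g (h u) + (- c * g (h y))" for u
        have "k u = c * (g (h u) - g (h y))" for u by (simp add: k_def right_diff_distrib)
        moreover have "c * (g (h x) - g (h y)) = pi / 2"
          using g(2) by (intro nonzero_eq_divide_eq[THEN iffD1]) (simp_all add: c_def)
        ultimately have kx: "k x = pi / 2" "k y = 0" by simp_all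
        have cg: "(\<lambda>v. c * g v) \<in> dual" by (rule dual_scale[OF g(1)])
        have "real_continuous X (\<lambda>u. sin (k u))"
          using zetac[OF cg, of 1 "- c * g (h y)"] by (simp add: k_def)
        then have R: "sin \<circ> k \<in> R"
          using trig[OF cg, of "- c * g (h y)"] by (simp add: R_def k_def o_def)
        have "(sin \<circ> k) x \<noteq> (sin \<circ> k) y" by (simp add: kx)
        then show ?thesis using R by (intro bexI[of _ "sin \<circ> k"])
      qed
    qed (rule f, rule e, rule that)
    moreover from this obtain s where "s \<in> linear_combinations Z" "\<forall>x\<in>topspace X. r x = s x"
      unfolding R_def by blast
    ultimately show ?thesis by (intro bexI[of _ s]) simp_all
  qed
  show thesis
    by (rule that[of Z]; (rule Zcomp Zne Zcont Zbd dense)?; assumption?)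
qed

context linear_domination
begin

lemma compact_image_family:
  assumes Z: "compact Z" "\<And>z. z \<in> Z \<Longrightarrow> real_continuous X z"
  shows "compact ((\<lambda>z y. if y \<in> topspace Y then \<mu> y z else 0) ` Z)"
proof (intro compact_continuous_image Z(1) continuous_on_coordinatewise_then_product)
  fix y
  show "continuous_on Z (\<lambda>z. if y \<in> topspace Y then \<mu> y z else 0)"
  proof (cases "y \<in> topspace Y")
    case True
    then obtain F C where F: "finite F" "F \<subseteq> topspace X" "0 \<le> C"
        "\<And>f. real_continuous X f \<Longrightarrow> \<bar>\<mu> y f\<bar> \<le> C * (\<Sum>x\<in>F. \<bar>f x\<bar>)"
      using finite_bound[OF True] by blast
    have "continuous_on Z (\<lambda>z. \<mu> y z)"
      unfolding continuous_on_def
    proof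
      fix z assume z: "z \<in> Z"
      have coord: "((\<lambda>u. u x) \<longlongrightarrow> z x) (at z within Z)" for x
        using continuous_on_subset[OF continuous_on_product_coordinates[of x], of Z] z
        unfolding continuous_on_def by blast
      have "((\<lambda>u. \<mu> y u - \<mu> y z) \<longlongrightarrow> 0) (at z within Z)"
      proof (rule Lim_null_comparison)
        have "norm (\<mu> y u - \<mu> y z) \<le> C * (\<Sum>x\<in>F. \<bar>u x - z x\<bar>)" if "u \<in> Z" for u
          using F(4)[of "\<lambda>x. u x - z x"] diff[OF True Z(2)[OF that] Z(2)[OF z]] Z(2) that z
          by (simp add: continuous_map_diff)
        then show "\<forall>\<^sub>F u in at z within Z. norm (\<mu> y u - \<mu> y z) \<le> C * (\<Sum>x\<in>F. \<bar>u x - z x\<bar>)"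
          by (simp add: eventually_at_filter)
        have "((\<lambda>u. C * (\<Sum>x\<in>F. \<bar>u x - z x\<bar>)) \<longlongrightarrow> C * (\<Sum>x\<in>F. \<bar>z x - z x\<bar>)) (at z within Z)"
          by (intro tendsto_intros coord)
        then show "((\<lambda>u. C * (\<Sum>x\<in>F. \<bar>u x - z x\<bar>)) \<longlongrightarrow> 0) (at z within Z)" by simp
      qed
      then show "((\<lambda>z. \<mu> y z) \<longlongrightarrow> \<mu> y z) (at z within Z)" by (rule LIM_zero_cancel)
    qed
    then show ?thesis using True by simp
  qed simp
qed

text \<open>The image \<open>W\<close> of the generating set \<open>Z\<close> is a pointwise compact family on \<open>Y\<close>. Let \<open>D\<close> be the topology that \<open>W\<close> generates.
  A continuous function on \<open>Y\<close> is \<open>y \<mapsto> \<mu> y \<psi>\<close>; approximating \<open>\<psi>\<close> uniformly by linear combinations of \<open>Z\<close>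
  approximates it uniformly by linear combinations of \<open>W\<close>, as the \<open>\<mu> y\<close> are uniformly bounded. So it
  is continuous for \<open>D\<close>, and by complete regularity \<open>D\<close> is as fine as the topology of \<open>Y\<close>. Evaluation thus embeds
  \<open>Y\<close> into the functions on \<open>W\<close>, with bounded image that is closed by \<open>adherent_attained\<close>.\<close>
theorem Eberlein_compact_target:
  assumes "Eberlein_compact_in TYPE('v) X"
  shows "compact_space Y \<and> Eberlein_compact_in TYPE(('b \<Rightarrow> real) \<Rightarrow> real) Y"
proof -
  have cX: "compact_space X" using assms by (simp add: Eberlein_compact_in_def)
  have creg: "completely_regular_space Y" and haus: "Hausdorff_space Y"
    using Tychonoff_Y by (auto simp: Tychonoff_space_def)
  obtain Z where Z: "compact Z" "Z \<noteq> {}"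
    "\<And>z. z \<in> Z \<Longrightarrow> real_continuous X z" "\<And>z x. z \<in> Z \<Longrightarrow> \<bar>z x\<bar> \<le> 1"
    "\<And>f \<epsilon>. real_continuous X f \<Longrightarrow> \<epsilon> > 0 \<Longrightarrow>
       \<exists>r\<in>linear_combinations Z. \<forall>x\<in>topspace X. \<bar>f x - r x\<bar> < \<epsilon>"
    by (rule Eberlein_compact_generating_set[OF assms]) (rule that)
  obtain M where M: "\<forall>y\<in>topspace Y. \<forall>f B. real_continuous X f \<longrightarrow>
    (\<forall>x\<in>topspace X. \<bar>f x\<bar> \<le> B) \<longrightarrow> B > 0 \<longrightarrow> \<bar>\<mu> y f\<bar> \<le> M * B"
    using uniformly_bounded[OF cX] ..
  define \<omega> where "\<omega> z y = (if y \<in> topspace Y then \<mu> y z else 0)" for z y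
  define W where "W = \<omega> ` Z"
  have Wc: "compact W" unfolding W_def \<omega>_def by (rule compact_image_family[OF Z(1,3)])
  have Wcont: "real_continuous Y w" if w: "w \<in> W" for w
  proof -
    obtain z where "z \<in> Z" "w = \<omega> z" using w by (auto simp: W_def)
    then show ?thesis
      using continuous_map_eq[OF continuous_image[OF Z(3)], of z w] by (simp add: \<omega>_def)
  qed
  have Wbd: "\<bar>w y\<bar> \<le> M" if "w \<in> W" "y \<in> topspace Y" for w y
    using that M[rule_format, of y _ 1] Z(3,4) by (auto simp: W_def \<omega>_def)
  interpret W: pointwise_compact_family Y W M
    by standard (use feebly_compact_target[OF cX] Wc Wcont Wbd in auto)
  define D where "D = pullback_topology (topspace Y) W.ev euclidean"
  have topD: "topspace D = topspace Y" by (simp add: D_def topspace_pullback_topology)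
  have Devc: "real_continuous D (\<lambda>y. w y)" if w: "w \<in> W" for w
  proof -
    have "continuous_map (euclidean :: (('b \<Rightarrow> real) \<Rightarrow> real) topology) euclideanreal (\<lambda>p. p w)"
      by simp
    then have "real_continuous D ((\<lambda>p. p w) \<circ> W.ev)"
      unfolding D_def by (rule continuous_map_pullback)
    then show ?thesis using w by (simp add: o_def W.ev_def)
  qed
  have Dlin: "real_continuous D (\<lambda>y. \<mu> y r)" if "r \<in> linear_combinations Z" for r
    using that
  proof induction
    case zero
    have "\<mu> y (\<lambda>_. 0) = 0" if "y \<in> topspace Y" for y
      using scale[OF that, of "\<lambda>_. 0" 0] by simp
    then have "\<And>y. y \<in> topspace D \<Longrightarrow> 0 = \<mu> y (\<lambda>_. 0)" by (simp add: topD)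
    moreover have "real_continuous D (\<lambda>_. 0)" by simp
    ultimately show ?case using continuous_map_eq by (metis (no_types, lifting))
  next
    case (step r z c)
    have rc: "real_continuous X r"
      by (rule linear_combinations_continuous[OF Z(3) step.hyps(1)])
    have "\<omega> z \<in> W" using step by (simp add: W_def)
    then have "real_continuous D (\<lambda>y. \<mu> y r + c * \<omega> z y)"
      by (intro continuous_map_add continuous_map_real_mult_left Devc step.IH)
    moreover have "\<mu> y r + c * \<omega> z y = \<mu> y (\<lambda>x. r x + c * z x)" if "y \<in> topspace Y" for y
      using that add[OF that rc continuous_map_real_mult_left[OF Z(3)[OF step.hyps(2)]]]
      by (simp add: \<omega>_def scale[OF that Z(3)[OF step.hyps(2)]])
    ultimately show ?case by (rule continuous_map_eq) (simp add: topD)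
  qed
  have Dall: "real_continuous D g" if g: "real_continuous Y g" for g
  proof (rule continuous_map_real_epsI)
    fix y and \<epsilon> :: real assume "y \<in> topspace D" "\<epsilon> > 0"
    then have y: "y \<in> topspace Y" by (simp add: topD)
    obtain \<psi> where psi: "real_continuous X \<psi>" "\<forall>y\<in>topspace Y. \<mu> y \<psi> = g y"
      using surjective[OF g] by blast
    define \<delta> where "\<delta> = \<epsilon> / (4 * (\<bar>M\<bar> + 1))"
    have d: "\<delta> > 0" using \<open>\<epsilon> > 0\<close> by (simp add: \<delta>_def)
    obtain r where r: "r \<in> linear_combinations Z" "\<forall>x\<in>topspace X. \<bar>\<psi> x - r x\<bar> < \<delta>"
      using Z(5)[OF psi(1) d] by blast
    have rc: "real_continuous X r" by (rule linear_combinations_continuous[OF Z(3) r(1)])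
    have close: "\<bar>g u - \<mu> u r\<bar> \<le> \<epsilon> / 4" if u: "u \<in> topspace Y" for u
    proof -
      have "\<bar>\<mu> u (\<lambda>x. \<psi> x - r x)\<bar> \<le> M * \<delta>"
        using r(2) d by (intro M[rule_format] u continuous_map_diff psi(1) rc) (auto intro: less_imp_le)
      also have "\<dots> \<le> (\<bar>M\<bar> + 1) * \<delta>" using d by (intro mult_right_mono) auto
      also have "\<dots> = \<epsilon> / 4" by (simp add: \<delta>_def field_simps add_eq_0_iff)
      finally show ?thesis using diff[OF u psi(1) rc] psi(2) u by simp
    qed
    define U where "U = {u \<in> topspace D. \<mu> u r \<in> ball (\<mu> y r) (\<epsilon> / 4)}"
    have "openin D U"
      unfolding U_def by (intro openin_real_preimage Dlin r open_ball)
    moreover have "y \<in> U" using y \<open>\<epsilon> > 0\<close> by (simp add: U_def topD)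
    moreover have "\<bar>g u - g y\<bar> < \<epsilon>" if u: "u \<in> U" for u
    proof -
      have uY: "u \<in> topspace Y" using u by (simp add: U_def topD)
      have "\<bar>\<mu> u r - \<mu> y r\<bar> < \<epsilon> / 4" using u by (simp add: U_def dist_real_def abs_minus_commute)
      moreover have "\<bar>g u - g y\<bar> \<le> \<bar>g u - \<mu> u r\<bar> + \<bar>\<mu> u r - \<mu> y r\<bar> + \<bar>g y - \<mu> y r\<bar>" by linarith
      ultimately show ?thesis using close[OF uY] close[OF y] \<open>\<epsilon> > 0\<close> by linarith
    qed
    ultimately show "\<exists>U. openin D U \<and> y \<in> U \<and> (\<forall>z\<in>U. \<bar>g z - g y\<bar> < \<epsilon>)" by blast
  qed
  have openD: "openin D U" if U: "openin Y U" for U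
  proof (subst openin_subopen, intro ballI)
    fix y assume y: "y \<in> U"
    then obtain g where g: "real_continuous Y g" "g y = 0" "g ` (topspace Y - U) \<subseteq> {1}"
      using creg U unfolding completely_regular_space_alt' by blast
    have "openin D {u \<in> topspace D. g u \<in> {..<1}}"
      by (intro openin_real_preimage Dall g open_lessThan)
    moreover have "y \<in> {u \<in> topspace D. g u \<in> {..<1}}" using y g(2) openin_subset[OF U] by (auto simp: topD)
    moreover have "{u \<in> topspace D. g u \<in> {..<1}} \<subseteq> U" using g(3) by (force simp: topD)
    ultimately show "\<exists>T. openin D T \<and> y \<in> T \<and> T \<subseteq> U" by blast
  qed
  have sep: "\<exists>w\<in>W. w y \<noteq> w z" if yz: "y \<in> topspace Y" "z \<in> topspace Y" "y \<noteq> z" for y z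
  proof (rule ccontr)
    assume "\<not> ?thesis"
    then have ev: "W.ev y = W.ev z" by (auto simp: W.ev_def)
    obtain U where U: "openin Y U" "y \<in> U" "z \<notin> U"
      using haus[unfolded Hausdorff_space_def, THEN spec[of _ y], THEN spec[of _ z]] yz by (auto simp: disjnt_iff)
    obtain T where "U = W.ev -` T \<inter> topspace Y"
      using openD[OF U(1)] unfolding D_def openin_pullback_topology by blast
    then show False using U yz ev by auto
  qed
  define E where "E = W.ev ` topspace Y"
  have "closed E"
    unfolding closed_def
  proof (subst open_subopen, intro ballI)
    fix p assume p: "p \<in> - E"
    show "\<exists>T. open T \<and> p \<in> T \<and> T \<subseteq> - E"
    proof (rule ccontr)
      assume neg: "\<not> ?thesis"
      have approx: "\<exists>y\<in>topspace Y. \<forall>w\<in>F. \<bar>W.ev y w - p w\<bar> < \<delta>" if F: "finite F" "\<delta> > 0" for F \<delta>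
      proof -
        have "open {q. \<forall>w\<in>F. \<bar>q w - p w\<bar> < \<delta>}" "p \<in> {q. \<forall>w\<in>F. \<bar>q w - p w\<bar> < \<delta>}"
          using open_fun_coordinate_nbhd[OF F(1)] F(2) by auto
        then have "\<not> {q. \<forall>w\<in>F. \<bar>q w - p w\<bar> < \<delta>} \<subseteq> - E" using neg by blast
        then show ?thesis by (auto simp: E_def)
      qed
      have "W.adherent (topspace Y) p"
        unfolding W.adherent_def
      proof (intro allI impI, elim conjE)
        fix F and \<delta> :: real assume F: "finite F" "F \<subseteq> W" "\<delta> > 0"
        then obtain y where y: "y \<in> topspace Y" "\<forall>w\<in>F. \<bar>W.ev y w - p w\<bar> < \<delta>" using approx by blast
        then show "\<exists>y\<in>topspace Y. \<forall>w\<in>F. \<bar>w y - p w\<bar> < \<delta>"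
          using F(2) by (intro bexI[of _ y]) (auto simp: W.ev_def subset_iff)
      qed
      then obtain y where y: "y \<in> topspace Y" "\<And>w. w \<in> W \<Longrightarrow> w y = p w"
        by (rule W.adherent_attained) (rule that)
      have "p w = 0" if "w \<notin> W" for w
      proof (rule ccontr)
        assume "p w \<noteq> 0"
        then obtain y where "\<bar>W.ev y w - p w\<bar> < \<bar>p w\<bar>" using approx[of "{w}" "\<bar>p w\<bar>"] by auto
        then show False using that by (simp add: W.ev_def)
      qed
      then have "p = W.ev y" using y by (auto simp: W.ev_def)
      then show False using p y(1) by (simp add: E_def)
    qed
  qed
  moreover have "compact (\<Pi>\<^sub>E w\<in>UNIV. {-\<bar>M\<bar>..\<bar>M\<bar>} :: (('b \<Rightarrow> real) \<Rightarrow> real) set)"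
    by (intro compact_box_fun compact_Icc)
  moreover have "E \<subseteq> (\<Pi>\<^sub>E w\<in>UNIV. {-\<bar>M\<bar>..\<bar>M\<bar>})"
  proof -
    have "\<bar>W.ev y w\<bar> \<le> \<bar>M\<bar>" if "y \<in> topspace Y" for y w
      using Wbd[of w y] that by (auto simp: W.ev_def)
    then show ?thesis by (auto simp: E_def PiE_iff abs_le_iff minus_le_iff)
  qed
  ultimately have "compact E" by (metis compact_Int_closed inf.absorb_iff2)
  have "homeomorphic_map Y (top_of_set E) W.ev"
  proof (rule bijective_open_imp_homeomorphic_map)
    have "continuous_map Y euclidean W.ev"
      unfolding euclidean_product_topology[symmetric] continuous_map_componentwise_UNIV W.ev_def
      using Wcont by auto
    then show "continuous_map Y (top_of_set E) W.ev" by (simp add: continuous_map_in_subtopology E_def)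
    show "open_map Y (top_of_set E) W.ev"
      unfolding open_map_def
    proof (intro allI impI)
      fix U assume U: "openin Y U"
      obtain T where T: "open T" "U = W.ev -` T \<inter> topspace Y"
        using openD[OF U] unfolding D_def openin_pullback_topology by auto
      then have "W.ev ` U = E \<inter> T" by (auto simp: E_def)
      then show "openin (top_of_set E) (W.ev ` U)" using T(1) by (simp add: openin_open_Int)
    qed
    show "inj_on W.ev (topspace Y)" by (rule W.inj_on_ev[OF sep])
  qed (simp add: E_def)
  then have "Y homeomorphic_space top_of_set E" by (rule homeomorphic_map_imp_homeomorphic_space)
  moreover have "compact_space (top_of_set E)"
    using \<open>compact E\<close> by (simp add: compact_space_subtopology)
  ultimately have "compact_space Y" using homeomorphic_compact_space by blast
  moreover have "W \<noteq> {}" using Z(2) by (simp add: W_def)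
  ultimately show ?thesis using W.Eberlein_compact_if_separating[OF _ haus] sep by blast
qed

end

section \<open>Scattered spaces\<close>

text \<open>More vectors than coordinates are linearly dependent; eliminating one coordinate with a pivot \<open>p\<close> reduces
  the number of both by one.\<close>
lemma nontrivial_linear_relation:
  fixes a :: "'q \<Rightarrow> 's \<Rightarrow> real"
  assumes "finite S" "finite Q" "card S < card Q"
  shows "\<exists>c. (\<exists>q\<in>Q. c q \<noteq> 0) \<and> (\<forall>x\<in>S. (\<Sum>q\<in>Q. c q * a q x) = 0)"
  using assms
proof (induction S arbitrary: Q a)
  case empty
  then have "Q \<noteq> {}" by auto
  then show ?case by (intro exI[of _ "\<lambda>_. 1"]) auto
next
  case (insert x S)
  show ?case
  proof (cases "\<forall>q\<in>Q. a q x = 0")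
    case True
    have "card S < card Q" using insert by simp
    then obtain c where "\<exists>q\<in>Q. c q \<noteq> 0" "\<forall>x\<in>S. (\<Sum>q\<in>Q. c q * a q x) = 0"
      using insert.IH[of Q a] insert.prems by auto
    then show ?thesis using True by (intro exI[of _ c]) auto
  next
    case False
    then obtain p where p: "p \<in> Q" "a p x \<noteq> 0" by blast
    define Q' where "Q' = Q - {p}"
    have Q': "finite Q'" "Q = insert p Q'" "p \<notin> Q'" "card S < card Q'"
      using insert p by (auto simp: Q'_def)
    obtain c' where c': "\<exists>q\<in>Q'. c' q \<noteq> 0"
        "\<forall>z\<in>S. (\<Sum>q\<in>Q'. c' q * (a q z - a q x / a p x * a p z)) = 0"
      using insert.IH[of Q' "\<lambda>q z. a q z - a q x / a p x * a p z"] Q' by auto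
    define c where "c = c'(p := - (\<Sum>q\<in>Q'. c' q * (a q x / a p x)))"
    have cc: "c q = c' q" if "q \<in> Q'" for q using that Q'(3) by (auto simp: c_def)
    have expand: "(\<Sum>q\<in>Q. c q * a q z) = (\<Sum>q\<in>Q'. c' q * (a q z - a q x / a p x * a p z))" for z
    proof -
      have "(\<Sum>q\<in>Q. c q * a q z) = c p * a p z + (\<Sum>q\<in>Q'. c' q * a q z)"
        using Q' cc by simp
      also have "c p * a p z = - (\<Sum>q\<in>Q'. c' q * (a q x / a p x * a p z))"
        by (simp add: c_def sum_distrib_right mult.assoc)
      finally show ?thesis by (simp add: right_diff_distrib sum_subtractf)
    qed
    have "\<exists>q\<in>Q. c q \<noteq> 0" using c'(1) cc Q'(2) by auto
    moreover have "(\<Sum>q\<in>Q. c q * a q z) = 0" if "z \<in> insert x S" for z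
      using that c'(2) p(2) by (auto simp: expand)
    ultimately show ?thesis by blast
  qed
qed

lemma Hausdorff_finite_disjoint_nbhds:
  assumes X: "Hausdorff_space X" and F: "finite F" "F \<subseteq> topspace X"
  obtains N where "\<And>x. x \<in> F \<Longrightarrow> openin X (N x)" "\<And>x. x \<in> F \<Longrightarrow> x \<in> N x"
    "\<And>x y. x \<in> F \<Longrightarrow> y \<in> F \<Longrightarrow> x \<noteq> y \<Longrightarrow> N x \<inter> N y = {}"
proof -
  have "\<exists>U V. openin X U \<and> openin X V \<and> x \<in> U \<and> y \<in> V \<and> disjnt U V"
    if "x \<in> F" "y \<in> F" "x \<noteq> y" for x y
    using X[unfolded Hausdorff_space_def, THEN spec[of _ x], THEN spec[of _ y]] that F(2) by auto
  then obtain U V where UV: "\<And>x y. x \<in> F \<Longrightarrow> y \<in> F \<Longrightarrow> x \<noteq> y \<Longrightarrow>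
      openin X (U x y) \<and> openin X (V x y) \<and> x \<in> U x y \<and> y \<in> V x y \<and> disjnt (U x y) (V x y)"
    by metis
  define N where "N x = topspace X \<inter> \<Inter>((\<lambda>y. U x y \<inter> V y x) ` (F - {x}))" for x
  show thesis
  proof (rule that[of N])
    show "openin X (N x)" if x: "x \<in> F" for x
    proof (cases "F - {x} = {}")
      case False
      have "openin X (\<Inter>((\<lambda>y. U x y \<inter> V y x) ` (F - {x})))"
        using False F UV x by (intro openin_INT2) auto
      then show ?thesis unfolding N_def by (intro openin_Int) auto
    qed (simp only: N_def, simp)
    show "x \<in> N x" if "x \<in> F" for x
      using UV that F(2) by (auto simp: N_def)
    show "N x \<inter> N y = {}" if xy: "x \<in> F" "y \<in> F" "x \<noteq> y" for x y
    proof -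
      have "N x \<subseteq> U x y" "N y \<subseteq> V x y" using xy by (auto simp: N_def)
      then show ?thesis using UV[OF xy] by (auto simp: disjnt_def)
    qed
  qed
qed

lemma Tychonoff_separating_function:
  assumes X: "Tychonoff_space X" and G: "openin X G" "x \<in> G" and F: "finite F" "F \<subseteq> topspace X" "x \<notin> F"
  shows "\<exists>f. real_continuous X f \<and> f x = 1 \<and> (\<forall>z\<in>topspace X. z \<notin> G \<or> z \<in> F \<longrightarrow> f z = 0)"
proof -
  have "closedin X F" using X F by (intro closedin_Hausdorff_finite) (auto simp: Tychonoff_space_def)
  then have "openin X (G - F)" using G by (intro openin_diff)
  moreover have "x \<in> G - F" using G F by auto
  ultimately show ?thesis
    using completely_regular_bump[of X "G - F" x] X by (auto simp: Tychonoff_space_def)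
qed

context linear_domination
begin

text \<open>A functional bounded by finitely many evaluations vanishes as soon as these do, so it is determined by its
  values on functions \<open>g x\<close> dual to the evaluations. Discarding zero coefficients makes the finite set
  the support.\<close>
lemma finite_representation:
  assumes y: "y \<in> topspace Y"
  shows "\<exists>F a. finite F \<and> F \<subseteq> topspace X \<and> (\<forall>x\<in>F. a x \<noteq> 0) \<and>
    (\<forall>f. real_continuous X f \<longrightarrow> \<mu> y f = (\<Sum>x\<in>F. a x * f x))"
proof -
  obtain G C where G: "finite G" "G \<subseteq> topspace X"
      "\<And>f. real_continuous X f \<Longrightarrow> \<bar>\<mu> y f\<bar> \<le> C * (\<Sum>x\<in>G. \<bar>f x\<bar>)"
    using finite_bound[OF y] by blast
  have "\<exists>g. real_continuous X g \<and> g x = 1 \<and> (\<forall>z\<in>G. z \<noteq> x \<longrightarrow> g z = 0)" if x: "x \<in> G" for x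
  proof -
    have "x \<in> topspace X" using x G by blast
    then obtain f where f: "real_continuous X f" "f x = 1"
        "\<forall>z\<in>topspace X. z \<notin> topspace X \<or> z \<in> G - {x} \<longrightarrow> f z = 0"
      using Tychonoff_separating_function[OF Tychonoff_X openin_topspace, of x "G - {x}"] G by auto
    then show ?thesis using G(2) by (intro exI[of _ f]) auto
  qed
  then obtain g where g: "\<And>x. x \<in> G \<Longrightarrow> real_continuous X (g x)" "\<And>x. x \<in> G \<Longrightarrow> g x x = 1"
      "\<And>x z. x \<in> G \<Longrightarrow> z \<in> G \<Longrightarrow> z \<noteq> x \<Longrightarrow> g x z = 0" by metis
  define a where "a x = \<mu> y (g x)" for x
  have sum: "real_continuous X (\<lambda>z. \<Sum>x\<in>H. f x * g x z) \<and>
      \<mu> y (\<lambda>z. \<Sum>x\<in>H. f x * g x z) = (\<Sum>x\<in>H. f x * a x)" if "H \<subseteq> G" for H and f :: "'a \<Rightarrow> real"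
    using finite_subset[OF that G(1)] that
  proof (induction H)
    case empty
    then show ?case using scale[OF y, of "\<lambda>_. 0" 0] by simp
  next
    case (insert x H)
    then have c: "real_continuous X (\<lambda>z. f x * g x z)"
      using g(1) by (intro continuous_map_real_mult_left) auto
    have IH: "real_continuous X (\<lambda>z. \<Sum>x\<in>H. f x * g x z)"
        "\<mu> y (\<lambda>z. \<Sum>x\<in>H. f x * g x z) = (\<Sum>x\<in>H. f x * a x)" using insert by auto
    have "\<mu> y (\<lambda>z. f x * g x z) = f x * a x" using scale[OF y g(1)] insert by (simp add: a_def)
    then show ?case using insert(1,2) add[OF y c IH(1)] IH continuous_map_add[OF c IH(1)] by simp
  qed
  have rep: "\<mu> y f = (\<Sum>x\<in>G. a x * f x)" if f: "real_continuous X f" for f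
  proof -
    define s where "s z = (\<Sum>x\<in>G. f x * g x z)" for z
    have s: "real_continuous X s" "\<mu> y s = (\<Sum>x\<in>G. f x * a x)"
      using sum[of G f] by (simp_all add: s_def[abs_def])
    have "s z = f z" if z: "z \<in> G" for z
    proof -
      have "s z = (\<Sum>x\<in>G. if x = z then f z else 0)"
        unfolding s_def using g(2,3) z by (intro sum.cong) auto
      then show ?thesis using z G(1) by simp
    qed
    then have "\<bar>\<mu> y (\<lambda>z. f z - s z)\<bar> \<le> C * (\<Sum>x\<in>G. 0)"
      using G(3)[OF continuous_map_diff[OF f s(1)]] by simp
    then have "\<mu> y f = \<mu> y s" using diff[OF y f s(1)] by simp
    then show ?thesis using s(2) by (simp add: mult.commute)
  qed
  have "(\<Sum>x\<in>G. a x * f x) = (\<Sum>x\<in>{x\<in>G. a x \<noteq> 0}. a x * f x)" for f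
    using G(1) by (intro sum.mono_neutral_right) auto
  then show ?thesis using G(1,2) rep by (intro exI[of _ "{x\<in>G. a x \<noteq> 0}"] exI[of _ a]) auto
qed

definition support :: "'b \<Rightarrow> 'a set" where
  "support y = (SOME F. \<exists>a. finite F \<and> F \<subseteq> topspace X \<and> (\<forall>x\<in>F. a x \<noteq> 0) \<and>
    (\<forall>f. real_continuous X f \<longrightarrow> \<mu> y f = (\<Sum>x\<in>F. a x * f x)))"

lemma support:
  assumes y: "y \<in> topspace Y"
  shows "\<exists>a. finite (support y) \<and> support y \<subseteq> topspace X \<and> (\<forall>x\<in>support y. a x \<noteq> 0) \<and>
    (\<forall>f. real_continuous X f \<longrightarrow> \<mu> y f = (\<Sum>x\<in>support y. a x * f x))"
  unfolding support_def by (rule someI_ex[OF finite_representation[OF y]])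

lemma finite_support: "y \<in> topspace Y \<Longrightarrow> finite (support y)"
  and support_subset: "y \<in> topspace Y \<Longrightarrow> support y \<subseteq> topspace X"
  using support by blast+

text \<open>A function concentrated on \<open>G\<close> and singling out one point of the support there is not annihilated by
  \<open>\<mu> y\<close>, hence neither by \<open>\<mu> z\<close> for nearby \<open>z\<close>.\<close>
proposition support_lower_semicontinuous:
  assumes y: "y \<in> topspace Y" and G: "openin X G" and ne: "support y \<inter> G \<noteq> {}"
  obtains V where "openin Y V" "y \<in> V" "\<And>z. z \<in> V \<Longrightarrow> support z \<inter> G \<noteq> {}"
proof -
  obtain a where a: "finite (support y)" "support y \<subseteq> topspace X" "\<forall>x\<in>support y. a x \<noteq> 0"
    "\<forall>f. real_continuous X f \<longrightarrow> \<mu> y f = (\<Sum>x\<in>support y. a x * f x)"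
    using support[OF y] by blast
  obtain x where x: "x \<in> support y" "x \<in> G" using ne by blast
  obtain f where f: "real_continuous X f" "f x = 1"
      "\<forall>z\<in>topspace X. z \<notin> G \<or> z \<in> support y - {x} \<longrightarrow> f z = 0"
    using Tychonoff_separating_function[OF Tychonoff_X G x(2), of "support y - {x}"] a(1,2) by auto
  have "\<mu> y f = (\<Sum>z\<in>support y. if z = x then a x else 0)"
    unfolding a(4)[rule_format, OF f(1)] using f a(2) by (intro sum.cong) auto
  then have "\<mu> y f \<noteq> 0" using a x by simp
  define V where "V = {z \<in> topspace Y. \<mu> z f \<in> - {0}}"
  have "openin Y V"
    unfolding V_def by (intro openin_real_preimage continuous_image f open_Compl closed_singleton)
  moreover have "y \<in> V" using y \<open>\<mu> y f \<noteq> 0\<close> by (simp add: V_def)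
  moreover have "support z \<inter> G \<noteq> {}" if z: "z \<in> V" for z
  proof
    assume e: "support z \<inter> G = {}"
    have zY: "z \<in> topspace Y" using z by (simp add: V_def)
    obtain b where b: "support z \<subseteq> topspace X" "\<mu> z f = (\<Sum>x\<in>support z. b x * f x)"
      using support[OF zY] f(1) by blast
    have "(\<Sum>x\<in>support z. b x * f x) = 0" using f(3) b(1) e by (intro sum.neutral) auto
    then show False using z b by (simp add: V_def)
  qed
  ultimately show thesis by (rule that)
qed

lemma support_meets_disjoint_nbhds:
  assumes y: "y \<in> topspace Y" and N: "\<And>x. x \<in> support y \<Longrightarrow> openin X (N x)" "\<And>x. x \<in> support y \<Longrightarrow> x \<in> N x"
  obtains V where "openin Y V" "y \<in> V" "\<And>z x. z \<in> V \<Longrightarrow> x \<in> support y \<Longrightarrow> support z \<inter> N x \<noteq> {}"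
proof -
  have "\<exists>V. openin Y V \<and> y \<in> V \<and> (\<forall>z\<in>V. support z \<inter> N x \<noteq> {})" if x: "x \<in> support y" for x
  proof -
    have "support y \<inter> N x \<noteq> {}" using N(2) x by auto
    then show ?thesis using support_lower_semicontinuous[OF y N(1)[OF x]] by metis
  qed
  then obtain V where V: "\<And>x. x \<in> support y \<Longrightarrow> openin Y (V x) \<and> y \<in> V x \<and> (\<forall>z\<in>V x. support z \<inter> N x \<noteq> {})" by metis
  show thesis
  proof (rule that[of "topspace Y \<inter> \<Inter>(V ` support y)"])
    show "openin Y (topspace Y \<inter> \<Inter>(V ` support y))"
    proof (cases "support y = {}")
      case False
      then have "openin Y (\<Inter>(V ` support y))"
        using V finite_support[OF y] by (intro openin_INT2) auto
      then show ?thesis by (intro openin_Int) auto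
    qed (simp only:, simp)
  qed (use V y in auto)
qed

lemma card_support_lower_semicontinuous:
  assumes y: "y \<in> topspace Y"
  obtains V where "openin Y V" "y \<in> V" "\<And>z. z \<in> V \<Longrightarrow> card (support y) \<le> card (support z)"
proof -
  have "Hausdorff_space X" using Tychonoff_X by (simp add: Tychonoff_space_def)
  from Hausdorff_finite_disjoint_nbhds[OF this finite_support[OF y] support_subset[OF y]]
  obtain N where N: "\<And>x. x \<in> support y \<Longrightarrow> openin X (N x)" "\<And>x. x \<in> support y \<Longrightarrow> x \<in> N x"
    "\<And>x z. x \<in> support y \<Longrightarrow> z \<in> support y \<Longrightarrow> x \<noteq> z \<Longrightarrow> N x \<inter> N z = {}" by metis
  obtain V where V: "openin Y V" "y \<in> V" "\<And>z x. z \<in> V \<Longrightarrow> x \<in> support y \<Longrightarrow> support z \<inter> N x \<noteq> {}"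
    by (rule support_meets_disjoint_nbhds[OF y N(1,2)]) (assumption+, rule that)
  have "card (support y) \<le> card (support z)" if z: "z \<in> V" for z
  proof -
    have "\<forall>x\<in>support y. \<exists>u. u \<in> support z \<inter> N x" using V(3)[OF z] by blast
    then obtain \<xi> where xi: "\<And>x. x \<in> support y \<Longrightarrow> \<xi> x \<in> support z \<inter> N x" by metis
    have "inj_on \<xi> (support y)"
      using xi N(3) by (intro inj_onI) (metis Int_iff empty_iff)
    moreover have "\<xi> ` support y \<subseteq> support z" using xi by blast
    moreover have "finite (support z)" using z V(1) openin_subset finite_support by blast
    ultimately show ?thesis by (rule card_inj_on_le)
  qed
  with V(1,2) show thesis by (rule that)
qed

text \<open>Too many functionals with one finite support satisfy a linear relation. Applied to a function \<open>f\<close> for which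
  \<open>q \<mapsto> \<mu> q f\<close> is \<open>1\<close> at one of the points and \<open>0\<close> at the others, it makes the coefficient of that point vanish.\<close>
lemma not_constant_support:
  assumes Q: "Q \<subseteq> topspace Y" "infinite Q" and S: "\<And>q. q \<in> Q \<Longrightarrow> support q = S"
  shows False
proof -
  obtain Q' where Q': "Q' \<subseteq> Q" "finite Q'" "card Q' = Suc (card S)"
    using infinite_arbitrarily_large[OF Q(2)] by blast
  have "Q' \<noteq> {}" using Q'(3) by auto
  then obtain q where "q \<in> Q" using Q'(1) by blast
  then have finS: "finite S" using finite_support Q(1) S by blast
  have "\<exists>a. \<forall>f. real_continuous X f \<longrightarrow> \<mu> q f = (\<Sum>x\<in>S. a x * f x)" if q: "q \<in> Q" for q
  proof -
    obtain a where "\<forall>f. real_continuous X f \<longrightarrow> \<mu> q f = (\<Sum>x\<in>support q. a x * f x)"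
      using support[of q] q Q(1) by blast
    then show ?thesis using S[OF q] by auto
  qed
  then obtain a where a: "\<And>q f. q \<in> Q \<Longrightarrow> real_continuous X f \<Longrightarrow> \<mu> q f = (\<Sum>x\<in>S. a q x * f x)"
    by metis
  obtain c where c: "\<exists>q\<in>Q'. c q \<noteq> 0" "\<forall>x\<in>S. (\<Sum>q\<in>Q'. c q * a q x) = 0"
    using nontrivial_linear_relation[OF finS Q'(2), of a] Q'(3) by auto
  then obtain p where p: "p \<in> Q'" "c p \<noteq> 0" by blast
  have pY: "p \<in> topspace Y" using p Q' Q by blast
  obtain g where g: "real_continuous Y g" "g p = 1"
      "\<forall>z\<in>topspace Y. z \<notin> topspace Y \<or> z \<in> Q' - {p} \<longrightarrow> g z = 0"
    using Tychonoff_separating_function[OF Tychonoff_Y openin_topspace pY, of "Q' - {p}"] Q' Q by auto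
  obtain f where f: "real_continuous X f" "\<forall>y\<in>topspace Y. \<mu> y f = g y"
    using surjective[OF g(1)] by blast
  have "(\<Sum>q\<in>Q'. c q * g q) = (\<Sum>q\<in>Q'. if q = p then c p else 0)"
    using g Q' Q by (intro sum.cong) auto
  then have "(\<Sum>q\<in>Q'. c q * g q) = c p" using p Q' by simp
  moreover have "(\<Sum>q\<in>Q'. c q * g q) = (\<Sum>q\<in>Q'. \<Sum>x\<in>S. f x * (c q * a q x))"
  proof (rule sum.cong[OF refl])
    fix q assume q: "q \<in> Q'"
    then have "q \<in> Q" "q \<in> topspace Y" using Q'(1) Q(1) by auto
    then have "g q = (\<Sum>x\<in>S. a q x * f x)" using a[of q f] f by auto
    then show "c q * g q = (\<Sum>x\<in>S. f x * (c q * a q x))" by (simp add: sum_distrib_left ac_simps)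
  qed
  moreover have "\<dots> = (\<Sum>x\<in>S. f x * (\<Sum>q\<in>Q'. c q * a q x))"
    by (subst sum.swap) (simp add: sum_distrib_left)
  ultimately show False using c(2) p(2) by simp
qed

text \<open>Open sets \<open>G\<close> that meet \<open>A\<close> play the role of nonempty relatively open sets; since \<open>A\<close> has no isolated point,
  they meet it in infinitely many points. They are shrunk in three stages: first until the supports have
  bounded size, then until each support has exactly one point \<open>\<xi> z x\<close> in each of the disjoint neighbourhoods \<open>N x\<close> of the
  points \<open>x\<close> of one support of maximal size, and last, one \<open>x\<close> at a time, until \<open>\<xi> z x\<close> does not depend on \<open>z\<close>.\<close>
theorem scattered_target:
  assumes Y: "compact_space Y" and X: "scattered_space X"
  shows "scattered_space Y"
proof (rule ccontr)
  assume "\<not> scattered_space Y"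
  then obtain A where A: "A \<subseteq> topspace Y" "A \<noteq> {}" "\<And>x. x \<in> A \<Longrightarrow> \<not> openin (subtopology Y A) {x}"
    unfolding scattered_space_def by meson
  have hX: "Hausdorff_space X" and hY: "Hausdorff_space Y"
    using Tychonoff_X Tychonoff_Y by (auto simp: Tychonoff_space_def)
  have inf: "infinite (G \<inter> A)" if G: "openin Y G" "G \<inter> A \<noteq> {}" for G
  proof
    assume fin: "finite (G \<inter> A)"
    obtain x where x: "x \<in> G" "x \<in> A" using G by blast
    have "closedin Y (G \<inter> A - {x})"
      using fin A(1) by (intro closedin_Hausdorff_finite hY) auto
    then have "openin Y (G - (G \<inter> A - {x}))" using G(1) by (intro openin_diff)
    then have "openin (subtopology Y A) ((G - (G \<inter> A - {x})) \<inter> A)" by (rule openin_subtopology_Int)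
    moreover have "(G - (G \<inter> A - {x})) \<inter> A = {x}" using x by auto
    ultimately show False using A(3)[OF x(2)] by simp
  qed
  \<comment> \<open>The closure of \<open>A\<close> is compact, hence a Baire space, and it is the
    union of the closed sets \<open>E n\<close> of points with support of size at most \<open>n\<close>.\<close>
  obtain G0 n where G0: "openin Y G0" "G0 \<inter> A \<noteq> {}" "\<And>y. y \<in> G0 \<inter> A \<Longrightarrow> card (support y) \<le> n"
  proof -
    define P where "P = subtopology Y (Y closure_of A)"
    have topP: "topspace P = Y closure_of A"
      by (simp add: P_def closure_of_subset_topspace Int_absorb1)
    have "closedin Y (Y closure_of A)" by simp
    then have cP: "compact_space P"
      unfolding P_def using Y closedin_compact_space compact_space_subtopology by blast
    have hP: "Hausdorff_space P" unfolding P_def by (rule Hausdorff_space_subtopology[OF hY])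
    have P: "locally_compact_space P \<and> regular_space P"
      using cP hP compact_imp_locally_compact_space compact_Hausdorff_imp_regular_space by blast
    define E where "E n = {y \<in> topspace P. card (support y) \<le> n}" for n
    have cl: "closedin P (E n)" for n
      unfolding closedin_def
    proof (intro conjI)
      show "E n \<subseteq> topspace P" by (auto simp: E_def)
      show "openin P (topspace P - E n)"
      proof (subst openin_subopen, intro ballI)
        fix y assume "y \<in> topspace P - E n"
        then have y: "y \<in> topspace P" "card (support y) > n" by (auto simp: E_def)
        have yY: "y \<in> topspace Y" using y(1) closure_of_subset_topspace[of Y A] unfolding topP by (rule set_mp[rotated])
        obtain V where V: "openin Y V" "y \<in> V" "\<And>z. z \<in> V \<Longrightarrow> card (support y) \<le> card (support z)"
          by (rule card_support_lower_semicontinuous[OF yY]) (rule that)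
        have "openin P (V \<inter> Y closure_of A)" unfolding P_def by (rule openin_subtopology_Int[OF V(1)])
        moreover have "V \<inter> Y closure_of A \<subseteq> topspace P - E n"
          using V(3) y(2) by (force simp: E_def topP)
        ultimately show "\<exists>T. openin P T \<and> y \<in> T \<and> T \<subseteq> topspace P - E n"
          using V(2) y(1) topP by blast
      qed
    qed
    have "\<exists>n. P interior_of (E n) \<noteq> {}"
    proof (rule ccontr)
      assume "\<not> ?thesis"
      then have "P interior_of \<Union>(range E) = {}"
        using cl by (intro Baire_category_alt disjI2 P) auto
      moreover have "\<Union>(range E) = topspace P" by (auto simp: E_def)
      ultimately have "topspace P = {}" by simp
      then show False using A(2) closure_of_subset[OF A(1)] topP by blast
    qed
    then obtain n y where "y \<in> P interior_of (E n)" by blast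
    then obtain T where T: "openin P T" "y \<in> T" "T \<subseteq> E n" unfolding interior_of_def by blast
    obtain G where G: "openin Y G" "T = G \<inter> Y closure_of A"
      using T(1) unfolding P_def openin_subtopology by blast
    have "y \<in> G" "y \<in> Y closure_of A" using T(2) G(2) by auto
    then have "G \<inter> A \<noteq> {}" using G(1) unfolding in_closure_of by blast
    moreover have "card (support z) \<le> n" if "z \<in> G \<inter> A" for z
      using that T(3) G(2) closure_of_subset[OF A(1)] by (auto simp: E_def)
    ultimately show thesis using G(1) by (intro that)
  qed
  define m where "m = Max ((\<lambda>y. card (support y)) ` (G0 \<inter> A))"
  have finm: "finite ((\<lambda>y. card (support y)) ` (G0 \<inter> A))"
    using G0(3) by - (rule finite_subset[of _ "{..n}"], auto)
  have "m \<in> (\<lambda>y. card (support y)) ` (G0 \<inter> A)" unfolding m_def using finm G0(2) by (intro Max_in) auto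
  then obtain y where y: "y \<in> G0" "y \<in> A" "m = card (support y)" by auto
  have m: "card (support z) \<le> card (support y)" if "z \<in> G0 \<inter> A" for z
    using finm that unfolding y(3)[symmetric] m_def by (intro Max_ge) auto
  have yY: "y \<in> topspace Y" using y A by blast
  define F where "F = support y"
  have F: "finite F" unfolding F_def by (rule finite_support[OF yY])
  from Hausdorff_finite_disjoint_nbhds[OF hX finite_support[OF yY] support_subset[OF yY]]
  obtain N where N: "\<And>x. x \<in> F \<Longrightarrow> openin X (N x)" "\<And>x. x \<in> F \<Longrightarrow> x \<in> N x"
    "\<And>x z. x \<in> F \<Longrightarrow> z \<in> F \<Longrightarrow> x \<noteq> z \<Longrightarrow> N x \<inter> N z = {}" unfolding F_def by metis
  obtain V where "openin Y V" "y \<in> V" "\<And>z x. z \<in> V \<Longrightarrow> x \<in> support y \<Longrightarrow> support z \<inter> N x \<noteq> {}"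
    by (rule support_meets_disjoint_nbhds[OF yY N(1,2)[unfolded F_def]]) (assumption+, rule that)
  note V = this[folded F_def]
  define G1 where "G1 = G0 \<inter> V"
  have G1: "openin Y G1" "G1 \<inter> A \<noteq> {}" using G0 V y by (auto simp: G1_def)
  define \<xi> where "\<xi> z x = (SOME u. u \<in> support z \<inter> N x)" for z x
  have xi: "\<xi> z x \<in> support z" "\<xi> z x \<in> N x" if "z \<in> G1" "x \<in> F" for z x
  proof -
    have "\<exists>u. u \<in> support z \<inter> N x" using V(3)[of z x] that by (auto simp: G1_def)
    then have "\<xi> z x \<in> support z \<inter> N x" unfolding \<xi>_def by (rule someI_ex)
    then show "\<xi> z x \<in> support z" "\<xi> z x \<in> N x" by auto
  qed
  have supp: "support z = \<xi> z ` F" if z: "z \<in> G1 \<inter> A" for z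
  proof -
    have "inj_on (\<xi> z) F"
      using xi N(3) z by (intro inj_onI) (metis Int_iff empty_iff)
    then have "card (\<xi> z ` F) = card F" by (rule card_image)
    moreover have "card (support z) \<le> card F" using m[of z] z by (simp add: G1_def F_def)
    moreover have "\<xi> z ` F \<subseteq> support z" using xi z by blast
    moreover have "finite (support z)" using finite_support z A(1) by blast
    ultimately show ?thesis using card_seteq by metis
  qed
  have uniq: "u = \<xi> z x" if u: "z \<in> G1 \<inter> A" "x \<in> F" "u \<in> support z" "u \<in> N x" for u z x
  proof -
    obtain x' where x': "x' \<in> F" "u = \<xi> z x'" using supp[OF u(1)] u(3) by blast
    have "x' = x"
    proof (rule ccontr)
      assume "x' \<noteq> x"
      then show False using N(3)[OF x'(1) u(2)] xi(2)[of z x'] x' u by auto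
    qed
    then show ?thesis using x' by simp
  qed
  have "\<exists>G c. openin Y G \<and> G \<subseteq> G1 \<and> G \<inter> A \<noteq> {} \<and> (\<forall>z\<in>G \<inter> A. \<forall>x\<in>F'. \<xi> z x = c x)"
    if "F' \<subseteq> F" for F'
    using finite_subset[OF that F] that
  proof (induction F')
    case empty
    then show ?case using G1 by blast
  next
    case (insert x F')
    then obtain G c where G: "openin Y G" "G \<subseteq> G1" "G \<inter> A \<noteq> {}" "\<forall>z\<in>G \<inter> A. \<forall>x\<in>F'. \<xi> z x = c x" by auto
    have x: "x \<in> F" using insert by simp
    define B where "B = (\<lambda>z. \<xi> z x) ` (G \<inter> A)"
    have "B \<subseteq> topspace X"
      using xi(1)[OF _ x] support_subset A(1) G(2) unfolding B_def by blast
    moreover have "B \<noteq> {}" using G(3) by (simp add: B_def)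
    \<comment> \<open>As \<open>X\<close> is scattered, the values of \<open>\<xi> z x\<close> have an isolated
      one, \<open>b\<close>; by lower semicontinuity the value near \<open>b\<close>, which can only be \<open>b\<close>, persists on an open set.\<close>
    ultimately obtain b where b: "b \<in> B" "openin (subtopology X B) {b}"
      using X unfolding scattered_space_def by blast
    obtain T where T: "openin X T" "{b} = T \<inter> B" using b(2) unfolding openin_subtopology by blast
    obtain z where z: "z \<in> G \<inter> A" "b = \<xi> z x" using b(1) by (auto simp: B_def)
    have zY: "z \<in> topspace Y" using z A by blast
    have "openin X (N x \<inter> T)" using N(1)[OF x] T(1) by (rule openin_Int)
    moreover have "support z \<inter> (N x \<inter> T) \<noteq> {}"
      using xi[of z x] z x G(2) T(2) by blast
    ultimately obtain U where U: "openin Y U" "z \<in> U" "\<And>u. u \<in> U \<Longrightarrow> support u \<inter> (N x \<inter> T) \<noteq> {}"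
      by (rule support_lower_semicontinuous[OF zY]) (rule that)
    have "\<xi> u x = b" if u: "u \<in> G \<inter> U \<inter> A" for u
    proof -
      obtain v where v: "v \<in> support u" "v \<in> N x" "v \<in> T" using U(3)[of u] u by blast
      have "v = \<xi> u x" using u G(2) v by (intro uniq x) auto
      then have "\<xi> u x \<in> T \<inter> B" using v u by (auto simp: B_def)
      then show ?thesis using T(2) by blast
    qed
    then have "\<forall>u\<in>G \<inter> U \<inter> A. \<forall>x'\<in>insert x F'. \<xi> u x' = (c(x := b)) x'"
      using G(4) insert(2) by auto
    moreover have "openin Y (G \<inter> U)" "G \<inter> U \<subseteq> G1" "G \<inter> U \<inter> A \<noteq> {}" using G U z by auto
    ultimately show ?case by blast
  qed
  from this[of F] obtain G c where G: "openin Y G" "G \<subseteq> G1" "G \<inter> A \<noteq> {}" "\<forall>z\<in>G \<inter> A. \<forall>x\<in>F. \<xi> z x = c x" by auto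
  show False
  proof (rule not_constant_support[of "G \<inter> A" "c ` F"])
    show "G \<inter> A \<subseteq> topspace Y" using A by blast
    show "infinite (G \<inter> A)" by (rule inf[OF G(1,3)])
    show "support q = c ` F" if "q \<in> G \<inter> A" for q
      using supp[of q] that G(2,4) by auto
  qed
qed

end

lemma topspace_Cp: "topspace (Cp X) = {f \<in> extensional (topspace X). real_continuous X f}"
  by (auto simp: Cp_def PiE_def)

lemma restrict_in_Cp:
  assumes "real_continuous X f"
  shows "restrict f (topspace X) \<in> topspace (Cp X)"
proof -
  have "real_continuous X (restrict f (topspace X))"
    by (rule continuous_map_eq[OF assms]) simp
  then show ?thesis by (simp add: topspace_Cp)
qed

text \<open>Only \<open>finite_bound\<close> takes work: a basic neighbourhood of the zero function mapped to functions of modulus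
  less than \<open>1\<close> at \<open>y\<close> restricts finitely many values, and \<open>\<mu> y\<close> is homogeneous.\<close>
lemma l_dominated_imp_linear_domination:
  assumes X: "Tychonoff_space X" and Y: "Tychonoff_space Y" and dom: "l_dominated_by Y X"
  obtains \<mu> where "linear_domination X Y \<mu>"
proof -
  obtain \<phi> where phi: "continuous_map (Cp X) (Cp Y) \<phi>" "\<phi> ` topspace (Cp X) = topspace (Cp Y)"
    "\<forall>f\<in>topspace (Cp X). \<forall>g\<in>topspace (Cp X). \<phi> (\<lambda>x\<in>topspace X. f x + g x) = (\<lambda>y\<in>topspace Y. \<phi> f y + \<phi> g y)"
    "\<forall>c. \<forall>f\<in>topspace (Cp X). \<phi> (\<lambda>x\<in>topspace X. c * f x) = (\<lambda>y\<in>topspace Y. c * \<phi> f y)"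
    using dom unfolding l_dominated_by_def by blast
  define \<mu> where "\<mu> y f = \<phi> (restrict f (topspace X)) y" for y f
  have add: "\<mu> y (\<lambda>x. f x + g x) = \<mu> y f + \<mu> y g"
    if "y \<in> topspace Y" "real_continuous X f" "real_continuous X g" for y f g
  proof -
    have "(\<lambda>x\<in>topspace X. restrict f (topspace X) x + restrict g (topspace X) x) = restrict (\<lambda>x. f x + g x) (topspace X)"
      by auto
    then have "\<phi> (restrict (\<lambda>x. f x + g x) (topspace X)) =
        (\<lambda>y\<in>topspace Y. \<phi> (restrict f (topspace X)) y + \<phi> (restrict g (topspace X)) y)"
      using phi(3) restrict_in_Cp[OF that(2)] restrict_in_Cp[OF that(3)] by metis
    then show ?thesis using that(1) by (simp add: \<mu>_def)
  qed
  have scale: "\<mu> y (\<lambda>x. c * f x) = c * \<mu> y f"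
    if "y \<in> topspace Y" "real_continuous X f" for y c f
  proof -
    have "(\<lambda>x\<in>topspace X. c * restrict f (topspace X) x) = restrict (\<lambda>x. c * f x) (topspace X)"
      by auto
    then have "\<phi> (restrict (\<lambda>x. c * f x) (topspace X)) = (\<lambda>y\<in>topspace Y. c * \<phi> (restrict f (topspace X)) y)"
      using phi(4) restrict_in_Cp[OF that(2)] by metis
    then show ?thesis using that(1) by (simp add: \<mu>_def)
  qed
  have "linear_domination X Y \<mu>"
  proof
    show "Tychonoff_space X" "Tychonoff_space Y" by (rule X, rule Y)
    show "\<mu> y (\<lambda>x. f x + g x) = \<mu> y f + \<mu> y g"
      if "y \<in> topspace Y" "real_continuous X f" "real_continuous X g" for y f g
      by (rule add[OF that])
    show "\<mu> y (\<lambda>x. c * f x) = c * \<mu> y f"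
      if "y \<in> topspace Y" "real_continuous X f" for y c f
      by (rule scale[OF that])
    show "real_continuous Y (\<lambda>y. \<mu> y f)" if "real_continuous X f" for f
    proof -
      have "\<phi> (restrict f (topspace X)) \<in> topspace (Cp Y)"
        using restrict_in_Cp[OF that] phi(2) by blast
      then show ?thesis by (simp add: topspace_Cp \<mu>_def)
    qed
    show "\<exists>f. real_continuous X f \<and> (\<forall>y\<in>topspace Y. \<mu> y f = h y)"
      if h: "real_continuous Y h" for h
    proof -
      obtain f where f: "f \<in> topspace (Cp X)" "\<phi> f = restrict h (topspace Y)"
        using restrict_in_Cp[OF h] phi(2) by (metis imageE)
      then have "restrict f (topspace X) = f" "real_continuous X f"
        by (auto simp: topspace_Cp extensional_restrict)
      then show ?thesis using f(2) by (intro exI[of _ f]) (simp add: \<mu>_def)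
    qed
    show "\<exists>F C. finite F \<and> F \<subseteq> topspace X \<and> 0 \<le> C \<and>
        (\<forall>f. real_continuous X f \<longrightarrow> \<bar>\<mu> y f\<bar> \<le> C * (\<Sum>x\<in>F. \<bar>f x\<bar>))" if y: "y \<in> topspace Y" for y
    proof -
      have "continuous_map (Cp Y) euclideanreal (\<lambda>g. g y)"
        unfolding Cp_def by (intro continuous_map_from_subtopology continuous_map_product_projection y)
      then have "continuous_map (Cp X) euclideanreal ((\<lambda>g. g y) \<circ> \<phi>)"
        using phi(1) continuous_map_compose by blast
      then have "openin (Cp X) {f \<in> topspace (Cp X). ((\<lambda>g. g y) \<circ> \<phi>) f \<in> ball 0 1}"
        by (rule openin_real_preimage) (rule open_ball)
      then obtain T where T: "openin (product_topology (\<lambda>_. euclideanreal) (topspace X)) T"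
          "{f \<in> topspace (Cp X). \<phi> f y \<in> ball 0 1} = T \<inter> {f. real_continuous X f}"
        unfolding Cp_def openin_subtopology by auto
      define z where "z = restrict (\<lambda>_. 0 :: real) (topspace X)"
      have "\<phi> z y = 0"
        using scale[OF y, of "\<lambda>_. 0" 0] by (simp add: \<mu>_def z_def)
      moreover have "z \<in> topspace (Cp X)" unfolding z_def by (rule restrict_in_Cp) simp
      ultimately have "z \<in> {f \<in> topspace (Cp X). \<phi> f y \<in> ball 0 1}" by simp
      then have "z \<in> T" unfolding T(2) by blast
      then obtain B where B: "z \<in> (\<Pi>\<^sub>E i\<in>topspace X. B i)" "\<And>i. open (B i)" "finite {i. B i \<noteq> UNIV}"
          "(\<Pi>\<^sub>E i\<in>topspace X. B i) \<subseteq> T"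
        using product_topology_open_contains_basis[OF T(1) \<open>z \<in> T\<close>] by auto
      define F where "F = {i. B i \<noteq> UNIV} \<inter> topspace X"
      have F: "finite F" "F \<subseteq> topspace X" using B(3) by (auto simp: F_def)
      have "\<exists>d>0. ball 0 d \<subseteq> B i" if "i \<in> F" for i
      proof -
        have "0 \<in> B i" using B(1) that F(2) by (auto simp: z_def PiE_iff)
        then show ?thesis using B(2) open_contains_ball_eq by blast
      qed
      then obtain d where d: "\<And>i. i \<in> F \<Longrightarrow> d i > 0" "\<And>i. i \<in> F \<Longrightarrow> ball 0 (d i) \<subseteq> B i" by metis
      define \<delta> where "\<delta> = Min (insert 1 (d ` F))"
      have \<delta>: "\<delta> > 0" using F d by (simp add: \<delta>_def)
      have near: "\<bar>\<mu> y f\<bar> < 1" if f: "real_continuous X f" "\<And>x. x \<in> F \<Longrightarrow> \<bar>f x\<bar> < \<delta>" for f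
      proof -
        let ?f = "restrict f (topspace X)"
        have "?f i \<in> B i" if "i \<in> topspace X" for i
        proof (cases "i \<in> F")
          case True
          then have "\<bar>f i\<bar> < d i" using f(2)[OF True] F(1) by (auto simp: \<delta>_def)
          then show ?thesis using d(2)[OF True] that by auto
        qed (use that in \<open>auto simp: F_def\<close>)
        then have "?f \<in> T" using B(4) by auto
        moreover have "?f \<in> topspace (Cp X)" by (rule restrict_in_Cp[OF f(1)])
        ultimately have "?f \<in> {f \<in> topspace (Cp X). \<phi> f y \<in> ball 0 1}"
          unfolding T(2) by (simp add: topspace_Cp)
        then show ?thesis by (simp add: \<mu>_def)
      qed
      have "\<bar>\<mu> y f\<bar> \<le> (1 / \<delta>) * (\<Sum>x\<in>F. \<bar>f x\<bar>)" if f: "real_continuous X f" for f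
      proof (rule dense_ge)
        fix r assume r: "(1 / \<delta>) * (\<Sum>x\<in>F. \<bar>f x\<bar>) < r"
        have s0: "(\<Sum>x\<in>F. \<bar>f x\<bar>) \<ge> 0" by (rule sum_nonneg) simp
        have "(1 / \<delta>) * (\<Sum>x\<in>F. \<bar>f x\<bar>) \<ge> 0" using s0 \<delta> by simp
        then have rpos: "r > 0" using r by linarith
        have "\<bar>\<mu> y (\<lambda>x. (1 / r) * f x)\<bar> < 1"
        proof (rule near)
          show "real_continuous X (\<lambda>x. (1 / r) * f x)" by (rule continuous_map_real_mult_left[OF f])
          fix x assume "x \<in> F"
          then have "\<bar>f x\<bar> \<le> (\<Sum>x\<in>F. \<bar>f x\<bar>)" using F(1) by (intro member_le_sum) auto
          also have "\<dots> < r * \<delta>" using r \<delta> by (simp add: field_simps)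
          finally show "\<bar>(1 / r) * f x\<bar> < \<delta>" using rpos by (simp add: abs_mult field_simps)
        qed
        then have "\<bar>(1 / r) * \<mu> y f\<bar> < 1" by (simp only: scale[OF y f])
        then show "\<bar>\<mu> y f\<bar> \<le> r" using rpos by (simp add: abs_mult field_simps)
      qed
      then show ?thesis using F \<delta> by (intro exI[of _ F] exI[of _ "1 / \<delta>"]) auto
    qed
  qed
  then show thesis by (rule that)
qed

theorem proposition3p10:
  fixes X :: "'a topology" and Y :: "'b topology"
  assumes "Tychonoff_space X" and "Tychonoff_space Y" and "l_dominated_by Y X"
  shows "(Eberlein_compact_in TYPE('v) X \<longrightarrow> Eberlein_compact_in TYPE(('b \<Rightarrow> real) \<Rightarrow> real) Y) \<and>
         (Eberlein_compact_in TYPE('v) X \<and> scattered_space X \<longrightarrow>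
            Eberlein_compact_in TYPE(('b \<Rightarrow> real) \<Rightarrow> real) Y \<and> scattered_space Y)"
proof -
  obtain \<mu> where "linear_domination X Y \<mu>"
    by (rule l_dominated_imp_linear_domination[OF assms])
  then interpret linear_domination X Y \<mu> .
  show ?thesis using Eberlein_compact_target scattered_target by blast
qed

end
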